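(* Let $m\in\mathbb N$. Let a homogeneous polynomial $X$ belong to $\Pi_k$, $1\le k\le 2m-1$. Let $A$ be an isotropic dilation matrix, and let $W(\xi)=\xi^TQ^2\xi$ be the associated quadratic form. Let masks ${}^jm_0$, $j\in\mathbb Z$, be given by $${}^jm_0(\xi)=\frac{\prod_{s\in\mathcal S(A^T)\setminus\{0\}}{}^jG(\xi+2\pi s)}{\prod_{s\in\mathcal S(A^T)\setminus\{0\}}{}^jG(2\pi s)},$$ where ${}^jG$ are trigonometric polynomials such that the Maclaurin series of ${}^jG\left((A^{-T})^j\,\cdot\right)$ are of the form $${}^jG\left((A^{-T})^j\xi\right)=C_j\left(X(\xi)+W(\xi)^m\right)+{}^jR_{>2m}\left((A^{-T})^j\xi\right),$$ where $C_j$ is a constant factor that depends on the scale $j$ and ${}^jR_{>2m}$ is a power series of order greater than $2m$. Moreover, suppose that $$\Pi\cap\left(\ker X(-iD)\setminus\ker W(-iD)^m\right)\neq\emptyset .$$ Then the nonstationary elliptic scaling function $\phi$ (of zero scale) corresponding to the dilation matrix $A$ and these masks can reproduce not scale-invariant (only shift-invariant) polynomial spaces.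
   Context: Polynomial spaces, and the spans that contain them, are considered over $\mathbb R$. $\Pi$ is the space of all polynomials on $\mathbb R^d$, and $\Pi_k$ is the linear span over $\mathbb R$ of the monomials $x^\alpha$, $\alpha\in\mathbb Z^d_{\ge0}$, $|\alpha|=k$. For a polynomial $P$, $P(-iD)$ is the differential operator obtained by substituting $-iD_n$ for the $n$th variable, where $D_n$ is the partial derivative with respect to the $n$th coordinate; $\ker P(-iD)$ is its null-space. The order of a power series $\sum_{\kappa\in\mathbb Z^d_{\ge0}}a_\kappa x^\kappa$, $a_\kappa\in\mathbb R$, is the least $|\kappa|$ with $a_\kappa\neq0$. A dilation matrix is a real $d\times d$ matrix with integer entries all of whose eigenvalues are greater than $1$ in absolute value. A square matrix is isotropic if it is diagonalizable over $\mathbb C$ and all its eigenvalues are equal in absolute value. For an isotropic dilation matrix $A$, put $q=|\det A|$ and $A^{-T}=(A^T)^{-1}$; then $A^{-T}$ can be factored as $A^{-T}=q^{-1/d}Q^{-1}UQ$ with $U$ orthogonal and $Q$ real symmetric positive definite ($Q$ is determined within a constant factor), and this defines the positive definite quadratic form $W(\xi)=\xi^TQ^2\xi$, $\xi\in\mathbb R^d$. $\mathcal S(A^T)\subset[0,1)^d$ is the set of points such that $A^T\mathcal S(A^T)\subset\mathbb Z^d$ is a set of representatives of the quotient $\mathbb Z^d/A^T\mathbb Z^d$. It is supposed that ${}^jG(2\pi s)\neq0$ for all $s\in\mathcal S(A^T)\setminus\{0\}$ and all $j$. The nonstationary scaling functions ${}^n\phi$ satisfy, in the Fourier domain, ${}^n\hat\phi(\xi)={}^{n+1}m_0(A^{-T}\xi)\;{}^{n+1}\hat\phi(A^{-T}\xi)$,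 and ${}^n\hat\phi(\xi)=\prod_{j=1}^\infty{}^{n+j}m_0\left((A^{-T})^j\xi\right)$, where $\hat f(\xi)=(2\pi)^{-d/2}\int_{\mathbb R^d}f(x)e^{-i\xi\cdot x}\,dx$ (extended to compactly supported tempered distributions); $\phi={}^0\phi$ is the scaling function of zero scale. A function $\phi$ reproduces a polynomial space if that space is contained in the span of the integer shifts $\phi(\cdot-k)$, $k\in\mathbb Z^d$ (infinite combinations allowed). A polynomial space is shift-invariant if it is closed under $P\mapsto P(\cdot+h)$ for all $h\in\mathbb R^d$, and scale-invariant if it is closed under $P\mapsto P(\lambda\,\cdot)$ for all real $\lambda\neq0$.
   Formalization: X and all C_j are nonzero; either the trigonometric polynomials jG have real coefficients and spaces and spans are over ℝ, or the jG are arbitrary and spaces and spans are over ℂ (over ℝ the claim fails for complex jG); the product converges locally uniformly on ℂ^d. *)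

theory Defs
  imports "HOL-Analysis.Analysis" "HOL-Library.Poly_Mapping"
begin

section \<open>Embeddings into complex space\<close>

definition cvec :: "real ^ 'n \<Rightarrow> complex ^ 'n" where
  "cvec x = (\<chi> i. of_real (x $ i))"

definition cmat :: "real ^ 'n ^ 'm \<Rightarrow> complex ^ 'n ^ 'm" where
  "cmat M = (\<chi> i j. of_real (M $ i $ j))"

definition ivec :: "int ^ 'n \<Rightarrow> real ^ 'n" where
  "ivec k = (\<chi> i. of_int (k $ i))"


section \<open>Isotropic dilation matrices\<close>

definition eigenvalue_of :: "complex ^ 'n ^ 'n \<Rightarrow> complex \<Rightarrow> bool" where
  "eigenvalue_of M \<mu> \<longleftrightarrow> (\<exists>v. v \<noteq> 0 \<and> M *v v = \<mu> *s v)"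

definition dilation_matrix :: "real ^ 'n ^ 'n \<Rightarrow> bool" where
  "dilation_matrix A \<longleftrightarrow>
     (\<forall>i j. A $ i $ j \<in> \<int>) \<and> (\<forall>\<mu>. eigenvalue_of (cmat A) \<mu> \<longrightarrow> cmod \<mu> > 1)"

definition diagonalizable :: "complex ^ 'n ^ 'n \<Rightarrow> bool" where
  "diagonalizable M \<longleftrightarrow>
     (\<exists>B D :: complex ^ 'n ^ 'n. invertible B \<and>
       (\<forall>i j. i \<noteq> j \<longrightarrow> D $ i $ j = 0) \<and> M = B ** D ** matrix_inv B)"

definition isotropic :: "real ^ 'n ^ 'n \<Rightarrow> bool" where
  "isotropic A \<longleftrightarrow> diagonalizable (cmat A) \<and>
     (\<exists>r. \<forall>\<mu>. eigenvalue_of (cmat A) \<mu> \<longrightarrow> cmod \<mu> = r)"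

definition inv_transp :: "real ^ 'n ^ 'n \<Rightarrow> real ^ 'n ^ 'n" where
  "inv_transp A = matrix_inv (transpose A)"

definition mat_powi :: "real ^ 'n ^ 'n \<Rightarrow> int \<Rightarrow> real ^ 'n ^ 'n" where
  "mat_powi M j = (if 0 \<le> j then (((**) M) ^^ nat j) (mat 1)
                   else (((**) (matrix_inv M)) ^^ nat (- j)) (mat 1))"

definition sym_pos_def :: "real ^ 'n ^ 'n \<Rightarrow> bool" where
  "sym_pos_def Q \<longleftrightarrow> transpose Q = Q \<and> (\<forall>x. x \<noteq> 0 \<longrightarrow> x \<bullet> (Q *v x) > 0)"

definition isotropic_factorization ::
    "real ^ 'n ^ 'n \<Rightarrow> real ^ 'n ^ 'n \<Rightarrow> real ^ 'n ^ 'n \<Rightarrow> bool" where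
  "isotropic_factorization A U Q \<longleftrightarrow> orthogonal_matrix U \<and> sym_pos_def Q \<and>
     inv_transp A =
       (\<bar>det A\<bar> powr (- 1 / real CARD('n))) *\<^sub>R (matrix_inv Q ** U ** Q)"

text \<open>The set \<open>S(M)\<close> for \<open>M\<close> the transpose of the dilation matrix: the points \<open>M s\<close> are
  integer and meet every coset of \<open>M \<int>\<^sup>d\<close> exactly once.\<close>

definition digit_set :: "real ^ 'n ^ 'n \<Rightarrow> (real ^ 'n) set \<Rightarrow> bool" where
  "digit_set M S \<longleftrightarrow>
     (\<forall>s\<in>S. \<forall>i. 0 \<le> s $ i \<and> s $ i < 1) \<and>
     (\<forall>s\<in>S. M *v s \<in> range ivec) \<and>
     (\<forall>l. \<exists>!s. s \<in> S \<and> ivec l - M *v s \<in> (\<lambda>n. M *v ivec n) ` UNIV)"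


section \<open>Polynomials, differential operators, power series\<close>

definition mdeg :: "nat ^ 'n \<Rightarrow> nat" where
  "mdeg \<alpha> = (\<Sum>i\<in>UNIV. \<alpha> $ i)"

definition mono_at :: "nat ^ 'n \<Rightarrow> real ^ 'n \<Rightarrow> real" where
  "mono_at \<alpha> x = (\<Prod>i\<in>UNIV. x $ i ^ (\<alpha> $ i))"

text \<open>Symbols of differential operators are kept as coefficient families \<open>(nat ^ 'n) \<Rightarrow>\<^sub>0 real\<close>,
  with the ring structure of \<^theory>\<open>HOL-Library.Poly_Mapping\<close>.\<close>

definition poly_at :: "((nat ^ 'n) \<Rightarrow>\<^sub>0 real) \<Rightarrow> real ^ 'n \<Rightarrow> real" where
  "poly_at P x = (\<Sum>\<alpha>\<in>Poly_Mapping.keys P. Poly_Mapping.lookup P \<alpha> * mono_at \<alpha> x)"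

definition homog_polys :: "nat \<Rightarrow> ((nat ^ 'n) \<Rightarrow>\<^sub>0 real) set" where
  "homog_polys k = {P. \<forall>\<alpha>\<in>Poly_Mapping.keys P. mdeg \<alpha> = k}"

definition W_poly :: "real ^ 'n ^ 'n \<Rightarrow> ((nat ^ 'n) \<Rightarrow>\<^sub>0 real)" where
  "W_poly Q = (\<Sum>i\<in>UNIV. \<Sum>j\<in>UNIV.
     Poly_Mapping.single (axis i 1 + axis j 1) ((Q ** Q) $ i $ j))"

definition pd :: "'n \<Rightarrow> (real ^ 'n \<Rightarrow> complex) \<Rightarrow> real ^ 'n \<Rightarrow> complex" where
  "pd i f x = vector_derivative (\<lambda>t. f (x + t *\<^sub>R axis i 1)) (at 0)"

definition smooth :: "(real ^ 'n \<Rightarrow> complex) \<Rightarrow> bool" where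
  "smooth f \<longleftrightarrow> (\<forall>is x. foldr pd is f differentiable (at x))"

text \<open>The chosen order of the coordinates is immaterial on smooth functions.\<close>

definition coord_list :: "'n::finite list" where
  "coord_list = (SOME is. distinct is \<and> set is = UNIV)"

definition mpd :: "nat ^ 'n \<Rightarrow> (real ^ 'n \<Rightarrow> complex) \<Rightarrow> real ^ 'n \<Rightarrow> complex" where
  "mpd \<alpha> f = foldr (\<lambda>i. pd i ^^ (\<alpha> $ i)) coord_list f"

text \<open>\<open>P(-iD)\<close>\<close>

definition diff_op ::
    "((nat ^ 'n) \<Rightarrow>\<^sub>0 real) \<Rightarrow> (real ^ 'n \<Rightarrow> complex) \<Rightarrow> real ^ 'n \<Rightarrow> complex" where
  "diff_op P f x = (\<Sum>\<alpha>\<in>Poly_Mapping.keys P.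
     of_real (Poly_Mapping.lookup P \<alpha>) * (- \<i>) ^ mdeg \<alpha> * mpd \<alpha> f x)"

definition null_space ::
    "((real ^ 'n \<Rightarrow> complex) \<Rightarrow> real ^ 'n \<Rightarrow> complex) \<Rightarrow> (real ^ 'n \<Rightarrow> complex) set" where
  "null_space L = {f. L f = (\<lambda>_. 0)}"

text \<open>The order of the zero series is \<open>\<infinity>\<close>.\<close>

definition series_order :: "(nat ^ 'n \<Rightarrow> real) \<Rightarrow> enat" where
  "series_order a = (INF \<kappa>\<in>{\<kappa>. a \<kappa> \<noteq> 0}. enat (mdeg \<kappa>))"


section \<open>Polynomial spaces over a scalar field\<close>

text \<open>The scalar field \<open>K\<close> is \<open>\<real>\<close> or \<open>UNIV\<close> (that is, \<open>\<complex>\<close>); for \<open>K = \<real>\<close>, the polynomials below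
  are the real-valued ones.\<close>

definition polys :: "complex set \<Rightarrow> (real ^ 'n \<Rightarrow> complex) set" where
  "polys K = {P. polynomial_function P \<and> range P \<subseteq> K}"

definition poly_space :: "complex set \<Rightarrow> (real ^ 'n \<Rightarrow> complex) set \<Rightarrow> bool" where
  "poly_space K V \<longleftrightarrow> V \<subseteq> polys K \<and> (\<lambda>_. 0) \<in> V \<and>
     (\<forall>P\<in>V. \<forall>P'\<in>V. (\<lambda>x. P x + P' x) \<in> V) \<and>
     (\<forall>c\<in>K. \<forall>P\<in>V. (\<lambda>x. c * P x) \<in> V)"

definition shift_invariant :: "(real ^ 'n \<Rightarrow> complex) set \<Rightarrow> bool" where
  "shift_invariant V \<longleftrightarrow> (\<forall>P\<in>V. \<forall>h. (\<lambda>x. P (x + h)) \<in> V)"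

definition scale_invariant :: "(real ^ 'n \<Rightarrow> complex) set \<Rightarrow> bool" where
  "scale_invariant V \<longleftrightarrow> (\<forall>P\<in>V. \<forall>t::real. t \<noteq> 0 \<longrightarrow> (\<lambda>x. P (t *\<^sub>R x)) \<in> V)"


section \<open>Compactly supported distributions\<close>

text \<open>Compactly supported tempered distributions are identified with the continuous linear
  functionals on the Frechet space of smooth functions; the values of \<open>\<phi>\<close> off the smooth functions
  are irrelevant.\<close>

definition compact_distribution :: "((real ^ 'n \<Rightarrow> complex) \<Rightarrow> complex) \<Rightarrow> bool" where
  "compact_distribution \<phi> \<longleftrightarrow>
     (\<forall>\<psi> \<eta> c. smooth \<psi> \<longrightarrow> smooth \<eta> \<longrightarrow> \<phi> (\<lambda>x. c * \<psi> x + \<eta> x) = c * \<phi> \<psi> + \<phi> \<eta>) \<and>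
     (\<exists>r N C. \<forall>\<psi> B. smooth \<psi> \<longrightarrow>
        (\<forall>\<alpha> x. mdeg \<alpha> \<le> N \<longrightarrow> norm x \<le> r \<longrightarrow> cmod (mpd \<alpha> \<psi> x) \<le> B) \<longrightarrow>
        cmod (\<phi> \<psi>) \<le> C * B)"

text \<open>The Fourier transform of a compactly supported distribution is the function obtained by
  applying it to exponentials; it is entire, so it is defined at complex arguments.\<close>

definition fourier :: "((real ^ 'n \<Rightarrow> complex) \<Rightarrow> complex) \<Rightarrow> complex ^ 'n \<Rightarrow> complex" where
  "fourier \<phi> \<zeta> = of_real ((2 * pi) powr (- real CARD('n) / 2)) *
     \<phi> (\<lambda>x. exp (- \<i> * (\<Sum>i\<in>UNIV. \<zeta> $ i * of_real (x $ i))))"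

definition test_function :: "(real ^ 'n \<Rightarrow> complex) \<Rightarrow> bool" where
  "test_function \<psi> \<longleftrightarrow> smooth \<psi> \<and> bounded {x. \<psi> x \<noteq> 0}"

text \<open>\<open>f = (\<Sum>k. c k \<phi>(\<cdot> - k))\<close> as distributions; only finitely many terms of the sum are nonzero
  for each test function.\<close>

definition shift_combination ::
    "((real ^ 'n \<Rightarrow> complex) \<Rightarrow> complex) \<Rightarrow> (int ^ 'n \<Rightarrow> complex) \<Rightarrow> (real ^ 'n \<Rightarrow> complex) \<Rightarrow> bool"
    where
  "shift_combination \<phi> c f \<longleftrightarrow> (\<forall>\<psi>. test_function \<psi> \<longrightarrow>
     ((\<lambda>k. c k * \<phi> (\<lambda>x. \<psi> (x + ivec k))) has_sum (LINT x|lborel. f x * \<psi> x)) UNIV)"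

definition reproduces ::
    "complex set \<Rightarrow> ((real ^ 'n \<Rightarrow> complex) \<Rightarrow> complex) \<Rightarrow> (real ^ 'n \<Rightarrow> complex) set \<Rightarrow> bool" where
  "reproduces K \<phi> V \<longleftrightarrow> (\<forall>P\<in>V. \<exists>c. range c \<subseteq> K \<and> shift_combination \<phi> c P)"


section \<open>Masks and scaling functions\<close>

text \<open>Trigonometric polynomials are regarded as entire functions.\<close>

definition trig_poly :: "complex set \<Rightarrow> (complex ^ 'n \<Rightarrow> complex) \<Rightarrow> bool" where
  "trig_poly K g \<longleftrightarrow> (\<exists>F c. finite F \<and> c ` F \<subseteq> K \<and>
     (\<forall>\<zeta>. g \<zeta> = (\<Sum>k\<in>F. c k * exp (- \<i> * (\<Sum>i\<in>UNIV. of_int ((k :: int ^ 'n) $ i) * \<zeta> $ i)))))"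

definition mask :: "(real ^ 'n) set \<Rightarrow> (complex ^ 'n \<Rightarrow> complex) \<Rightarrow> complex ^ 'n \<Rightarrow> complex" where
  "mask S g \<zeta> = (\<Prod>s\<in>S - {0}. g (\<zeta> + cvec ((2 * pi) *\<^sub>R s))) /
                (\<Prod>s\<in>S - {0}. g (cvec ((2 * pi) *\<^sub>R s)))"

text \<open>\<open>\<phi>\<close> is the scaling function of scale \<open>n\<close> for the masks \<open>m0\<close>.  The infinite product is
  understood to converge locally uniformly on complex space, which is what makes it an entire
  function whose Taylor coefficients are the limits of those of the partial products.\<close>

definition scaling_function ::
    "real ^ 'n ^ 'n \<Rightarrow> (int \<Rightarrow> complex ^ 'n \<Rightarrow> complex) \<Rightarrow> int \<Rightarrow>
     ((real ^ 'n \<Rightarrow> complex) \<Rightarrow> complex) \<Rightarrow> bool" where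
  "scaling_function A m0 n \<phi> \<longleftrightarrow> compact_distribution \<phi> \<and>
     (\<forall>Z. compact Z \<longrightarrow> uniform_limit Z
        (\<lambda>N \<zeta>. \<Prod>j = 1..N. m0 (n + int j) (cmat (mat_powi (inv_transp A) (int j)) *v \<zeta>))
        (fourier \<phi>) sequentially)"


section \<open>Consistency of \<open>W_poly\<close> with the quadratic form\<close>

lemma poly_at_superset:
  assumes "finite F" "Poly_Mapping.keys P \<subseteq> F"
  shows "poly_at P x = (\<Sum>\<alpha>\<in>F. Poly_Mapping.lookup P \<alpha> * mono_at \<alpha> x)"
  unfolding poly_at_def
  by (rule sum.mono_neutral_left) (use assms in \<open>auto simp: in_keys_iff\<close>)

lemma poly_at_add: "poly_at (P + R) x = poly_at P x + poly_at R x"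
proof -
  let ?F = "Poly_Mapping.keys P \<union> Poly_Mapping.keys R"
  have "poly_at (P + R) x = (\<Sum>\<alpha>\<in>?F. Poly_Mapping.lookup (P + R) \<alpha> * mono_at \<alpha> x)"
    by (rule poly_at_superset) (auto simp: Poly_Mapping.keys_add)
  also have "\<dots> = poly_at P x + poly_at R x"
    by (subst (1 2) poly_at_superset[of ?F])
       (auto simp: lookup_add sum.distrib algebra_simps)
  finally show ?thesis .
qed

lemma poly_at_0: "poly_at 0 x = 0"
  by (simp add: poly_at_def)

lemma poly_at_sum: "poly_at (\<Sum>i\<in>I. f i) x = (\<Sum>i\<in>I. poly_at (f i) x)"
  by (induction I rule: infinite_finite_induct) (auto simp: poly_at_0 poly_at_add)

lemma mono_at_add: "mono_at (\<alpha> + \<beta>) x = mono_at \<alpha> x * mono_at \<beta> x"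
  by (simp add: mono_at_def power_add prod.distrib)

lemma mono_at_axis: "mono_at (axis i 1) x = x $ i"
proof -
  have "mono_at (axis i 1) x = (\<Prod>j\<in>UNIV. if j = i then x $ j else 1)"
    unfolding mono_at_def by (rule prod.cong) (auto simp: axis_def)
  then show ?thesis
    by (simp add: prod.delta)
qed

lemma poly_at_W_poly: "poly_at (W_poly Q) \<xi> = \<xi> \<bullet> ((Q ** Q) *v \<xi>)"
proof -
  have single: "poly_at (Poly_Mapping.single \<alpha> c) \<xi> = c * mono_at \<alpha> \<xi>" for \<alpha> c
    by (simp add: poly_at_def)
  show ?thesis
    unfolding W_poly_def poly_at_sum single mono_at_add mono_at_axis inner_vec_def
      matrix_vector_mult_def
    by (simp add: sum_distrib_left mult_ac)
qed

end

theory Submission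
  imports Defs "HOL-Complex_Analysis.Complex_Analysis"
begin

text \<open>For \<open>l \<noteq> 0\<close> one factor of the infinite product for the Fourier transform of \<open>\<phi>\<close> carries the
  factor \<open>X + W ^ m\<close>, up to order \<open>2 m\<close>, at \<open>2 \<pi> l\<close>. These Strang-Fix type conditions make \<open>\<phi>\<close>
  annihilate \<open>P\<close> times a nontrivial character for every \<open>P\<close> in the shift-invariant space \<open>V\<close> of polynomials of
  degree at most \<open>2 m\<close> killed by \<open>X(-iD) + W(-iD) ^ m\<close>. Hence the lattice sum of the shifts of
  \<open>\<phi>\<close> with coefficients \<open>P k\<close> is the convolution of \<open>P\<close> with \<open>\<phi>\<close>. This convolution is, up to
  a nonzero constant, unipotent on \<open>V\<close>, hence onto, and all of \<open>V\<close> is reproduced. A polynomial in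
  \<open>ker X(-iD)\<close> outside \<open>ker W(-iD) ^ m\<close> yields an element of \<open>V\<close> with two homogeneous components
  that are coupled by the equation but scale differently. Every polynomial is handled as a sum of divided
  powers of linear forms, on which constant coefficient operators act by lowering the exponent.\<close>

text \<open>The degree bound \<open>2 * m\<close> comes from the hypothesis on \<open>G\<close>,
  whose Maclaurin series is prescribed only up to that order. The decisive factor for
  \<open>l\<close> is found by dividing \<open>l\<close> by the transpose of \<open>A\<close> until
  the quotient is no longer integral: the quotient is then a nonzero digit modulo integer vectors,
  and the mask factor of that digit is \<open>G\<close> at an unshifted argument. Taylor
  coefficients are compared along complex lines only, so that one-variable power series suffice. For
  \<open>K = \<real>\<close> the space and the coefficients of the shifts must be real; real
  coefficients of \<open>G\<close> force \<open>k\<close> to be even and the moments of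
  \<open>\<phi>\<close> to be real. The coupled pair arises from a homogeneous component of the
  given polynomial by differentiating in a direction until the image under W(-iD)^m is a nonzero
  constant; a multiple of the \<open>k\<close>th power of a linear form then cancels that constant
  through X(-iD).\<close>

no_notation fps_nth (infixl "$" 75)

section \<open>Iterated partial derivatives\<close>

lemma pd_eq_derivative:
  assumes "(f has_derivative f') (at x)"
  shows "pd i f x = f' (axis i 1)"
proof -
  have g: "((\<lambda>t. x + t *\<^sub>R axis i 1) has_derivative (\<lambda>t. t *\<^sub>R axis i 1)) (at (0::real))"
    by (auto intro!: derivative_eq_intros)
  have f: "(f has_derivative f') (at (x + (0::real) *\<^sub>R axis i 1))"
    using assms by simp
  have "((\<lambda>t. f (x + t *\<^sub>R axis i 1)) has_derivative (\<lambda>t. f' (t *\<^sub>R axis i 1))) (at (0::real))"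
    using has_derivative_compose[OF g f] by (simp add: o_def)
  moreover have "f' (t *\<^sub>R axis i 1) = t *\<^sub>R f' (axis i 1)" for t
    using assms by (simp add: has_derivative_bounded_linear linear_simps(5))
  ultimately have "((\<lambda>t. f (x + t *\<^sub>R axis i 1)) has_vector_derivative f' (axis i 1)) (at 0)"
    by (simp add: has_vector_derivative_def)
  then show ?thesis
    unfolding pd_def by (rule vector_derivative_at)
qed

lemma pd_add:
  assumes "f differentiable (at x)" "g differentiable (at x)"
  shows "pd i (\<lambda>x. f x + g x) x = pd i f x + pd i g x"
proof -
  obtain f' g' where "(f has_derivative f') (at x)" "(g has_derivative g') (at x)"
    using assms by (auto simp: differentiable_def)
  then show ?thesis
    by (simp add: pd_eq_derivative[OF has_derivative_add] pd_eq_derivative)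
qed

lemma pd_mult:
  assumes "f differentiable (at x)" "g differentiable (at x)"
  shows "pd i (\<lambda>x. f x * g x) x = f x * pd i g x + pd i f x * g x"
proof -
  obtain f' g' where "(f has_derivative f') (at x)" "(g has_derivative g') (at x)"
    using assms by (auto simp: differentiable_def)
  then show ?thesis
    by (simp add: pd_eq_derivative[OF has_derivative_mult] pd_eq_derivative)
qed

lemma pd_const [simp]: "pd i (\<lambda>x. c) = (\<lambda>x. 0)"
  by (rule ext) (simp add: pd_def)

lemma pd_cmult:
  assumes "f differentiable (at x)"
  shows "pd i (\<lambda>x. c * f x) x = c * pd i f x"
  using pd_mult[of "\<lambda>x. c" x f i] assms by simp

lemma pd_translate: "pd i (\<lambda>x. f (x + y)) = (\<lambda>x. pd i f (x + y))"
  by (rule ext) (simp add: pd_def algebra_simps)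

lemma smooth_differentiable: "smooth f \<Longrightarrow> f differentiable (at x)"
  unfolding smooth_def by (drule spec[of _ "[]"]) simp

lemma smooth_continuous: "smooth f \<Longrightarrow> continuous_on S f"
  by (simp add: differentiable_imp_continuous_within continuous_at_imp_continuous_on
      smooth_differentiable)

lemma smooth_pd: "smooth f \<Longrightarrow> smooth (pd i f)"
  unfolding smooth_def
proof (intro allI)
  fix "is" x assume "\<forall>is x. foldr pd is f differentiable (at x)"
  then have "foldr pd (is @ [i]) f differentiable (at x)"
    by blast
  then show "foldr pd is (pd i f) differentiable (at x)"
    by simp
qed

lemma smooth_foldr_pd: "smooth f \<Longrightarrow> smooth (foldr pd is f)"
  by (induction "is") (auto intro: smooth_pd)

text \<open>Smoothness is a greatest fixed point: all iterated partial derivatives of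
  \<open>f\<close> stay inside \<open>P\<close>. The closure lemmas below only have to exhibit a
  suitable class.\<close>

lemma smooth_coinduct:
  assumes "P f" and diff: "\<And>f x. P f \<Longrightarrow> f differentiable (at x)" and pd: "\<And>f i. P f \<Longrightarrow> P (pd i f)"
  shows "smooth f"
proof -
  have "P (foldr pd is f)" for "is"
    by (induction "is") (auto intro: assms)
  then show ?thesis
    unfolding smooth_def using diff by blast
qed

lemma smooth_const [simp, intro]: "smooth (\<lambda>x. c)"
  by (rule smooth_coinduct[where P = "\<lambda>f. \<exists>c. f = (\<lambda>x. c)"]) auto

lemma smooth_translate:
  assumes "smooth f"
  shows "smooth (\<lambda>x. f (x + y))"
proof (rule smooth_coinduct[where P = "\<lambda>h. \<exists>f. smooth f \<and> h = (\<lambda>x. f (x + y))"])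
  fix h x assume "\<exists>f. smooth f \<and> h = (\<lambda>x. f (x + y))"
  then obtain f where f: "smooth f" "h = (\<lambda>x. f (x + y))" by blast
  have "f differentiable (at (x + y))"
    using f smooth_differentiable by blast
  moreover have "(\<lambda>x. x + y) differentiable (at x)"
    by simp
  ultimately show "h differentiable (at x)"
    using differentiable_chain_at[of "\<lambda>x. x + y" x f] by (simp add: f o_def)
next
  fix h i assume "\<exists>f. smooth f \<and> h = (\<lambda>x. f (x + y))"
  then obtain f where f: "smooth f" "h = (\<lambda>x. f (x + y))" by blast
  then show "\<exists>f. smooth f \<and> pd i h = (\<lambda>x. f (x + y))"
    by (intro exI[of _ "pd i f"]) (simp add: pd_translate smooth_pd)
qed (use assms in blast)

text \<open>Products alone are not stable under \<open>pd\<close>, since the Leibniz rule produces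
  sums of products. Closing under sums yields a class to which \<open>smooth_coinduct\<close>
  applies.\<close>

inductive smooth_alg :: "(real ^ 'n \<Rightarrow> complex) \<Rightarrow> bool" where
  prod: "smooth f \<Longrightarrow> smooth g \<Longrightarrow> smooth_alg (\<lambda>x. f x * g x)"
| plus: "smooth_alg f \<Longrightarrow> smooth_alg g \<Longrightarrow> smooth_alg (\<lambda>x. f x + g x)"

lemma smooth_alg_imp_smooth:
  assumes "smooth_alg f"
  shows "smooth f"
proof (rule smooth_coinduct[of smooth_alg])
  have *: "(\<forall>x. f differentiable (at x)) \<and> (\<forall>i. smooth_alg (pd i f))" if "smooth_alg f"
    for f :: "real ^ 'n \<Rightarrow> complex"
    using that
  proof induction
    case (prod f g)
    have "pd i (\<lambda>x. f x * g x) = (\<lambda>x. f x * pd i g x + pd i f x * g x)" for i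
      by (intro ext pd_mult smooth_differentiable prod)
    then show ?case
      using prod by (simp add: smooth_alg.intros smooth_pd differentiable_mult smooth_differentiable)
  next
    case (plus f g)
    have "pd i (\<lambda>x. f x + g x) = (\<lambda>x. pd i f x + pd i g x)" for i
      using plus by (intro ext pd_add) auto
    then show ?case
      using plus by (simp add: smooth_alg.intros differentiable_add)
  qed
  show "\<And>f x. smooth_alg f \<Longrightarrow> f differentiable (at x)"
    and "\<And>f i. smooth_alg f \<Longrightarrow> smooth_alg (pd i f)"
    using * by blast+
qed (rule assms)

lemma smooth_mult: "smooth f \<Longrightarrow> smooth g \<Longrightarrow> smooth (\<lambda>x. f x * g x)"
  by (rule smooth_alg_imp_smooth, rule smooth_alg.prod)

lemma smooth_add:
  assumes "smooth f" "smooth g"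
  shows "smooth (\<lambda>x. f x + g x)"
proof -
  have "smooth_alg (\<lambda>x. f x * 1 + g x * 1)"
    by (intro smooth_alg.intros assms smooth_const)
  from smooth_alg_imp_smooth[OF this] show ?thesis
    by simp
qed

lemma smooth_diff: "smooth f \<Longrightarrow> smooth g \<Longrightarrow> smooth (\<lambda>x. f x - g x)"
  using smooth_add[of f "\<lambda>x. (-1) * g x"] smooth_mult[of "\<lambda>_. -1" g] by simp

lemma smooth_power: "smooth f \<Longrightarrow> smooth (\<lambda>x. f x ^ n)"
  by (induction n) (auto intro: smooth_mult)

lemma smooth_sum: "(\<And>i. i \<in> I \<Longrightarrow> smooth (f i)) \<Longrightarrow> smooth (\<lambda>x. \<Sum>i\<in>I. f i x)"
  by (induction I rule: infinite_finite_induct) (auto intro: smooth_add)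

lemma smooth_sum_list: "(\<And>p. p \<in> set L \<Longrightarrow> smooth (f p)) \<Longrightarrow> smooth (\<lambda>x. \<Sum>p\<leftarrow>L. f p x)"
  by (induction L) (auto intro: smooth_add)

lemma has_derivative_linear_form:
  "((\<lambda>x::real^'n. complex_of_real (\<xi> \<bullet> x)) has_derivative (\<lambda>h. complex_of_real (\<xi> \<bullet> h))) (at x)"
  by (intro derivative_eq_intros refl) (auto intro!: derivative_eq_intros)

lemma smooth_linear_form: "smooth (\<lambda>x::real^'n. complex_of_real (\<xi> \<bullet> x))"
proof (rule smooth_coinduct[where P = "\<lambda>h. h = (\<lambda>x. complex_of_real (\<xi> \<bullet> x)) \<or> (\<exists>c. h = (\<lambda>x. c))"])
  fix f :: "real ^ 'n \<Rightarrow> complex" and i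
  assume "f = (\<lambda>x. complex_of_real (\<xi> \<bullet> x)) \<or> (\<exists>c. f = (\<lambda>x. c))"
  moreover have "pd i (\<lambda>x. complex_of_real (\<xi> \<bullet> x)) = (\<lambda>_. of_real (\<xi> \<bullet> axis i 1))"
    by (intro ext pd_eq_derivative has_derivative_linear_form)
  ultimately show "pd i f = (\<lambda>x. complex_of_real (\<xi> \<bullet> x)) \<or> (\<exists>c. pd i f = (\<lambda>x. c))"
    by auto
next
  fix f :: "real ^ 'n \<Rightarrow> complex" and x
  assume "f = (\<lambda>x. complex_of_real (\<xi> \<bullet> x)) \<or> (\<exists>c. f = (\<lambda>x. c))"
  then show "f differentiable (at x)"
    using has_derivative_linear_form[of \<xi> x] differentiable_const unfolding differentiable_def by blast
qed simp

lemma has_derivative_exp_linear_form: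
  "((\<lambda>x::real^'n. exp (a * complex_of_real (\<xi> \<bullet> x))) has_derivative
     (\<lambda>h. a * of_real (\<xi> \<bullet> h) * exp (a * of_real (\<xi> \<bullet> x)))) (at x)"
proof -
  have "(exp has_derivative (\<lambda>h. h * exp (a * of_real (\<xi> \<bullet> x)))) (at (a * of_real (\<xi> \<bullet> x)))"
    using DERIV_exp[of "a * complex_of_real (\<xi> \<bullet> x)"]
    by (simp add: has_field_derivative_def mult_commute_abs)
  moreover have "((\<lambda>x. a * complex_of_real (\<xi> \<bullet> x)) has_derivative (\<lambda>h. a * complex_of_real (\<xi> \<bullet> h))) (at x)"
    by (intro has_derivative_mult_right has_derivative_linear_form)
  ultimately show ?thesis
    using has_derivative_compose by fastforce
qed

lemma pd_exp_linear_form: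
  "pd i (\<lambda>x. exp (a * complex_of_real (\<xi> \<bullet> x))) = (\<lambda>x. a * of_real (\<xi> $ i) * exp (a * of_real (\<xi> \<bullet> x)))"
  using pd_eq_derivative[OF has_derivative_exp_linear_form[of a \<xi>]]
  by (intro ext) (simp add: inner_axis)

lemma smooth_exp_linear_form: "smooth (\<lambda>x::real^'n. exp (a * complex_of_real (\<xi> \<bullet> x)))"
proof (rule smooth_coinduct[where P = "\<lambda>h. \<exists>c. h = (\<lambda>x. c * exp (a * complex_of_real (\<xi> \<bullet> x)))"])
  have d: "(\<lambda>x. exp (a * complex_of_real (\<xi> \<bullet> x))) differentiable (at x)" for x
    using has_derivative_exp_linear_form by (auto simp: differentiable_def)
  show "\<exists>c. (\<lambda>x. exp (a * complex_of_real (\<xi> \<bullet> x))) = (\<lambda>x. c * exp (a * complex_of_real (\<xi> \<bullet> x)))"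
    by (rule exI[of _ 1]) simp
  fix h :: "real ^ 'n \<Rightarrow> complex" and i and x
  assume "\<exists>c. h = (\<lambda>x. c * exp (a * complex_of_real (\<xi> \<bullet> x)))"
  then obtain c where h: "h = (\<lambda>x. c * exp (a * complex_of_real (\<xi> \<bullet> x)))" by blast
  show "h differentiable (at x)"
    unfolding h by (intro differentiable_mult d) simp
  have "pd i h = (\<lambda>x. c * (a * of_real (\<xi> $ i) * exp (a * of_real (\<xi> \<bullet> x))))"
    unfolding h by (intro ext) (subst pd_cmult[OF d], simp add: pd_exp_linear_form)
  then show "\<exists>c. pd i h = (\<lambda>x. c * exp (a * complex_of_real (\<xi> \<bullet> x)))"
    by (auto simp: mult.assoc[symmetric])
qed

lemma foldr_pd_add:
  assumes "smooth f" "smooth g"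
  shows "foldr pd is (\<lambda>x. f x + g x) = (\<lambda>x. foldr pd is f x + foldr pd is g x)"
proof (induction "is")
  case (Cons i "is")
  then show ?case
    by (auto intro!: ext pd_add smooth_differentiable smooth_foldr_pd assms)
qed simp

lemma foldr_pd_cmult:
  assumes "smooth f"
  shows "foldr pd is (\<lambda>x. c * f x) = (\<lambda>x. c * foldr pd is f x)"
proof (induction "is")
  case (Cons i "is")
  then show ?case
    by (auto intro!: ext pd_cmult smooth_differentiable smooth_foldr_pd assms)
qed simp

lemma foldr_pd_zero [simp]: "foldr pd is (\<lambda>x. 0) = (\<lambda>x. 0)"
  by (induction "is") auto

lemma foldr_pd_translate: "foldr pd is (\<lambda>x. f (x + y)) = (\<lambda>x. foldr pd is f (x + y))"
  by (induction "is") (auto simp: pd_translate)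

lemma foldr_pd_sum:
  assumes "\<And>i. i \<in> I \<Longrightarrow> smooth (f i)"
  shows "foldr pd is (\<lambda>x. \<Sum>i\<in>I. f i x) = (\<lambda>x. \<Sum>i\<in>I. foldr pd is (f i) x)"
  using assms
  by (induction I rule: infinite_finite_induct) (auto simp: foldr_pd_add smooth_sum)

text \<open>Flattening \<open>mpd\<close> into a word of single derivatives lets every estimate be
  made by induction over words \<open>foldr pd is\<close>, with \<open>length is\<close> in place of
  \<open>mdeg \<alpha>\<close>.\<close>

definition pd_seq :: "nat ^ 'n::finite \<Rightarrow> 'n list" where
  "pd_seq \<alpha> = concat (map (\<lambda>i. replicate (\<alpha> $ i) i) coord_list)"

lemma coord_list: "distinct (coord_list :: 'n::finite list)" "set (coord_list :: 'n list) = UNIV"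
proof -
  have "\<exists>is :: 'n list. distinct is \<and> set is = UNIV"
    using finite_distinct_list[of "UNIV :: 'n set"] by auto
  then show "distinct (coord_list :: 'n list)" "set (coord_list :: 'n list) = UNIV"
    unfolding coord_list_def using someI_ex[of "\<lambda>is :: 'n list. distinct is \<and> set is = UNIV"] by blast+
qed

lemma mpd_eq_foldr: "mpd \<alpha> f = foldr pd (pd_seq \<alpha>) f"
proof -
  have r: "foldr pd (replicate n i) g = (pd i ^^ n) g" for n i g
    by (induction n) auto
  have "foldr (\<lambda>i. pd i ^^ (\<alpha> $ i)) xs f = foldr pd (concat (map (\<lambda>i. replicate (\<alpha> $ i) i) xs)) f" for xs
    by (induction xs) (auto simp: r)
  then show ?thesis
    by (simp add: mpd_def pd_seq_def)
qed

lemma sum_list_coord_list: "(\<Sum>i\<leftarrow>coord_list. f i) = (\<Sum>i\<in>UNIV. f i)"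
  by (simp add: coord_list sum_list_distinct_conv_sum_set)

lemma length_pd_seq: "length (pd_seq \<alpha>) = mdeg \<alpha>"
  by (simp add: pd_seq_def mdeg_def length_concat o_def sum_list_coord_list)

lemma prod_list_pd_seq: "(\<Prod>i\<leftarrow>pd_seq \<alpha>. \<xi> $ i) = mono_at \<alpha> \<xi>"
proof -
  have "(\<Prod>i\<leftarrow>concat (map (\<lambda>i. replicate (\<alpha> $ i) i) xs). \<xi> $ i) = (\<Prod>i\<leftarrow>xs. \<xi> $ i ^ (\<alpha> $ i))" for xs
    by (induction xs) (auto simp: map_replicate prod_list_replicate)
  then show ?thesis
    by (simp add: pd_seq_def mono_at_def coord_list prod.distinct_set_conv_list[symmetric])
qed

section \<open>Sums of divided powers of linear forms\<close>

text \<open>Divided powers with an integer index, vanishing below 0. Differentiation is then an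
  index shift without exceptional cases, and an operator of order \<open>k\<close> kills the powers
  below \<open>k\<close> automatically.\<close>

definition dp :: "int \<Rightarrow> complex \<Rightarrow> complex" where
  "dp n z = (if n < 0 then 0 else z ^ nat n / fact (nat n))"

lemma dp_neg [simp]: "n < 0 \<Longrightarrow> dp n z = 0"
  by (simp add: dp_def)

lemma dp_0 [simp]: "dp 0 z = 1"
  by (simp add: dp_def)

lemma dp_int: "dp (int n) z = z ^ n / fact n"
  by (simp add: dp_def)

lemma dp_scale: "dp n (c * z) = c ^ nat n * dp n z"
  by (simp add: dp_def power_mult_distrib)

lemma DERIV_dp: "(dp n has_field_derivative dp (n - 1) z) (at z)"
proof (cases "n \<le> 0")
  case True
  then have "dp n = (\<lambda>_. if n = 0 then 1 else 0)"
    by (auto simp: dp_def)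
  then show ?thesis
    using True by (simp add: dp_def)
next
  case False
  then obtain p where n: "n = int (Suc p)"
    by (metis not_le zero_less_imp_eq_int not0_implies_Suc less_irrefl)
  have "((\<lambda>z. z ^ Suc p / fact (Suc p)) has_field_derivative of_nat (Suc p) * z ^ p / fact (Suc p)) (at z)"
    using DERIV_cdivide[OF DERIV_power[OF DERIV_ident, of "Suc p" z UNIV], of "fact (Suc p)"] by simp
  moreover have "of_nat (Suc p) * z ^ p / fact (Suc p) = z ^ p / fact p"
    by (simp add: field_simps del: of_nat_Suc)
  moreover have "dp n = (\<lambda>z. z ^ Suc p / fact (Suc p))" "dp (n - 1) z = z ^ p / fact p"
    using dp_int[of "Suc p"] dp_int[of p z] by (auto simp: n)
  ultimately show ?thesis
    by simp
qed

text \<open>The binomial theorem. Terms with \<open>a > n\<close> vanish, so any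
  \<open>M \<ge> n\<close> may bound the sum; a range common to all entries of a list is needed when
  sums over entries and over \<open>a\<close> are interchanged.\<close>

lemma dp_add:
  assumes "n \<le> int M"
  shows "dp n (x + y) = (\<Sum>a\<le>M. dp (int a) x * dp (n - int a) y)"
proof (cases "n < 0")
  case False
  then obtain p where n: "n = int p"
    using nonneg_int_cases not_less by metis
  have "(\<Sum>a\<le>M. dp (int a) x * dp (n - int a) y) = (\<Sum>a\<le>p. dp (int a) x * dp (n - int a) y)"
    using assms by (intro sum.mono_neutral_right) (auto simp: n)
  also have "\<dots> = (\<Sum>a\<le>p. of_nat (p choose a) * x ^ a * y ^ (p - a)) / fact p"
    unfolding sum_divide_distrib
  proof (rule sum.cong)
    fix a assume "a \<in> {..p}"
    then have "a \<le> p" by simp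
    then have e: "n - int a = int (p - a)" by (simp add: n of_nat_diff)
    show "dp (int a) x * dp (n - int a) y = of_nat (p choose a) * x ^ a * y ^ (p - a) / fact p"
      unfolding e dp_int using binomial_fact[OF \<open>a \<le> p\<close>, where ?'a = complex]
      by (simp add: field_simps)
  qed simp
  also have "\<dots> = dp n (x + y)"
    by (simp add: n dp_int binomial_ring)
  finally show ?thesis by simp
qed simp

text \<open>A polynomial has many such lists. Operators are defined on lists, and that they descend
  to functions needs a separate argument (\<open>diff_op_psum\<close>).\<close>

definition psum :: "(complex \<times> int \<times> (real ^ 'n)) list \<Rightarrow> real ^ 'n \<Rightarrow> complex" where
  "psum L x = (\<Sum>(b, n, \<xi>)\<leftarrow>L. b * dp n (of_real (\<xi> \<bullet> x)))"

lemma psum_Nil [simp]: "psum [] x = 0"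
  by (simp add: psum_def)

lemma psum_Cons: "psum ((b, n, \<xi>) # L) x = b * dp n (of_real (\<xi> \<bullet> x)) + psum L x"
  by (simp add: psum_def)

lemma psum_append: "psum (L @ L') x = psum L x + psum L' x"
  by (simp add: psum_def)

lemma smooth_dp: "smooth (\<lambda>x::real^'n. dp n (of_real (\<xi> \<bullet> x)))"
proof (cases "n < 0")
  case False
  have "smooth (\<lambda>x::real^'n. (1 / fact (nat n)) * complex_of_real (\<xi> \<bullet> x) ^ nat n)"
    by (intro smooth_mult smooth_power smooth_linear_form smooth_const)
  then show ?thesis
    using False by (simp add: dp_def)
qed simp

lemma pd_dp: "pd i (\<lambda>x::real^'n. dp n (of_real (\<xi> \<bullet> x))) = (\<lambda>x. of_real (\<xi> $ i) * dp (n - 1) (of_real (\<xi> \<bullet> x)))"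
proof
  fix x :: "real ^ 'n"
  have "(dp n has_derivative (\<lambda>h. dp (n - 1) (of_real (\<xi> \<bullet> x)) * h)) (at (of_real (\<xi> \<bullet> x)))"
    using DERIV_dp by (simp add: has_field_derivative_def)
  from has_derivative_compose[OF has_derivative_linear_form this]
  show "pd i (\<lambda>x. dp n (of_real (\<xi> \<bullet> x))) x = of_real (\<xi> $ i) * dp (n - 1) (of_real (\<xi> \<bullet> x))"
    by (simp add: pd_eq_derivative inner_axis mult.commute)
qed

lemma foldr_pd_dp:
  "foldr pd is (\<lambda>x. dp n (of_real (\<xi> \<bullet> x))) =
     (\<lambda>x. of_real (\<Prod>i\<leftarrow>is. \<xi> $ i) * dp (n - int (length is)) (of_real (\<xi> \<bullet> x)))"
proof (induction "is")
  case (Cons i "is")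
  then show ?case
    by (auto simp: pd_cmult smooth_differentiable smooth_dp pd_dp algebra_simps)
qed simp

lemma smooth_psum: "smooth (psum L)"
proof -
  have "smooth (\<lambda>x. \<Sum>p\<leftarrow>L. (case p of (b, n, \<xi>) \<Rightarrow> b * dp n (of_real (\<xi> \<bullet> x))))"
    by (intro smooth_sum_list) (auto intro!: smooth_mult smooth_dp split: prod.splits)
  then show ?thesis
    by (simp add: psum_def[abs_def])
qed

text \<open>On a divided power of \<open>\<xi> \<bullet> x\<close> each derivative in direction
  \<open>i\<close> only multiplies by \<open>\<xi> $ i\<close> and lowers the index. Homogeneity
  makes the index shift the same for all monomials of \<open>Y\<close>, so their values at
  \<open>\<xi>\<close> add up.\<close>

lemma diff_op_dp:
  assumes "Y \<in> homog_polys k"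
  shows "diff_op Y (\<lambda>x. dp n (of_real (\<xi> \<bullet> x))) x =
    (- \<i>) ^ k * of_real (poly_at Y \<xi>) * dp (n - int k) (of_real (\<xi> \<bullet> x))"
proof -
  have "diff_op Y (\<lambda>x. dp n (of_real (\<xi> \<bullet> x))) x =
    (\<Sum>\<alpha>\<in>Poly_Mapping.keys Y. (- \<i>) ^ k * of_real (Poly_Mapping.lookup Y \<alpha> * mono_at \<alpha> \<xi>)
        * dp (n - int k) (of_real (\<xi> \<bullet> x)))"
    unfolding diff_op_def
  proof (rule sum.cong)
    fix \<alpha> assume "\<alpha> \<in> Poly_Mapping.keys Y"
    then have "mdeg \<alpha> = k"
      using assms by (simp add: homog_polys_def)
    then show "complex_of_real (Poly_Mapping.lookup Y \<alpha>) * (- \<i>) ^ mdeg \<alpha> *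
        mpd \<alpha> (\<lambda>x. dp n (of_real (\<xi> \<bullet> x))) x =
      (- \<i>) ^ k * of_real (Poly_Mapping.lookup Y \<alpha> * mono_at \<alpha> \<xi>) * dp (n - int k) (of_real (\<xi> \<bullet> x))"
      by (simp add: mpd_eq_foldr foldr_pd_dp length_pd_seq prod_list_pd_seq)
  qed simp
  then show ?thesis
    by (simp add: poly_at_def sum_distrib_left sum_distrib_right)
qed

lemma diff_op_add_cmult:
  assumes "smooth f" "smooth g"
  shows "diff_op Y (\<lambda>x. c * f x + g x) x = c * diff_op Y f x + diff_op Y g x"
proof -
  have "foldr pd is (\<lambda>x. c * f x + g x) = (\<lambda>x. c * foldr pd is f x + foldr pd is g x)" for "is"
    using foldr_pd_add[of "\<lambda>x. c * f x" g "is"] foldr_pd_cmult[of f "is" c] smooth_mult[of "\<lambda>_. c" f] assms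
    by simp
  then show ?thesis
    by (simp add: diff_op_def mpd_eq_foldr algebra_simps sum.distrib sum_distrib_left)
qed

lemma diff_op_psum:
  assumes "Y \<in> homog_polys k"
  shows "diff_op Y (psum L) =
    psum (map (\<lambda>(b, n, \<xi>). ((- \<i>) ^ k * of_real (poly_at Y \<xi>) * b, n - int k, \<xi>)) L)"
proof (induction L)
  case Nil
  have "psum [] = (\<lambda>_. 0)"
    by auto
  then show ?case
    by (simp add: diff_op_def mpd_eq_foldr fun_eq_iff)
next
  case (Cons p L)
  obtain b n \<xi> where p: "p = (b, n, \<xi>)" by (cases p) auto
  have "psum (p # L) = (\<lambda>x. b * dp n (of_real (\<xi> \<bullet> x)) + psum L x)"
    by (auto simp: p psum_Cons)
  then show ?case
    using Cons by (simp add: fun_eq_iff diff_op_add_cmult smooth_dp smooth_psum diff_op_dp[OF assms] p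
        psum_Cons)
qed

lemma diff_op_funpow_psum:
  assumes "Y \<in> homog_polys k"
  shows "(diff_op Y ^^ m) (psum L) =
    psum (map (\<lambda>(b, n, \<xi>). (((- \<i>) ^ k * of_real (poly_at Y \<xi>)) ^ m * b, n - int (m * k), \<xi>)) L)"
proof (induction m)
  case 0
  have "map (\<lambda>(b, n, \<xi>). (((- \<i>) ^ k * of_real (poly_at Y \<xi>)) ^ 0 * b, n - int (0 * k), \<xi>)) L = L"
    by (induction L) auto
  then show ?case by simp
next
  case (Suc m)
  show ?case
    by (simp add: Suc diff_op_psum[OF assms] o_def split_beta algebra_simps)
qed

lemma W_poly_homog:
  fixes Q :: "real ^ 'n ^ 'n"
  shows "W_poly Q \<in> homog_polys 2"
proof -
  have "mdeg (axis i 1 + axis j 1 :: nat ^ 'n) = 2" for i j :: 'n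
  proof -
    have "mdeg (axis i 1 :: nat ^ 'n) = 1" for i :: 'n
    proof -
      have "mdeg (axis i 1 :: nat ^ 'n) = (\<Sum>j\<in>UNIV. if j = i then 1 else 0)"
        unfolding mdeg_def by (rule sum.cong) (auto simp: axis_def)
      then show ?thesis by simp
    qed
    moreover have "mdeg (\<alpha> + \<beta>) = mdeg \<alpha> + mdeg \<beta>" for \<alpha> \<beta> :: "nat ^ 'n"
      by (simp add: mdeg_def sum.distrib)
    ultimately show ?thesis by simp
  qed
  moreover have "Poly_Mapping.keys (W_poly Q) \<subseteq>
      (\<Union>i\<in>UNIV. \<Union>j\<in>UNIV. Poly_Mapping.keys (Poly_Mapping.single (axis i 1 + axis j 1) ((Q ** Q) $ i $ j)))"
    unfolding W_poly_def by (intro order_trans[OF keys_sum] UN_mono order_refl)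
  ultimately show ?thesis
    by (fastforce simp: homog_polys_def split: if_splits)
qed

lemma psum_cmult: "psum (map (\<lambda>(b, n, \<xi>). (c * b, n, \<xi>)) L) x = c * psum L x"
  by (induction L) (auto simp: psum_Cons algebra_simps)

lemma psum_scale: "psum (map (\<lambda>(b, n, \<xi>). (of_real t ^ nat n * b, n, \<xi>)) L) x = psum L (t *\<^sub>R x)"
  by (induction L) (auto simp: psum_Cons dp_scale)

lemma psum_in:
  assumes "K = \<real> \<or> K = UNIV" "\<forall>p\<in>set L. fst p \<in> K"
  shows "psum L x \<in> K"
proof (cases "K = UNIV")
  case False
  then have K: "K = \<real>"
    using assms(1) by simp
  have "dp n (of_real r) \<in> \<real>" for n r
    by (auto simp: dp_def intro!: Reals_divide Reals_power fact_in_Reals)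
  then show ?thesis
    using assms(2) unfolding K by (induction L) (auto simp: psum_Cons)
qed simp

lemma polynomial_function_psum:
  fixes L :: "(complex \<times> int \<times> (real ^ 'n)) list"
  shows "polynomial_function (psum L)"
proof (induction L)
  case Nil
  have "psum [] = (\<lambda>_::real^'n. 0::complex)"
    by auto
  then show ?case by simp
next
  case (Cons p L)
  obtain b n \<xi> where p: "p = (b, n, \<xi>)" by (cases p) auto
  define q :: "real ^ 'n \<Rightarrow> real" where "q x = (if n < 0 then 0 else (\<xi> \<bullet> x) ^ nat n / fact (nat n))" for x
  have "psum (p # L) = (\<lambda>x. q x *\<^sub>R b + psum L x)"
    by (auto simp: p psum_Cons dp_def q_def scaleR_conv_of_real)
  moreover have "real_polynomial_function (\<lambda>x. \<xi> \<bullet> x)"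
    by (simp add: real_polynomial_function.intros(1) bounded_linear_inner_right)
  then have "real_polynomial_function q"
    unfolding q_def by (cases "n < 0") (auto simp: divide_inverse)
  then have "polynomial_function q"
    by (simp add: real_polynomial_function_eq)
  ultimately show ?case
    using Cons by (simp add: polynomial_function_add polynomial_function_mult)
qed

section \<open>Real polynomials as sums of powers of linear forms\<close>

text \<open>Lagrange interpolation at the nodes 0, ..., \<open>M\<close> reproduces
  \<open>x ^ e\<close> for \<open>e \<le> M\<close>; the weight \<open>w s\<close> is the
  coefficient of \<open>x ^ p\<close> in the basis polynomial of the node \<open>s\<close>. The
  weights thus read one coefficient of a polynomial off its values at natural numbers.\<close>

lemma moment_weights:
  assumes "p \<le> M"
  obtains w :: "nat \<Rightarrow> complex"
  where "\<And>e. e \<le> M \<Longrightarrow> (\<Sum>s\<le>M. w s * of_nat s ^ e) = (if e = p then 1 else 0)"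
    and "\<And>s. w s \<in> \<real>"
proof
  define l :: "nat \<Rightarrow> real poly" where
    "l s = (\<Prod>r\<in>{..M} - {s}. smult (inverse (real s - real r)) [:- real r, 1:])" for s
  have l_eval: "poly (l s) (real r) = (if r = s then 1 else 0)" if "s \<le> M" "r \<le> M" for r s
  proof (cases "r = s")
    case True
    have "poly (smult (inverse (real s - real t)) [:- real t, 1:]) (real s) = 1" if "t \<noteq> s" for t
    proof -
      have "poly (smult (inverse (real s - real t)) [:- real t, 1:]) (real s) =
          inverse (real s - real t) * (real s - real t)"
        by (simp add: algebra_simps)
      then show ?thesis
        using that by (simp only: left_inverse of_nat_eq_iff right_minus_eq not_False_eq_True)
    qed
    then show ?thesis
      unfolding l_def poly_prod using True by (auto intro!: prod.neutral)
  next
    case False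
    then show ?thesis
      using that by (auto simp: l_def poly_prod intro!: prod_zero bexI[of _ r])
  qed
  have l_deg: "degree (l s) \<le> M" if "s \<le> M" for s
  proof -
    have "degree (l s) \<le> sum (degree \<circ> (\<lambda>r. smult (inverse (real s - real r)) [:- real r, 1:])) ({..M} - {s})"
      unfolding l_def by (rule degree_prod_sum_le) simp
    also have "\<dots> \<le> (\<Sum>r\<in>{..M} - {s}. 1)"
      by (intro sum_mono) (auto intro: order_trans[OF degree_smult_le])
    also have "\<dots> = M"
      using that by simp
    finally show ?thesis .
  qed
  fix e assume e: "e \<le> M"
  \<comment> \<open>Both sides have degree at most \<open>M\<close> and agree at the
    \<open>M + 1\<close> nodes.\<close>
  have "(\<Sum>s\<le>M. smult (real s ^ e) (l s)) = monom 1 e"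
  proof (rule poly_eqI_degree[of "real ` {..M}"])
    fix x assume "x \<in> real ` {..M}"
    then obtain r where r: "r \<le> M" "x = real r" by auto
    have "poly (\<Sum>s\<le>M. smult (real s ^ e) (l s)) x = (\<Sum>s\<le>M. if r = s then real s ^ e else 0)"
      unfolding poly_sum by (intro sum.cong) (auto simp: r l_eval)
    then show "poly (\<Sum>s\<le>M. smult (real s ^ e) (l s)) x = poly (monom 1 e) x"
      using r by (simp add: poly_monom)
  next
    have c: "card (real ` {..M}) = Suc M"
      by (simp add: card_image inj_on_def)
    have "degree (\<Sum>s\<le>M. smult (real s ^ e) (l s)) \<le> M"
      by (intro degree_sum_le) (auto intro: order_trans[OF degree_smult_le] l_deg)
    then show "degree (\<Sum>s\<le>M. smult (real s ^ e) (l s)) < card (real ` {..M})"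
      by (simp add: c)
    show "degree (monom (1::real) e) < card (real ` {..M})"
      using e by (simp add: c degree_monom_eq)
  qed
  then have "(\<Sum>s\<le>M. real s ^ e * coeff (l s) p) = (if e = p then 1 else 0)"
    by (metis (no_types, lifting) coeff_monom coeff_smult coeff_sum sum.cong)
  then have "complex_of_real (\<Sum>s\<le>M. real s ^ e * coeff (l s) p) = (if e = p then 1 else 0)"
    by simp
  then show "(\<Sum>s\<le>M. of_real (coeff (l s) p) * of_nat s ^ e) = (if e = p then 1 else (0::complex))"
    by (simp add: mult.commute)
qed simp

lemma polynomial_coeffs_zero:
  fixes c :: "nat \<Rightarrow> complex"
  assumes "\<And>s::nat. (\<Sum>a\<le>M. of_nat s ^ a * c a) = 0" and "p \<le> M"
  shows "c p = 0"
proof -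
  obtain w :: "nat \<Rightarrow> complex" where
    w: "\<And>e. e \<le> M \<Longrightarrow> (\<Sum>s\<le>M. w s * of_nat s ^ e) = (if e = p then 1 else 0)"
    using moment_weights[OF assms(2)] by metis
  have "0 = (\<Sum>s\<le>M. w s * (\<Sum>a\<le>M. of_nat s ^ a * c a))"
    by (simp add: assms)
  also have "\<dots> = (\<Sum>a\<le>M. (\<Sum>s\<le>M. w s * of_nat s ^ a) * c a)"
    unfolding sum_distrib_left sum_distrib_right by (subst sum.swap) (simp add: mult.assoc)
  also have "\<dots> = (\<Sum>a\<le>M. if a = p then c a else 0)"
    by (intro sum.cong) (auto simp: w)
  finally show ?thesis
    using assms(2) by simp
qed

text \<open>Real coefficients are demanded so that the list of a real polynomial is admissible for
  both choices of the scalar field.\<close>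

definition power_span :: "(real ^ 'n \<Rightarrow> complex) \<Rightarrow> bool" where
  "power_span f \<longleftrightarrow> (\<exists>L. (\<forall>p\<in>set L. fst p \<in> \<real>) \<and> f = psum L)"

lemma power_span_add:
  assumes "power_span f" "power_span g"
  shows "power_span (\<lambda>x. f x + g x)"
proof -
  obtain L L' where "\<forall>p\<in>set L. fst p \<in> \<real>" "f = psum L" "\<forall>p\<in>set L'. fst p \<in> \<real>" "g = psum L'"
    using assms by (auto simp: power_span_def)
  then show ?thesis
    unfolding power_span_def by (intro exI[of _ "L @ L'"]) (auto simp: psum_append)
qed

lemma power_span_dp: "b \<in> \<real> \<Longrightarrow> power_span (\<lambda>x. b * dp n (of_real (\<xi> \<bullet> x)))"
  unfolding power_span_def by (intro exI[of _ "[(b, n, \<xi>)]"]) (auto simp: psum_Cons)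

lemma power_span_cmult:
  assumes "c \<in> \<real>" "power_span f"
  shows "power_span (\<lambda>x. c * f x)"
proof -
  obtain L where L: "\<forall>p\<in>set L. fst p \<in> \<real>" "f = psum L"
    using assms by (auto simp: power_span_def)
  let ?L = "map (\<lambda>(b, n, \<xi>). (c * b, n, \<xi>)) L"
  have "(\<lambda>x. c * f x) = psum ?L"
    by (intro ext) (simp only: L psum_cmult)
  moreover have "\<forall>p\<in>set ?L. fst p \<in> \<real>"
    using L assms(1) by fastforce
  ultimately show ?thesis
    unfolding power_span_def by blast
qed

lemma power_span_0: "power_span (\<lambda>x. 0)"
  using power_span_dp[of 0 0 0] by simp

lemma power_span_sum: "(\<And>i. i \<in> I \<Longrightarrow> power_span (f i)) \<Longrightarrow> power_span (\<lambda>x. \<Sum>i\<in>I. f i x)"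
  by (induction I rule: infinite_finite_induct) (auto intro: power_span_add power_span_0)

text \<open>Polarization: the product is the coefficient of \<open>s ^ p\<close> in \<open>dp (n + p) ((\<xi> + s \<eta>) \<bullet> x)\<close>.\<close>

lemma power_span_dp_mult:
  "power_span (\<lambda>x. dp n (of_real (\<xi> \<bullet> x)) * dp p (of_real (\<eta> \<bullet> x)))"
proof (cases "n < 0 \<or> p < 0")
  case True
  then show ?thesis
    using power_span_0 by auto
next
  case False
  then obtain n' p' where np: "n = int n'" "p = int p'"
    by (metis nonneg_int_cases not_less)
  let ?M = "n' + p'"
  obtain w :: "nat \<Rightarrow> complex" where
    w: "\<And>e. e \<le> ?M \<Longrightarrow> (\<Sum>s\<le>?M. w s * of_nat s ^ e) = (if e = p' then 1 else 0)"
    and w_real: "\<And>s. w s \<in> \<real>"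
    using moment_weights[of p' ?M] le_add2 by metis
  have "(\<Sum>s\<le>?M. w s * dp (int ?M) (of_real ((real s *\<^sub>R \<eta> + \<xi>) \<bullet> x)))
      = dp n (of_real (\<xi> \<bullet> x)) * dp p (of_real (\<eta> \<bullet> x))" for x
  proof -
    let ?d = "\<lambda>a. dp (int a) (of_real (\<eta> \<bullet> x)) * dp (int ?M - int a) (of_real (\<xi> \<bullet> x))"
    have "(\<Sum>s\<le>?M. w s * dp (int ?M) (of_real ((real s *\<^sub>R \<eta> + \<xi>) \<bullet> x))) =
        (\<Sum>s\<le>?M. \<Sum>a\<le>?M. w s * of_nat s ^ a * ?d a)"
    proof (rule sum.cong)
      fix s
      have "dp (int ?M) (of_real ((real s *\<^sub>R \<eta> + \<xi>) \<bullet> x)) = (\<Sum>a\<le>?M. of_nat s ^ a * ?d a)"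
        using dp_add[of "int ?M" ?M "of_nat s * of_real (\<eta> \<bullet> x)" "of_real (\<xi> \<bullet> x)"]
        by (simp add: inner_add_left dp_scale mult.assoc)
      then show "w s * dp (int ?M) (of_real ((real s *\<^sub>R \<eta> + \<xi>) \<bullet> x)) = (\<Sum>a\<le>?M. w s * of_nat s ^ a * ?d a)"
        by (simp add: sum_distrib_left mult.assoc)
    qed simp
    also have "\<dots> = (\<Sum>a\<le>?M. (\<Sum>s\<le>?M. w s * of_nat s ^ a) * ?d a)"
      by (subst sum.swap) (simp add: sum_distrib_right)
    also have "\<dots> = (\<Sum>a\<le>?M. if a = p' then ?d a else 0)"
      by (intro sum.cong) (auto simp: w)
    also have "\<dots> = ?d p'"
      by simp
    finally show ?thesis
      by (simp add: np mult.commute)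
  qed
  moreover have "power_span (\<lambda>x. \<Sum>s\<le>?M. w s * dp (int ?M) (of_real ((real s *\<^sub>R \<eta> + \<xi>) \<bullet> x)))"
    by (intro power_span_sum power_span_dp w_real)
  ultimately show ?thesis
    by simp
qed

lemma power_span_psum_mult:
  assumes "\<forall>p\<in>set L. fst p \<in> \<real>" "\<And>n \<xi>. power_span (\<lambda>x. dp n (of_real (\<xi> \<bullet> x)) * g x)"
  shows "power_span (\<lambda>x. psum L x * g x)"
  using assms(1)
proof (induction L)
  case Nil
  then show ?case
    by (simp add: power_span_0)
next
  case (Cons p L)
  obtain b n \<xi> where p: "p = (b, n, \<xi>)" by (cases p) auto
  have "power_span (\<lambda>x. b * (dp n (of_real (\<xi> \<bullet> x)) * g x) + psum L x * g x)"
    using Cons p by (intro power_span_add power_span_cmult assms(2)) auto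
  then show ?case
    by (simp add: p psum_Cons algebra_simps)
qed

lemma power_span_mult:
  assumes "power_span f" "power_span g"
  shows "power_span (\<lambda>x. f x * g x)"
proof -
  obtain L1 L2 where L1: "\<forall>p\<in>set L1. fst p \<in> \<real>" "f = psum L1"
    and L2: "\<forall>p\<in>set L2. fst p \<in> \<real>" "g = psum L2"
    using assms unfolding power_span_def by blast
  have "power_span (\<lambda>x. dp n (of_real (\<xi> \<bullet> x)) * psum L2 x)" for n \<xi>
  proof -
    have "power_span (\<lambda>x. psum L2 x * dp n (of_real (\<xi> \<bullet> x)))"
      by (rule power_span_psum_mult[OF L2(1) power_span_dp_mult])
    then show ?thesis
      by (simp add: mult.commute)
  qed
  then show ?thesis
    unfolding L1(2) L2(2) by (rule power_span_psum_mult[OF L1(1)])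
qed

lemma power_span_real_polynomial:
  fixes p :: "real ^ 'n \<Rightarrow> real"
  assumes "real_polynomial_function p"
  shows "power_span (\<lambda>x. of_real (p x))"
  using assms
proof induction
  case (linear f)
  \<comment> \<open>The Riesz vector of the functional \<open>f\<close>.\<close>
  have "f x = adjoint f 1 \<bullet> x" for x
    using adjoint_works[of f x 1] linear by (simp add: bounded_linear.linear inner_commute)
  then have "power_span (\<lambda>x. complex_of_real (f x)) \<longleftrightarrow>
      power_span (\<lambda>x. 1 * dp 1 (complex_of_real (adjoint f 1 \<bullet> x)))"
    using dp_int[of 1] by simp
  then show ?case
    using power_span_dp[of 1 1 "adjoint f 1"] by simp
next
  case (const c)
  then show ?case
    using power_span_dp[of "of_real c" 0 0] by simp
qed (auto dest: power_span_add power_span_mult)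

section \<open>Constant-coefficient operators on lists, and homogeneous components\<close>

text \<open>The list form of a homogeneous operator of order \<open>k\<close>, modelled on
  \<open>diff_op_psum\<close>. Since \<open>Y\<close> is an arbitrary complex function of the
  direction, the power of -i can be absorbed into it.\<close>

definition symb :: "nat \<Rightarrow> (real ^ 'n \<Rightarrow> complex) \<Rightarrow> (complex \<times> int \<times> (real ^ 'n)) list
    \<Rightarrow> (complex \<times> int \<times> (real ^ 'n)) list" where
  "symb k Y L = map (\<lambda>p. (Y (snd (snd p)) * fst p, fst (snd p) - int k, snd (snd p))) L"

lemma psum_eq: "psum L x = (\<Sum>p\<leftarrow>L. fst p * dp (fst (snd p)) (of_real (snd (snd p) \<bullet> x)))"
  by (induction L) (auto simp: psum_Cons)

lemma psum_symb:
  "psum (symb k Y L) x = (\<Sum>p\<leftarrow>L. Y (snd (snd p)) * fst p * dp (fst (snd p) - int k) (of_real (snd (snd p) \<bullet> x)))"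
  by (simp add: psum_eq symb_def o_def)

lemma sum_list_sum:
  fixes f :: "'a \<Rightarrow> 'b \<Rightarrow> complex"
  shows "(\<Sum>p\<leftarrow>L. \<Sum>a\<in>A. f p a) = (\<Sum>a\<in>A. \<Sum>p\<leftarrow>L. f p a)"
  by (induction L) (auto simp: sum.distrib)

text \<open>The entries of exponent \<open>a\<close> form the homogeneous component of degree
  \<open>a\<close>. Entries of negative exponent fall outside the sum, but they evaluate to
  0.\<close>

lemma psum_scale_components:
  assumes "\<forall>p\<in>set L. fst (snd p) \<le> int M"
  shows "psum L (t *\<^sub>R x) = (\<Sum>a\<le>M. of_real t ^ a * psum (filter (\<lambda>p. fst (snd p) = int a) L) x)"
  using assms
proof (induction L)
  case (Cons p L)
  obtain b n \<xi> where p: "p = (b, n, \<xi>)" by (cases p) auto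
  have "(\<Sum>a\<le>M. of_real t ^ a * psum (filter (\<lambda>p. fst (snd p) = int a) (p # L)) x) =
      (\<Sum>a\<le>M. (if n = int a then of_real t ^ a * (b * dp n (of_real (\<xi> \<bullet> x))) else 0)
        + of_real t ^ a * psum (filter (\<lambda>p. fst (snd p) = int a) L) x)"
    by (intro sum.cong) (auto simp: p psum_Cons algebra_simps)
  also have "\<dots> = (\<Sum>a\<le>M. (if n = int a then of_real t ^ a * (b * dp n (of_real (\<xi> \<bullet> x))) else 0))
      + psum L (t *\<^sub>R x)"
    using Cons by (simp add: sum.distrib)
  also have "(\<Sum>a\<le>M. (if n = int a then of_real t ^ a * (b * dp n (of_real (\<xi> \<bullet> x))) else 0))
      = b * dp n (of_real (\<xi> \<bullet> t *\<^sub>R x))"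
  proof (cases "n < 0")
    case True
    then show ?thesis by (simp add: dp_neg)
  next
    case False
    have "(\<Sum>a\<le>M. (if n = int a then of_real t ^ a * (b * dp n (of_real (\<xi> \<bullet> x))) else 0)) =
       (\<Sum>a\<le>M. (if nat n = a then of_real t ^ nat n * (b * dp n (of_real (\<xi> \<bullet> x))) else 0))"
      using False by (intro sum.cong) auto
    also have "\<dots> = of_real t ^ nat n * (b * dp n (of_real (\<xi> \<bullet> x)))"
      using Cons.prems False by (simp add: p nat_le_iff)
    finally show ?thesis
      by (simp add: dp_scale)
  qed
  finally show ?case
    by (simp add: p psum_Cons)
qed simp

lemma degree_bound: obtains M where "\<forall>p\<in>set L. fst (snd p) \<le> int M"
proof -
  have "\<exists>M. \<forall>p\<in>set L. fst (snd p) \<le> int M"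
  proof (induction L)
    case (Cons p L)
    then obtain M where "\<forall>p\<in>set L. fst (snd p) \<le> int M" by blast
    then show ?case
      by (intro exI[of _ "M + nat (fst (snd p))"]) fastforce
  qed simp
  then show ?thesis
    using that by blast
qed

text \<open>Along a ray, \<open>psum L\<close> is a polynomial in the scaling parameter with the
  components as coefficients, and it vanishes at all natural numbers.\<close>

lemma psum_component_zero:
  assumes "\<And>x. psum L x = 0"
  shows "psum (filter (\<lambda>p. fst (snd p) = int a) L) x = 0"
proof -
  obtain M where M: "\<forall>p\<in>set L. fst (snd p) \<le> int M"
    using degree_bound by blast
  show ?thesis
  proof (cases "a \<le> M")
    case True
    have "(\<Sum>a\<le>M. of_nat s ^ a * psum (filter (\<lambda>p. fst (snd p) = int a) L) x) = 0" for s
      using psum_scale_components[OF M, of "real s" x] assms by simp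
    from polynomial_coeffs_zero[of "\<lambda>a. psum (filter (\<lambda>p. fst (snd p) = int a) L) x", OF this True]
    show ?thesis .
  next
    case False
    have "filter (\<lambda>p. fst (snd p) = int a) L = []"
      using M False by (auto simp: filter_empty_conv)
    then show ?thesis by simp
  qed
qed

lemma psum_component_nonzero:
  assumes "psum L x \<noteq> 0"
  obtains a where "psum (filter (\<lambda>p. fst (snd p) = int a) L) x \<noteq> 0"
proof -
  obtain M where M: "\<forall>p\<in>set L. fst (snd p) \<le> int M"
    using degree_bound by blast
  show ?thesis
  proof (rule ccontr)
    assume "\<not> thesis"
    then have "psum (filter (\<lambda>p. fst (snd p) = int a) L) x = 0" for a
      using that by blast
    then show False
      using psum_scale_components[OF M, of 1 x] assms by simp
  qed
qed

lemma filter_symb: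
  "filter (\<lambda>p. fst (snd p) = d) (symb k Y L) = symb k Y (filter (\<lambda>p. fst (snd p) = d + int k) L)"
  by (simp add: symb_def filter_map o_def algebra_simps cong: filter_cong)

text \<open>A combination of a homogeneous polynomial of degree \<open>w\<close> and one of degree \<open>k\<close> solves the
  mixed equation; the two parts scale differently.\<close>

lemma exists_unscalable_solution:
  fixes Y Z :: "real ^ 'n \<Rightarrow> complex"
  assumes L0: "\<forall>p\<in>set L0. fst p \<in> \<real>"
    and ker: "\<And>x. psum (symb k Y L0) x = 0" and nonker: "psum (symb w Z L0) x0 \<noteq> 0"
    and kw: "k < w" and \<xi>1: "Y \<xi>1 \<noteq> 0"
    and Z: "\<And>\<xi>. Z \<xi> \<in> \<real>" and K: "K = UNIV \<or> (K = \<real> \<and> Y \<xi>1 \<in> \<real>)"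
  obtains L where "\<forall>p\<in>set L. fst p \<in> K \<and> 0 \<le> fst (snd p) \<and> fst (snd p) \<le> int w"
    and "\<And>x. psum (symb k Y L) x + psum (symb w Z L) x = 0"
    and "psum (symb k Y (map (\<lambda>(b, n, \<xi>). (of_real 2 ^ nat n * b, n, \<xi>)) L)) 0
       + psum (symb w Z (map (\<lambda>(b, n, \<xi>). (of_real 2 ^ nat n * b, n, \<xi>)) L)) 0 \<noteq> 0"
proof -
  \<comment> \<open>A component of the image under \<open>Z\<close> that does not vanish at
    \<open>x0\<close>, of degree \<open>a\<close>. It comes from the entries of exponent
    \<open>a + w\<close>, and only these are kept.\<close>
  obtain a where a: "psum (filter (\<lambda>p. fst (snd p) = int a) (symb w Z L0)) x0 \<noteq> 0"
    using psum_component_nonzero[OF nonker] by blast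
  define L1 where "L1 = filter (\<lambda>p. fst (snd p) = int (a + w)) L0"
  have W1: "psum (symb w Z L1) x0 \<noteq> 0"
    using a by (simp add: filter_symb L1_def)
  have X1: "psum (symb k Y L1) x = 0" for x
  proof -
    have "int (a + w - k) + int k = int (a + w)"
      using kw by simp
    then show ?thesis
      using psum_component_zero[OF ker, of "a + w - k" x] by (simp only: filter_symb L1_def)
  qed
  have L1: "fst (snd p) = int (a + w)" "fst p \<in> \<real>" if "p \<in> set L1" for p
    using that L0 by (auto simp: L1_def)
  \<comment> \<open>\<open>L2\<close> represents the derivative of \<open>L1\<close> of order
    \<open>a\<close> in the direction \<open>x0\<close>, divided by the factorial of
    \<open>a\<close>. It commutes with both operators: \<open>Y\<close> still annihilates it, while
    the image under \<open>Z\<close>, homogeneous of degree \<open>a\<close>, becomes the constant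
    \<open>c\<close>, its value at \<open>x0\<close>.\<close>
  define \<beta> where "\<beta> p = dp (int a) (of_real (snd (snd p) \<bullet> x0))" for p :: "complex \<times> int \<times> (real ^ 'n)"
  define L2 where "L2 = map (\<lambda>p. (fst p * \<beta> p, int w, snd (snd p))) L1"
  define c where "c = psum (symb w Z L1) x0"
  have \<beta>_real: "\<beta> p \<in> \<real>" for p
    by (auto simp: \<beta>_def dp_def intro!: Reals_divide Reals_power fact_in_Reals)
  have X2: "psum (symb k Y L2) x = 0" for x
  proof -
    let ?M = "a + w"
    let ?g = "\<lambda>e. \<Sum>p\<leftarrow>L1. Y (snd (snd p)) * fst p * (dp (int e) (of_real (snd (snd p) \<bullet> x0))
       * dp (int (a + w) - int k - int e) (of_real (snd (snd p) \<bullet> x)))"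
    \<comment> \<open>The vanishing image of \<open>L1\<close> under \<open>Y\<close>, expanded at
      \<open>s x0 + x\<close> in powers of \<open>s\<close>; the image of \<open>L2\<close> is the
      coefficient of \<open>s ^ a\<close>.\<close>
    have "(\<Sum>e\<le>?M. of_nat s ^ e * ?g e) = 0" for s
    proof -
      have "0 = psum (symb k Y L1) (real s *\<^sub>R x0 + x)"
        by (simp add: X1)
      also have "\<dots> = (\<Sum>p\<leftarrow>L1. \<Sum>e\<le>?M. of_nat s ^ e * (Y (snd (snd p)) * fst p * (dp (int e) (of_real (snd (snd p) \<bullet> x0))
          * dp (int (a + w) - int k - int e) (of_real (snd (snd p) \<bullet> x)))))"
        unfolding psum_symb
      proof (intro arg_cong[of _ _ sum_list] map_cong refl)
        fix p assume "p \<in> set L1"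
        have "dp (int (a + w) - int k) (of_real (snd (snd p) \<bullet> (real s *\<^sub>R x0 + x))) =
           (\<Sum>e\<le>?M. of_nat s ^ e * dp (int e) (of_real (snd (snd p) \<bullet> x0))
              * dp (int (a + w) - int k - int e) (of_real (snd (snd p) \<bullet> x)))"
          using dp_add[of "int (a + w) - int k" ?M "of_nat s * of_real (snd (snd p) \<bullet> x0)" "of_real (snd (snd p) \<bullet> x)"]
          by (simp add: inner_add_right dp_scale)
        then show "Y (snd (snd p)) * fst p * dp (fst (snd p) - int k) (of_real (snd (snd p) \<bullet> (real s *\<^sub>R x0 + x))) =
          (\<Sum>e\<le>?M. of_nat s ^ e * (Y (snd (snd p)) * fst p * (dp (int e) (of_real (snd (snd p) \<bullet> x0))
          * dp (int (a + w) - int k - int e) (of_real (snd (snd p) \<bullet> x)))))"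
          using L1(1)[OF \<open>p \<in> set L1\<close>] by (simp add: sum_distrib_left mult_ac)
      qed
      also have "\<dots> = (\<Sum>e\<le>?M. of_nat s ^ e * ?g e)"
        by (simp add: sum_list_sum sum_list_const_mult)
      finally show ?thesis by simp
    qed
    from polynomial_coeffs_zero[of ?g, OF this, of a]
    have "?g a = 0" by simp
    then show ?thesis
      by (simp add: psum_symb L2_def o_def \<beta>_def mult.assoc)
  qed
  have W2: "psum (symb w Z L2) x = c" for x
  proof -
    have "psum (symb w Z L2) x = (\<Sum>p\<leftarrow>L1. Z (snd (snd p)) * (fst p * \<beta> p))"
      by (simp add: psum_symb L2_def o_def)
    also have "\<dots> = c"
      unfolding c_def psum_symb
      by (intro arg_cong[of _ _ sum_list] map_cong refl) (simp add: L1 \<beta>_def)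
    finally show ?thesis .
  qed
  have "c \<in> \<real>"
    unfolding c_def by (rule psum_in) (auto simp: symb_def L1 Z)
  \<comment> \<open>The \<open>k\<close>th divided power in the direction \<open>\<xi>1\<close> has
    the constant image \<open>Y \<xi>1\<close> under \<open>Y\<close>, so \<open>b3\<close> makes it
    cancel \<open>c\<close>. Its image under \<open>Z\<close> is 0 because \<open>k < w\<close>
    makes the index negative.\<close>
  define b3 where "b3 = - c / Y \<xi>1"
  have b3: "b3 \<in> K"
    using K \<open>c \<in> \<real>\<close> by (auto simp: b3_def)
  define L3 where "L3 = (b3, int k, \<xi>1) # L2"
  have X3: "psum (symb k Y L3) x = - c" for x
    using X2[of x] \<xi>1 by (simp add: L3_def psum_symb b3_def)
  have W3: "psum (symb w Z L3) x = c" for x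
    using W2[of x] kw by (simp add: L3_def psum_symb)
  let ?s = "map (\<lambda>(b, n, \<xi>). (of_real 2 ^ nat n * b, n, \<xi>))"
  have s2: "psum (symb k' Y' (?s L2)) x = 2 ^ w * psum (symb k' Y' L2) x" for k' Y' x
    by (simp add: psum_symb L2_def o_def sum_list_const_mult[symmetric] mult_ac)
  have X3s: "psum (symb k Y (?s L3)) 0 = - c * 2 ^ k"
  proof -
    have "psum (symb k Y (?s L3)) 0 = Y \<xi>1 * (2 ^ k * b3) + psum (symb k Y (?s L2)) 0"
      by (simp add: L3_def psum_symb)
    then show ?thesis
      using \<xi>1 by (simp only: s2 X2) (simp add: b3_def)
  qed
  have W3s: "psum (symb w Z (?s L3)) 0 = c * 2 ^ w"
  proof -
    have "psum (symb w Z (?s L3)) 0 = psum (symb w Z (?s L2)) 0"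
      using kw by (simp add: L3_def psum_symb)
    then show ?thesis
      by (simp only: s2 W2) simp
  qed
  \<comment> \<open>Dilation by 2 multiplies the part of degree \<open>w\<close> by
    \<open>2 ^ w\<close> and the part of degree \<open>k\<close> by \<open>2 ^ k\<close>. The
    cancellation of \<open>- c\<close> against \<open>c\<close> therefore fails after
    dilation.\<close>
  have "(2::complex) ^ k \<noteq> 2 ^ w"
  proof
    assume "(2::complex) ^ k = 2 ^ w"
    then have "norm ((2::complex) ^ k) = norm ((2::complex) ^ w)" by simp
    then show False
      using kw by (simp add: norm_power)
  qed
  then have ne: "- c * 2 ^ k + c * 2 ^ w \<noteq> 0"
    using W1 by (simp add: c_def algebra_simps)
  show ?thesis
  proof (rule that[of L3])
    show "\<forall>p\<in>set L3. fst p \<in> K \<and> 0 \<le> fst (snd p) \<and> fst (snd p) \<le> int w"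
      using b3 kw L1(2) \<beta>_real K by (auto simp: L3_def L2_def)
    show "psum (symb k Y L3) x + psum (symb w Z L3) x = 0" for x
      by (simp add: X3 W3)
    show "psum (symb k Y (?s L3)) 0 + psum (symb w Z (?s L3)) 0 \<noteq> 0"
      using ne by (simp only: X3s W3s not_False_eq_True)
  qed
qed

section \<open>Compactly supported distributions\<close>

locale cdist =
  fixes \<phi> :: "(real ^ 'n \<Rightarrow> complex) \<Rightarrow> complex"
  assumes cdist: "compact_distribution \<phi>"
begin

lemma phi_linear: "smooth \<psi> \<Longrightarrow> smooth \<eta> \<Longrightarrow> \<phi> (\<lambda>x. c * \<psi> x + \<eta> x) = c * \<phi> \<psi> + \<phi> \<eta>"
  using cdist unfolding compact_distribution_def by blast

lemma phi_0 [simp]: "\<phi> (\<lambda>x. 0) = 0"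
  using phi_linear[of "\<lambda>_. 0" "\<lambda>_. 0" 1] by simp

lemma phi_cmult: "smooth \<psi> \<Longrightarrow> \<phi> (\<lambda>x. c * \<psi> x) = c * \<phi> \<psi>"
  using phi_linear[of \<psi> "\<lambda>_. 0" c] by simp

lemma phi_add: "smooth \<psi> \<Longrightarrow> smooth \<eta> \<Longrightarrow> \<phi> (\<lambda>x. \<psi> x + \<eta> x) = \<phi> \<psi> + \<phi> \<eta>"
  using phi_linear[of \<psi> \<eta> 1] by simp

lemma phi_diff: "smooth \<psi> \<Longrightarrow> smooth \<eta> \<Longrightarrow> \<phi> (\<lambda>x. \<psi> x - \<eta> x) = \<phi> \<psi> - \<phi> \<eta>"
  using phi_linear[of \<eta> \<psi> "-1"] by simp

lemma phi_sum: "(\<And>i. i \<in> I \<Longrightarrow> smooth (f i)) \<Longrightarrow> \<phi> (\<lambda>x. \<Sum>i\<in>I. f i x) = (\<Sum>i\<in>I. \<phi> (f i))"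
  by (induction I rule: infinite_finite_induct) (auto simp: phi_add smooth_sum)

lemma phi_sum_list:
  "(\<And>p. p \<in> set L \<Longrightarrow> smooth (f p)) \<Longrightarrow> \<phi> (\<lambda>x. \<Sum>p\<leftarrow>L. f p x) = (\<Sum>p\<leftarrow>L. \<phi> (f p))"
  by (induction L) (auto simp: phi_add smooth_sum_list)

text \<open>The seminorm estimate over words of derivatives instead of multi-indices, with radius
  and constant made nonnegative for use in later inequalities.\<close>

lemma phi_bound:
  "\<exists>r C N. 0 \<le> r \<and> 0 \<le> C \<and> (\<forall>\<psi> B. smooth \<psi> \<longrightarrow>
      (\<forall>is x. length is \<le> N \<longrightarrow> norm x \<le> r \<longrightarrow> cmod (foldr pd is \<psi> x) \<le> B) \<longrightarrow> cmod (\<phi> \<psi>) \<le> C * B)"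
proof -
  have "\<exists>r N C. \<forall>\<psi> B. smooth \<psi> \<longrightarrow>
      (\<forall>\<alpha> x. mdeg \<alpha> \<le> N \<longrightarrow> norm x \<le> r \<longrightarrow> cmod (mpd \<alpha> \<psi> x) \<le> B) \<longrightarrow> cmod (\<phi> \<psi>) \<le> C * B"
    using cdist unfolding compact_distribution_def by (rule conjunct2)
  then obtain r N C where *: "\<forall>\<psi> B. smooth \<psi> \<longrightarrow>
      (\<forall>\<alpha> x. mdeg \<alpha> \<le> N \<longrightarrow> norm x \<le> r \<longrightarrow> cmod (mpd \<alpha> \<psi> x) \<le> B) \<longrightarrow> cmod (\<phi> \<psi>) \<le> C * B"
    by (elim exE)
  show ?thesis
  proof (rule exI[of _ "max r 0"], rule exI[of _ "\<bar>C\<bar>"], rule exI[of _ N], intro conjI allI impI)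
    fix \<psi> :: "real ^ 'n \<Rightarrow> complex" and B
    assume \<psi>: "smooth \<psi>"
      and B: "\<forall>is x. length is \<le> N \<longrightarrow> norm x \<le> max r 0 \<longrightarrow> cmod (foldr pd is \<psi> x) \<le> B"
    have "cmod (\<phi> \<psi>) \<le> C * B"
    proof (rule *[rule_format, OF \<psi>])
      fix \<alpha> :: "nat ^ 'n" and x :: "real ^ 'n"
      assume "mdeg \<alpha> \<le> N" "norm x \<le> r"
      then show "cmod (mpd \<alpha> \<psi> x) \<le> B"
        using B[rule_format, of "pd_seq \<alpha>" x] by (simp add: mpd_eq_foldr length_pd_seq)
    qed
    \<comment> \<open>The empty word at the origin shows this; the origin lies in the ball because
      the radius was replaced by \<open>max r 0\<close>.\<close>
    moreover have "0 \<le> B"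
      using order_trans[OF norm_ge_zero B[rule_format, of "[]" 0]] by simp
    ultimately show "cmod (\<phi> \<psi>) \<le> \<bar>C\<bar> * B"
      using mult_right_mono[OF abs_ge_self[of C], of B] by simp
  qed simp_all
qed

end

section \<open>Interchange of a distribution with an integral\<close>

text \<open>Differentiation under the integral sign. The derivatives form a family of bounded linear
  maps, whose continuity is checked on coordinate vectors, where it is continuity of a partial
  derivative.\<close>

lemma has_derivative_parametric_integral:
  fixes \<psi> :: "real ^ 'n \<Rightarrow> complex" and q :: "real ^ 'n \<Rightarrow> complex"
  assumes \<psi>: "smooth \<psi>" and q: "continuous_on UNIV q"
  shows "((\<lambda>x. integral (cbox a b) (\<lambda>y. q y * \<psi> (x + y))) has_derivative
      (\<lambda>h. integral (cbox a b) (\<lambda>y. q y * frechet_derivative \<psi> (at (x + y)) h))) (at x)"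
proof -
  define D where "D z = frechet_derivative \<psi> (at z)" for z
  have D: "(\<psi> has_derivative D z) (at z)" for z
    using smooth_differentiable[OF \<psi>, of z] by (simp add: frechet_derivative_works D_def)
  define fx where "fx x y = Blinfun (\<lambda>h. q y * D (x + y) h)" for x y
  have bl: "bounded_linear (\<lambda>h. q y * D (x + y) h)" for x y
    by (rule bounded_linear_compose[OF bounded_linear_mult_right has_derivative_bounded_linear[OF D]])
  have fx: "blinfun_apply (fx x y) = (\<lambda>h. q y * D (x + y) h)" for x y
    unfolding fx_def by (rule bounded_linear_Blinfun_apply[OF bl])
  have cont: "continuous_on (UNIV \<times> cbox a b) (\<lambda>(x, y). fx x y)"
  proof (rule continuous_on_blinfun_componentwise)
    fix e :: "real ^ 'n" assume "e \<in> Basis"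
    then obtain i where e: "e = axis i 1"
      by (auto simp: Basis_vec_def)
    have "D z e = pd i \<psi> z" for z
      using pd_eq_derivative[OF D] by (simp add: e)
    then have eq: "(\<lambda>p. blinfun_apply (case p of (x, y) \<Rightarrow> fx x y) e) = (\<lambda>p. q (snd p) * pd i \<psi> (fst p + snd p))"
      by (auto simp: fx)
    have "continuous_on (UNIV \<times> cbox a b) (\<lambda>p. q (snd p) * pd i \<psi> (fst p + snd p))"
      by (intro continuous_intros continuous_on_compose2[OF q] continuous_on_compose2[OF smooth_continuous[OF smooth_pd[OF \<psi>], of UNIV]])
        auto
    then show "continuous_on (UNIV \<times> cbox a b) (\<lambda>p. blinfun_apply (case p of (x, y) \<Rightarrow> fx x y) e)"
      unfolding eq .
  qed
  have "((\<lambda>x. integral (cbox a b) (\<lambda>y. q y * \<psi> (x + y))) has_derivative integral (cbox a b) (fx x)) (at x within UNIV)"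
  proof (rule leibniz_rule[OF _ _ cont])
    show "((\<lambda>x. q t * \<psi> (x + t)) has_derivative blinfun_apply (fx x t)) (at x within UNIV)" for x t
    proof -
      have "((\<lambda>x. x + t) has_derivative (\<lambda>h. h)) (at x)"
        by (auto intro!: derivative_eq_intros)
      from has_derivative_compose[OF this D]
      show ?thesis
        unfolding fx by (intro has_derivative_mult_right) simp
    qed
    show "(\<lambda>y. q y * \<psi> (x + y)) integrable_on cbox a b" for x
      by (intro integrable_continuous continuous_intros continuous_on_compose2[OF q]
          continuous_on_compose2[OF smooth_continuous[OF \<psi>, of UNIV]]) auto
  qed auto
  moreover have "blinfun_apply (integral (cbox a b) (fx x)) h = integral (cbox a b) (\<lambda>y. q y * D (x + y) h)" for h
  proof -
    have "continuous_on (cbox a b) (\<lambda>y. (x, y))"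
      by (intro continuous_intros)
    moreover have "(\<lambda>y. (x, y)) ` cbox a b \<subseteq> UNIV \<times> cbox a b"
      by blast
    ultimately have "continuous_on (cbox a b) (\<lambda>y. case (x, y) of (x, y) \<Rightarrow> fx x y)"
      by (rule continuous_on_compose2[OF cont])
    then have "continuous_on (cbox a b) (fx x)"
      by (simp only: prod.case)
    then have "fx x integrable_on cbox a b"
      by (rule integrable_continuous)
    from blinfun_apply_integral[OF this, of h] show ?thesis
      unfolding fx .
  qed
  then have "blinfun_apply (integral (cbox a b) (fx x)) = (\<lambda>h. integral (cbox a b) (\<lambda>y. q y * D (x + y) h))"
    by (rule ext)
  ultimately show ?thesis
    unfolding D_def by (simp only:)
qed

definition param_int ::
    "real ^ 'n \<Rightarrow> real ^ 'n \<Rightarrow> (real ^ 'n \<Rightarrow> complex) \<Rightarrow> (real ^ 'n \<Rightarrow> complex) \<Rightarrow> real ^ 'n \<Rightarrow> complex" where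
  "param_int a b q \<psi> x = integral (cbox a b) (\<lambda>y. q y * \<psi> (x + y))"

lemma param_int_differentiable:
  assumes "smooth \<psi>" "continuous_on UNIV q"
  shows "param_int a b q \<psi> differentiable (at x)"
  using has_derivative_parametric_integral[OF assms, of a b x]
  unfolding differentiable_def param_int_def[abs_def] by blast

lemma pd_param_int:
  assumes \<psi>: "smooth \<psi>" and q: "continuous_on UNIV q"
  shows "pd i (param_int a b q \<psi>) = param_int a b q (pd i \<psi>)"
proof
  fix x
  have D: "(\<psi> has_derivative frechet_derivative \<psi> (at z)) (at z)" for z
    using smooth_differentiable[OF \<psi>, of z] by (simp add: frechet_derivative_works)
  have "pd i (param_int a b q \<psi>) x = integral (cbox a b) (\<lambda>y. q y * frechet_derivative \<psi> (at (x + y)) (axis i 1))"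
    using pd_eq_derivative[OF has_derivative_parametric_integral[OF assms]] unfolding param_int_def[abs_def] .
  then show "pd i (param_int a b q \<psi>) x = param_int a b q (pd i \<psi>) x"
    by (simp only: param_int_def pd_eq_derivative[OF D])
qed

lemma smooth_param_int:
  assumes \<psi>: "smooth \<psi>" and q: "continuous_on UNIV q"
  shows "smooth (param_int a b q \<psi>)"
proof (rule smooth_coinduct[where P = "\<lambda>h. \<exists>\<psi>. smooth \<psi> \<and> h = param_int a b q \<psi>"])
  show "\<exists>\<psi>'. smooth \<psi>' \<and> param_int a b q \<psi> = param_int a b q \<psi>'"
    using \<psi> by blast
next
  fix f x assume "\<exists>\<psi>. smooth \<psi> \<and> f = param_int a b q \<psi>"
  then show "f differentiable at x"
    using param_int_differentiable[OF _ q] by blast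
next
  fix f i assume "\<exists>\<psi>. smooth \<psi> \<and> f = param_int a b q \<psi>"
  then obtain \<psi> where "smooth \<psi>" "f = param_int a b q \<psi>"
    by blast
  then show "\<exists>\<psi>. smooth \<psi> \<and> pd i f = param_int a b q \<psi>"
    by (intro exI[of _ "pd i \<psi>"]) (simp add: pd_param_int q smooth_pd)
qed

lemma foldr_pd_param_int:
  assumes \<psi>: "smooth \<psi>" and q: "continuous_on UNIV q"
  shows "foldr pd is (param_int a b q \<psi>) = param_int a b q (foldr pd is \<psi>)"
  by (induction "is") (simp_all add: pd_param_int q smooth_foldr_pd[OF \<psi>])

text \<open>The error depends on the oscillation alone, so one fine division serves simultaneously
  for all points of a ball and for all derivatives up to a given order.\<close>

lemma riemann_sum_error:
  fixes g :: "'a::euclidean_space \<Rightarrow> complex"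
  assumes D: "D tagged_division_of cbox a b" "(\<lambda>y. ball y \<delta>) fine D"
    and g: "continuous_on (cbox a b) g"
    and osc: "\<And>y z. y \<in> cbox a b \<Longrightarrow> z \<in> cbox a b \<Longrightarrow> dist z y < \<delta> \<Longrightarrow> cmod (g z - g y) \<le> \<epsilon>"
  shows "cmod ((\<Sum>(y, k)\<in>D. measure lborel k *\<^sub>R g y) - integral (cbox a b) g) \<le> \<epsilon> * measure lborel (cbox a b)"
proof -
  have gi: "g integrable_on cbox a b"
    by (rule integrable_continuous[OF g])
  have I: "integral (cbox a b) g = (\<Sum>(y, k)\<in>D. integral k g)"
    by (rule integral_combine_tagged_division_topdown[OF gi D(1)])
  have "(\<Sum>(y, k)\<in>D. measure lborel k *\<^sub>R g y) - integral (cbox a b) g =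
      (\<Sum>(y, k)\<in>D. measure lborel k *\<^sub>R g y - integral k g)"
    by (simp add: I sum_subtractf split_beta)
  also have "cmod \<dots> \<le> (\<Sum>(y, k)\<in>D. \<epsilon> * measure lborel k)"
  proof (rule sum_norm_le)
    fix p assume "p \<in> D"
    then obtain y k where p: "p = (y, k)" and yk: "(y, k) \<in> D"
      by (cases p) auto
    obtain c d where k: "k = cbox c d"
      using tagged_division_ofD(4)[OF D(1) yk] by blast
    have sub: "k \<subseteq> cbox a b" and y: "y \<in> k"
      using tagged_division_ofD(2,3)[OF D(1) yk] by simp_all
    have kb: "k \<subseteq> ball y \<delta>"
      using D(2) yk unfolding fine_def by blast
    have gk: "g integrable_on cbox c d"
      using Henstock_Kurzweil_Integration.integrable_subinterval[OF gi] sub unfolding k by blast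
    have dist: "dist z y < \<delta>" if "z \<in> cbox c d" for z
      using that kb by (auto simp: k dist_commute)
    have hi: "((\<lambda>z. g y - g z) has_integral measure lborel (cbox c d) *\<^sub>R g y - integral (cbox c d) g) (cbox c d)"
      by (intro has_integral_diff has_integral_const integrable_integral gk)
    then have "integral (cbox c d) (\<lambda>z. g y - g z) = measure lborel (cbox c d) *\<^sub>R g y - integral (cbox c d) g"
      by (rule integral_unique)
    moreover have "norm (integral (cbox c d) (\<lambda>z. g y - g z)) \<le> \<epsilon> * measure lborel (cbox c d)"
    proof (rule integrable_bound)
      have "cmod (g y - g y) \<le> \<epsilon>"
        using osc[of y y] sub y dist[of y] by (auto simp: k)
      then show "0 \<le> \<epsilon>" by simp
      show "(\<lambda>z. g y - g z) integrable_on cbox c d"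
        using hi by blast
      show "norm (g y - g z) \<le> \<epsilon>" if "z \<in> cbox c d" for z
      proof -
        have "cmod (g z - g y) \<le> \<epsilon>"
          using that sub y by (intro osc dist) (auto simp: k)
        then show ?thesis
          by (simp add: norm_minus_commute)
      qed
    qed
    ultimately show "cmod (case p of (y, k) \<Rightarrow> measure lborel k *\<^sub>R g y - integral k g) \<le> (case p of (y, k) \<Rightarrow> \<epsilon> * measure lborel k)"
      by (simp add: k p)
  qed
  also have "\<dots> = \<epsilon> * measure lborel (cbox a b)"
    using additive_content_tagged_division[OF D(1)] by (simp add: split_beta sum_distrib_left[symmetric])
  finally show ?thesis .
qed

context cdist
begin

text \<open>The Riemann sums in \<open>y\<close> converge to the integral together with their
  derivatives in \<open>x\<close>, uniformly on the ball that controls \<open>\<phi>\<close>. By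
  linearity \<open>\<phi>\<close> maps them to the Riemann sums of the left-hand integrand.\<close>

lemma phi_integral:
  assumes \<psi>: "smooth \<psi>" and q: "continuous_on UNIV q"
  shows "((\<lambda>y. q y * \<phi> (\<lambda>x. \<psi> (x + y))) has_integral
     \<phi> (\<lambda>x. integral (cbox a b) (\<lambda>y. q y * \<psi> (x + y)))) (cbox a b)"
  unfolding has_integral
proof (intro allI impI)
  fix e :: real assume e: "e > 0"
  obtain r C N where r: "0 \<le> r" and C: "0 \<le> C"
    and bound: "\<forall>\<psi> B. smooth \<psi> \<longrightarrow>
      (\<forall>is x. length is \<le> N \<longrightarrow> norm x \<le> r \<longrightarrow> cmod (foldr pd is \<psi> x) \<le> B) \<longrightarrow> cmod (\<phi> \<psi>) \<le> C * B"
    using phi_bound by (elim exE conjE)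
  let ?c = "measure lborel (cbox a b)"
  \<comment> \<open>The error will be \<open>C * ?c * \<epsilon>\<close>; the denominator keeps it
    strictly below \<open>e\<close> and is positive even if \<open>C * ?c = 0\<close>.\<close>
  define \<epsilon> where "\<epsilon> = e / (2 * (C * ?c + 1))"
  have pos: "C * ?c + 1 > 0"
    using C by (simp add: add_nonneg_pos)
  then have \<epsilon>: "\<epsilon> > 0"
    using e by (simp add: \<epsilon>_def)
  let ?I = "{is :: 'n list. length is \<le> N}"
  have fin: "finite ?I"
    using finite_lists_length_le[of "UNIV :: 'n set" N] by simp
  have "\<exists>\<delta>>0. \<forall>x y z. norm x \<le> r \<longrightarrow> y \<in> cbox a b \<longrightarrow> z \<in> cbox a b \<longrightarrow> dist z y < \<delta> \<longrightarrow>
      cmod (q z * foldr pd is \<psi> (x + z) - q y * foldr pd is \<psi> (x + y)) \<le> \<epsilon>" for "is"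
  proof -
    have "uniformly_continuous_on (cball 0 r \<times> cbox a b) (\<lambda>p. q (snd p) * foldr pd is \<psi> (fst p + snd p))"
      by (intro compact_uniformly_continuous compact_Times continuous_intros continuous_on_compose2[OF q]
          continuous_on_compose2[OF smooth_continuous[OF smooth_foldr_pd[OF \<psi>], of UNIV]]) auto
    then obtain \<delta> where \<delta>: "\<delta> > 0" "\<And>p p'. p \<in> cball 0 r \<times> cbox a b \<Longrightarrow> p' \<in> cball 0 r \<times> cbox a b \<Longrightarrow> dist p' p < \<delta> \<Longrightarrow>
        dist (q (snd p') * foldr pd is \<psi> (fst p' + snd p')) (q (snd p) * foldr pd is \<psi> (fst p + snd p)) < \<epsilon>"
      using \<epsilon> unfolding uniformly_continuous_on_def by metis
    show ?thesis
    proof (intro exI[of _ \<delta>] conjI allI impI \<delta>(1))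
      fix x y z :: "real ^ 'n" assume "norm x \<le> r" "y \<in> cbox a b" "z \<in> cbox a b" "dist z y < \<delta>"
      then show "cmod (q z * foldr pd is \<psi> (x + z) - q y * foldr pd is \<psi> (x + y)) \<le> \<epsilon>"
        using \<delta>(2)[of "(x, y)" "(x, z)"] by (simp add: dist_norm dist_Pair_Pair)
    qed
  qed
  then obtain d where d: "\<And>is. d is > 0"
    "\<And>is x y z. norm x \<le> r \<Longrightarrow> y \<in> cbox a b \<Longrightarrow> z \<in> cbox a b \<Longrightarrow> dist z y < d is \<Longrightarrow>
      cmod (q z * foldr pd is \<psi> (x + z) - q y * foldr pd is \<psi> (x + y)) \<le> \<epsilon>"
    by metis
  \<comment> \<open>Only finitely many words have length at most \<open>N\<close>, so one modulus of
    continuity serves them all.\<close>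
  define \<delta> where "\<delta> = Min (d ` ?I)"
  have ne: "?I \<noteq> {}"
    by (auto intro: exI[of _ "[]"])
  have \<delta>: "\<delta> > 0" "\<And>is. length is \<le> N \<Longrightarrow> \<delta> \<le> d is"
    using fin ne d(1) by (auto simp: \<delta>_def)
  define J where "J = param_int a b q"
  have J: "smooth (J \<psi>)" "\<And>is. foldr pd is (J \<psi>) = J (foldr pd is \<psi>)"
    by (simp_all add: J_def smooth_param_int foldr_pd_param_int \<psi> q)
  show "\<exists>\<gamma>. gauge \<gamma> \<and> (\<forall>D. D tagged_division_of cbox a b \<and> \<gamma> fine D \<longrightarrow>
      cmod ((\<Sum>(y, k)\<in>D. measure lborel k *\<^sub>R (q y * \<phi> (\<lambda>x. \<psi> (x + y))))
         - \<phi> (\<lambda>x. integral (cbox a b) (\<lambda>y. q y * \<psi> (x + y)))) < e)"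
  proof (intro exI[of _ "\<lambda>y. ball y \<delta>"] conjI allI impI)
    show "gauge (\<lambda>y. ball y \<delta>)"
      using \<delta>(1) by (rule gauge_ball)
    fix D assume D: "D tagged_division_of cbox a b \<and> (\<lambda>y. ball y \<delta>) fine D"
    let ?S = "\<lambda>x. \<Sum>p\<in>D. (of_real (measure lborel (snd p)) * q (fst p)) * \<psi> (x + fst p)"
    have sm: "smooth (\<lambda>x. (of_real (measure lborel (snd p)) * q (fst p)) * \<psi> (x + fst p))" for p
      by (intro smooth_mult smooth_const smooth_translate \<psi>)
    have S: "smooth ?S"
      by (intro smooth_sum sm)
    have "(\<Sum>(y, k)\<in>D. measure lborel k *\<^sub>R (q y * \<phi> (\<lambda>x. \<psi> (x + y)))) = \<phi> ?S"
      unfolding phi_sum[OF sm] phi_cmult[OF smooth_translate[OF \<psi>]]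
      by (simp add: split_beta scaleR_conv_of_real mult.assoc)
    then have "(\<Sum>(y, k)\<in>D. measure lborel k *\<^sub>R (q y * \<phi> (\<lambda>x. \<psi> (x + y)))) - \<phi> (J \<psi>) = \<phi> (\<lambda>x. ?S x - J \<psi> x)"
      by (simp add: phi_diff S J)
    also have "cmod \<dots> \<le> C * (\<epsilon> * ?c)"
    proof (rule bound[rule_format])
      show "smooth (\<lambda>x. ?S x - J \<psi> x)"
        by (intro smooth_diff S J)
      fix "is" :: "'n list" and x :: "real ^ 'n" assume len: "length is \<le> N" and x: "norm x \<le> r"
      let ?g = "\<lambda>y. q y * foldr pd is \<psi> (x + y)"
      have "foldr pd is (\<lambda>x. ?S x + (-1) * J \<psi> x) x = foldr pd is ?S x + (-1) * foldr pd is (J \<psi>) x"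
        using foldr_pd_add[OF S smooth_mult[OF smooth_const J(1)], of "is" "-1"]
          foldr_pd_cmult[OF J(1), of "is" "-1"] by simp
      also have "foldr pd is ?S x = (\<Sum>p\<in>D. of_real (measure lborel (snd p)) * q (fst p) * foldr pd is \<psi> (x + fst p))"
        by (subst foldr_pd_sum[OF sm]) (simp add: foldr_pd_cmult smooth_translate \<psi> foldr_pd_translate)
      finally have "foldr pd is (\<lambda>x. ?S x - J \<psi> x) x = (\<Sum>(y, k)\<in>D. measure lborel k *\<^sub>R ?g y) - integral (cbox a b) ?g"
        by (simp add: J(2)) (simp add: J_def param_int_def split_beta scaleR_conv_of_real mult.assoc)
      also have "cmod \<dots> \<le> \<epsilon> * ?c"
      proof (rule riemann_sum_error)
        show "continuous_on (cbox a b) ?g"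
          by (intro continuous_intros continuous_on_compose2[OF q]
             continuous_on_compose2[OF smooth_continuous[OF smooth_foldr_pd[OF \<psi>], of UNIV]]) auto
        show "cmod (?g z - ?g y) \<le> \<epsilon>" if "y \<in> cbox a b" "z \<in> cbox a b" "dist z y < \<delta>" for y z
          using d(2)[OF x that(1,2)] \<delta>(2)[OF len] that(3) by force
      qed (use D in auto)
      finally show "cmod (foldr pd is (\<lambda>x. ?S x - J \<psi> x) x) \<le> \<epsilon> * ?c" .
    qed
    also have "\<dots> = (C * ?c) * \<epsilon>" by simp
    also have "\<dots> < (2 * (C * ?c + 1)) * \<epsilon>"
      using \<epsilon> C by (intro mult_strict_right_mono) (auto intro: add_nonneg_pos simp: mult_nonneg_nonneg)
    also have "\<dots> = e"
      using pos by (simp add: \<epsilon>_def)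
    finally show "cmod ((\<Sum>(y, k)\<in>D. measure lborel k *\<^sub>R (q y * \<phi> (\<lambda>x. \<psi> (x + y))))
         - \<phi> (\<lambda>x. integral (cbox a b) (\<lambda>y. q y * \<psi> (x + y)))) < e"
      by (simp add: J_def param_int_def[abs_def])
  qed
qed

end

section \<open>Taylor coefficients along lines\<close>

text \<open>The Taylor remainder of \<open>exp\<close>. Differentiation replaces \<open>M\<close> by
  \<open>M - 1\<close>, and natural subtraction is right also at \<open>M = 0\<close>, where the
  remainder is \<open>exp\<close> itself.\<close>

definition exp_rem :: "nat \<Rightarrow> complex \<Rightarrow> complex" where
  "exp_rem M z = exp z - (\<Sum>n<M. dp (int n) z)"

lemma DERIV_exp_rem: "(exp_rem M has_field_derivative exp_rem (M - 1) z) (at z)"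
proof -
  have "((\<lambda>z. exp z - (\<Sum>n<M. dp (int n) z)) has_field_derivative exp z - (\<Sum>n<M. dp (int n - 1) z)) (at z)"
    by (intro DERIV_diff DERIV_exp DERIV_sum DERIV_dp)
  moreover have "(\<Sum>n<M. dp (int n - 1) z) = (\<Sum>n<M - 1. dp (int n) z)"
  proof (cases M)
    case (Suc M')
    have "(\<Sum>n<Suc M'. dp (int n - 1) z) = dp (int 0 - 1) z + (\<Sum>n<M'. dp (int (Suc n) - 1) z)"
      by (rule sum.lessThan_Suc_shift)
    then show ?thesis
      by (simp add: Suc)
  qed simp
  ultimately show ?thesis
    by (simp add: exp_rem_def[abs_def])
qed

lemma exp_rem_bound: "cmod (exp_rem M z) \<le> exp (cmod z) * cmod z ^ M"
proof (cases M)
  case 0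
  then show ?thesis
    using norm_exp[of z] by (simp add: exp_rem_def)
next
  case (Suc n)
  have "cmod (exp_rem M z) = cmod (exp z - (\<Sum>i\<le>n. z ^ i / fact i))"
    by (simp add: exp_rem_def Suc lessThan_Suc_atMost dp_int)
  also have "\<dots> \<le> exp (cmod z) * cmod z ^ M / fact n"
    using Taylor_exp_field[of z n] by (simp add: Suc)
  also have "\<dots> \<le> exp (cmod z) * cmod z ^ M / 1"
    by (intro divide_left_mono) (auto simp: fact_ge_1)
  finally show ?thesis by simp
qed

lemma smooth_exp_rem: "smooth (\<lambda>x::real^'n. exp_rem M (t * of_real (\<xi> \<bullet> x)))"
proof -
  have "smooth (\<lambda>x::real^'n. exp (t * of_real (\<xi> \<bullet> x)) - (\<Sum>n<M. t ^ n * dp (int n) (of_real (\<xi> \<bullet> x))))"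
    by (intro smooth_diff smooth_sum smooth_mult smooth_const smooth_dp smooth_exp_linear_form)
  then show ?thesis
    by (simp add: exp_rem_def dp_scale)
qed

lemma pd_exp_rem:
  "pd i (\<lambda>x::real^'n. exp_rem M (t * of_real (\<xi> \<bullet> x))) =
     (\<lambda>x. (t * of_real (\<xi> $ i)) * exp_rem (M - 1) (t * of_real (\<xi> \<bullet> x)))"
proof
  fix x :: "real ^ 'n"
  have "(exp_rem M has_derivative (\<lambda>h. exp_rem (M - 1) (t * of_real (\<xi> \<bullet> x)) * h)) (at (t * of_real (\<xi> \<bullet> x)))"
    using DERIV_exp_rem by (simp add: has_field_derivative_def)
  moreover have "((\<lambda>x. t * complex_of_real (\<xi> \<bullet> x)) has_derivative (\<lambda>h. t * complex_of_real (\<xi> \<bullet> h))) (at x)"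
    by (intro has_derivative_mult_right has_derivative_linear_form)
  ultimately have "((\<lambda>x. exp_rem M (t * of_real (\<xi> \<bullet> x))) has_derivative
      (\<lambda>h. exp_rem (M - 1) (t * of_real (\<xi> \<bullet> x)) * (t * complex_of_real (\<xi> \<bullet> h)))) (at x)"
    using has_derivative_compose by fastforce
  from pd_eq_derivative[OF this, of i]
  show "pd i (\<lambda>x. exp_rem M (t * of_real (\<xi> \<bullet> x))) x = (t * of_real (\<xi> $ i)) * exp_rem (M - 1) (t * of_real (\<xi> \<bullet> x))"
    by (simp add: inner_axis)
qed

text \<open>A derivative falling on the remainder lowers its order by one but contributes a factor
  \<open>t\<close>, so the power \<open>cmod t ^ M\<close> survives. The induction peels off the
  innermost derivative and hence generalizes over \<open>M\<close>.\<close>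

lemma foldr_pd_exp_rem_bound:
  fixes \<xi> \<eta> :: "real ^ 'n"
  shows "\<exists>C. 0 \<le> C \<and> (\<forall>t x. cmod t \<le> 1 \<longrightarrow> norm x \<le> r \<longrightarrow>
    cmod (foldr pd is (\<lambda>x. exp_rem M (t * of_real (\<xi> \<bullet> x)) * exp (a * of_real (\<eta> \<bullet> x))) x) \<le> C * cmod t ^ M)"
proof (induction "is" arbitrary: M rule: rev_induct)
  case Nil
  define B where "B = norm \<xi> * max r 0"
  have B: "0 \<le> B" by (simp add: B_def)
  let ?C = "exp B * B ^ M * exp (cmod a * (norm \<eta> * max r 0))"
  have "cmod (exp_rem M (t * of_real (\<xi> \<bullet> x)) * exp (a * of_real (\<eta> \<bullet> x))) \<le> ?C * cmod t ^ M"
    if t: "cmod t \<le> 1" and x: "norm x \<le> r" for t :: complex and x :: "real ^ 'n"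
  proof -
    have "\<bar>\<xi> \<bullet> x\<bar> \<le> norm \<xi> * norm x" "\<bar>\<eta> \<bullet> x\<bar> \<le> norm \<eta> * norm x"
      by (rule Cauchy_Schwarz_ineq2)+
    moreover have "norm \<xi> * norm x \<le> B" "norm \<eta> * norm x \<le> norm \<eta> * max r 0"
      using x by (auto simp: B_def intro!: mult_left_mono)
    ultimately have b: "\<bar>\<xi> \<bullet> x\<bar> \<le> B" "\<bar>\<eta> \<bullet> x\<bar> \<le> norm \<eta> * max r 0"
      by linarith+
    let ?z = "t * complex_of_real (\<xi> \<bullet> x)"
    have z: "cmod ?z \<le> cmod t * B"
      using b by (simp add: norm_mult mult_left_mono)
    also have "\<dots> \<le> B"
      using t B by (simp add: mult_left_le_one_le)
    finally have zB: "cmod ?z \<le> B" .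
    have "cmod (exp_rem M ?z) \<le> exp (cmod ?z) * cmod ?z ^ M"
      by (rule exp_rem_bound)
    also have "\<dots> \<le> exp B * (cmod t * B) ^ M"
      using z zB by (intro mult_mono power_mono) auto
    finally have 1: "cmod (exp_rem M ?z) \<le> exp B * (cmod t * B) ^ M" .
    have "cmod (exp (a * of_real (\<eta> \<bullet> x))) \<le> exp (cmod (a * of_real (\<eta> \<bullet> x)))"
      by (rule norm_exp)
    also have "\<dots> \<le> exp (cmod a * (norm \<eta> * max r 0))"
      using b by (simp add: norm_mult mult_left_mono)
    finally have "cmod (exp_rem M ?z) * cmod (exp (a * of_real (\<eta> \<bullet> x)))
        \<le> (exp B * (cmod t * B) ^ M) * exp (cmod a * (norm \<eta> * max r 0))"
      using 1 B by (intro mult_mono) auto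
    then show ?thesis
      by (simp add: norm_mult power_mult_distrib mult_ac)
  qed
  then show ?case
    using B by (intro exI[of _ ?C]) simp
next
  case (snoc i "is")
  let ?u = "\<lambda>M t x. exp_rem M (t * of_real (\<xi> \<bullet> x)) * exp (a * of_real (\<eta> \<bullet> x))"
  obtain C where C: "0 \<le> C" "\<And>t x. cmod t \<le> 1 \<Longrightarrow> norm x \<le> r \<Longrightarrow> cmod (foldr pd is (?u M t) x) \<le> C * cmod t ^ M"
    using snoc[of M] by blast
  obtain C' where C': "0 \<le> C'" "\<And>t x. cmod t \<le> 1 \<Longrightarrow> norm x \<le> r \<Longrightarrow> cmod (foldr pd is (?u (M - 1) t) x) \<le> C' * cmod t ^ (M - 1)"
    using snoc[of "M - 1"] by blast
  have su: "smooth (?u M t)" for M t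
    by (intro smooth_mult smooth_exp_rem smooth_exp_linear_form)
  have pdu: "pd i (?u M t) = (\<lambda>x. (t * of_real (\<xi> $ i)) * ?u (M - 1) t x + (a * of_real (\<eta> $ i)) * ?u M t x)" for t
  proof
    fix x
    show "pd i (?u M t) x = (t * of_real (\<xi> $ i)) * ?u (M - 1) t x + (a * of_real (\<eta> $ i)) * ?u M t x"
      by (subst pd_mult)
        (auto intro!: smooth_differentiable smooth_exp_rem smooth_exp_linear_form
          simp: pd_exp_rem pd_exp_linear_form algebra_simps)
  qed
  let ?C = "\<bar>\<xi> $ i\<bar> * C' + cmod a * \<bar>\<eta> $ i\<bar> * C"
  have "cmod (foldr pd (is @ [i]) (?u M t) x) \<le> ?C * cmod t ^ M"
    if t: "cmod t \<le> 1" and x: "norm x \<le> r" for t x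
  proof -
    have "foldr pd (is @ [i]) (?u M t) x =
       (t * of_real (\<xi> $ i)) * foldr pd is (?u (M - 1) t) x + (a * of_real (\<eta> $ i)) * foldr pd is (?u M t) x"
      by (simp add: pdu foldr_pd_add foldr_pd_cmult su smooth_mult)
    also have "cmod \<dots> \<le> cmod t * \<bar>\<xi> $ i\<bar> * (C' * cmod t ^ (M - 1)) + cmod a * \<bar>\<eta> $ i\<bar> * (C * cmod t ^ M)"
      using C(2)[OF t x] C'(2)[OF t x]
      by (intro norm_triangle_le add_mono) (auto simp: norm_mult intro!: mult_left_mono)
    also have "\<dots> = \<bar>\<xi> $ i\<bar> * C' * (cmod t * cmod t ^ (M - 1)) + cmod a * \<bar>\<eta> $ i\<bar> * C * cmod t ^ M"
      by simp
    also have "\<dots> \<le> \<bar>\<xi> $ i\<bar> * C' * cmod t ^ M + cmod a * \<bar>\<eta> $ i\<bar> * C * cmod t ^ M"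
    proof (rule add_right_mono, rule mult_left_mono)
      \<comment> \<open>An equality except at \<open>M = 0\<close>, where the truncated index leaves
        \<open>cmod t \<le> 1\<close>.\<close>
      show "cmod t * cmod t ^ (M - 1) \<le> cmod t ^ M"
        using t by (cases M) auto
    qed (simp add: C'(1))
    also have "\<dots> = ?C * cmod t ^ M"
      by (simp add: algebra_simps)
    finally show ?thesis .
  qed
  then show ?case
    using C(1) C'(1) by (intro exI[of _ ?C]) simp
qed

context cdist
begin

lemma phi_exp_rem_bound:
  fixes \<xi> \<eta> :: "real ^ 'n"
  shows "\<exists>C. \<forall>t. cmod t \<le> 1 \<longrightarrow>
    cmod (\<phi> (\<lambda>x. exp_rem M (t * of_real (\<xi> \<bullet> x)) * exp (a * of_real (\<eta> \<bullet> x)))) \<le> C * cmod t ^ M"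
proof -
  obtain r C N where r: "0 \<le> r" and C: "0 \<le> C"
    and bound: "\<forall>\<psi> B. smooth \<psi> \<longrightarrow>
      (\<forall>is x. length is \<le> N \<longrightarrow> norm x \<le> r \<longrightarrow> cmod (foldr pd is \<psi> x) \<le> B) \<longrightarrow> cmod (\<phi> \<psi>) \<le> C * B"
    using phi_bound by (elim exE conjE)
  let ?u = "\<lambda>t x. exp_rem M (t * of_real (\<xi> \<bullet> x)) * exp (a * of_real (\<eta> \<bullet> x))"
  have "\<forall>is. \<exists>D. 0 \<le> D \<and> (\<forall>t x. cmod t \<le> 1 \<longrightarrow> norm x \<le> r \<longrightarrow> cmod (foldr pd is (?u t) x) \<le> D * cmod t ^ M)"
    using foldr_pd_exp_rem_bound by (rule allI)
  from choice[OF this] obtain D where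
    D': "\<forall>is. 0 \<le> D is \<and> (\<forall>t x. cmod t \<le> 1 \<longrightarrow> norm x \<le> r \<longrightarrow> cmod (foldr pd is (?u t) x) \<le> D is * cmod t ^ M)"
    by (elim exE)
  have D: "0 \<le> D is" "cmod t \<le> 1 \<Longrightarrow> norm x \<le> r \<Longrightarrow> cmod (foldr pd is (?u t) x) \<le> D is * cmod t ^ M" for "is" t x
    using D' by simp_all
  let ?I = "{is :: 'n list. length is \<le> N}"
  have fin: "finite ?I"
    using finite_lists_length_le[of "UNIV :: 'n set" N] by simp
  define E where "E = (\<Sum>is\<in>?I. D is)"
  have DE: "D is \<le> E" if "length is \<le> N" for "is"
    unfolding E_def using that fin D(1) by (intro member_le_sum) auto
  have "cmod (\<phi> (?u t)) \<le> C * (E * cmod t ^ M)" if t: "cmod t \<le> 1" for t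
  proof (rule bound[rule_format])
    show "smooth (?u t)"
      by (intro smooth_mult smooth_exp_rem smooth_exp_linear_form)
    fix "is" :: "'n list" and x :: "real ^ 'n" assume "length is \<le> N" "norm x \<le> r"
    then show "cmod (foldr pd is (?u t) x) \<le> E * cmod t ^ M"
      using D(2)[OF t, of x "is"] mult_right_mono[OF DE, of "is" "cmod t ^ M"] by simp
  qed
  then show ?thesis
    by (intro exI[of _ "C * E"]) (simp add: mult.assoc)
qed

end

section \<open>Taylor coefficients from asymptotics and from uniform limits\<close>

text \<open>Once the coefficients below \<open>n\<close> agree, that of the difference at
  \<open>n\<close> is the limit of \<open>d z / z ^ n\<close>, and along positive reals the bound
  forces this limit to be 0. An estimate on a real interval thus identifies complex Taylor
  coefficients.\<close>

lemma fps_coeffs_of_asymptotics: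
  fixes f :: "complex \<Rightarrow> complex"
  assumes f: "f has_fps_expansion F"
    and bound: "\<And>s. 0 < s \<Longrightarrow> s \<le> 1 \<Longrightarrow> cmod (f (of_real s) - (\<Sum>n<M. c n * of_real s ^ n)) \<le> C * s ^ M"
    and n: "n < M"
  shows "fps_nth F n = c n"
proof -
  define P where "P = (\<Sum>n<M. fps_const (c n) * fps_X ^ n)"
  define d where "d z = f z - (\<Sum>n<M. c n * z ^ n)" for z
  have d: "d has_fps_expansion F - P"
    unfolding d_def[abs_def] P_def by (intro fps_expansion_intros f)
  have Pn: "fps_nth P n = c n" if "n < M" for n
    using that by (simp add: P_def fps_sum_nth fps_X_power_iff if_distrib cong: if_cong)
  have "\<forall>n<M. fps_nth (F - P) n = 0"
  proof (intro allI impI)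
    fix n assume "n < M"
    then show "fps_nth (F - P) n = 0"
    proof (induction n rule: less_induct)
      case (less n)
      show ?case
      proof (cases "F - P = 0")
        case False
        have sub: "n \<le> subdegree (F - P)"
          using less False by (intro subdegree_geI) auto
        let ?c = "fps_nth (F - P) n"
        let ?g = "\<lambda>x. if x = 0 then ?c else d x / x ^ n"
        have "?g has_fps_expansion fps_shift n (F - P)"
          by (rule has_fps_expansion_shift[OF d sub refl])
        then have "isCont ?g 0"
          by (rule has_fps_expansion_imp_continuous)
        then have lim: "(?g \<longlongrightarrow> ?c) (at 0)"
          unfolding isCont_def by simp
        have "filterlim (\<lambda>k. complex_of_real (inverse (real (Suc k)))) (at 0) sequentially"
        proof (rule filterlim_atI)
          show "(\<lambda>k. complex_of_real (inverse (real (Suc k)))) \<longlonglongrightarrow> 0"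
            using tendsto_of_real[OF LIMSEQ_inverse_real_of_nat, where 'a = complex] by (simp only: of_real_0)
        qed (rule always_eventually, simp del: of_nat_Suc)
        from filterlim_compose[OF lim this]
        have l1: "(\<lambda>k. ?g (complex_of_real (inverse (real (Suc k))))) \<longlonglongrightarrow> ?c" .
        have l2: "(\<lambda>k. ?g (complex_of_real (inverse (real (Suc k))))) \<longlonglongrightarrow> 0"
        proof (rule Lim_null_comparison)
          show "(\<lambda>k. \<bar>C\<bar> * inverse (real (Suc k))) \<longlonglongrightarrow> 0"
            using tendsto_mult_right_zero[OF LIMSEQ_inverse_real_of_nat] by blast
          show "\<forall>\<^sub>F k in sequentially. norm (?g (complex_of_real (inverse (real (Suc k))))) \<le> \<bar>C\<bar> * inverse (real (Suc k))"
          proof (rule always_eventually, rule allI)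
            fix k
            define s where "s = inverse (real (Suc k))"
            have s: "0 < s" "s \<le> 1"
              by (auto simp: s_def field_simps)
            have "C * s ^ M \<le> \<bar>C\<bar> * s ^ Suc n"
              using s less.prems by (intro mult_mono power_decreasing) auto
            then have "cmod (d (of_real s)) \<le> \<bar>C\<bar> * s ^ Suc n"
              using bound[OF s] by (simp add: d_def)
            then have "cmod (d (of_real s)) / s ^ n \<le> \<bar>C\<bar> * s"
              using s by (simp add: field_simps)
            then show "norm (?g (complex_of_real (inverse (real (Suc k))))) \<le> \<bar>C\<bar> * inverse (real (Suc k))"
              using s unfolding s_def[symmetric] by (simp add: norm_divide norm_power)
          qed
        qed
        show ?thesis
          using LIMSEQ_unique[OF l1 l2] .
      qed simp
    qed
  qed
  then show ?thesis
    using n Pn by auto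
qed

text \<open>Uniform convergence of holomorphic functions carries over to all derivatives at 0.
  Identities between coefficients of the partial products pass to the Fourier transform in this
  way.\<close>

lemma uniform_limit_fps_coeffs:
  fixes f :: "nat \<Rightarrow> complex \<Rightarrow> complex"
  assumes lim: "uniform_limit (cball 0 1) f g sequentially"
    and holo: "\<And>N. f N holomorphic_on UNIV" and exps: "\<And>N. f N has_fps_expansion F N"
  obtains H where "g has_fps_expansion H" "\<And>n. (\<lambda>N. fps_nth (F N) n) \<longlonglongrightarrow> fps_nth H n"
proof -
  have "g holomorphic_on ball 0 1"
  proof (rule holomorphic_uniform_limit[OF _ lim])
    show "\<forall>\<^sub>F n in sequentially. continuous_on (cball 0 1) (f n) \<and> f n holomorphic_on ball 0 1"
      using holo by (auto intro!: always_eventually holomorphic_on_imp_continuous_on intro: holomorphic_on_subset)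
  qed auto
  then have g: "g has_fps_expansion fps_expansion g 0"
    by (intro has_fps_expansion_fps_expansion[of "ball 0 1"]) auto
  have "(\<lambda>N. (deriv ^^ n) (f N) 0) \<longlonglongrightarrow> (deriv ^^ n) g 0" for n
  proof (rule higher_deriv_complex_uniform_limit[where A = "ball 0 1"])
    show "uniform_limit (ball 0 1) f g sequentially"
      by (rule uniform_limit_on_subset[OF lim]) auto
  qed (auto intro!: always_eventually intro: holomorphic_on_subset[OF holo])
  then have "(\<lambda>N. (deriv ^^ n) (f N) 0 / fact n) \<longlonglongrightarrow> (deriv ^^ n) g 0 / fact n" for n
    by (intro tendsto_intros) auto
  then have "(\<lambda>N. fps_nth (F N) n) \<longlonglongrightarrow> fps_nth (fps_expansion g 0) n" for n
    by (simp add: fps_nth_fps_expansion[OF exps] fps_nth_fps_expansion[OF g])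
  then show ?thesis
    using that g by blast
qed

context cdist
begin

definition \<phi>_norm :: complex where
  "\<phi>_norm = of_real ((2 * pi) powr (- real CARD('n) / 2))"

lemma \<phi>_norm_nonzero: "\<phi>_norm \<noteq> 0"
  by (simp add: \<phi>_norm_def)

lemma fourier_line:
  "fourier \<phi> (s *s cvec \<xi> + cvec w) = \<phi>_norm *
     \<phi> (\<lambda>x. exp ((- \<i> * s) * of_real (\<xi> \<bullet> x)) * exp (- \<i> * of_real (w \<bullet> x)))"
proof -
  have "- \<i> * (\<Sum>i\<in>UNIV. (s *s cvec \<xi> + cvec w) $ i * of_real (x $ i)) =
      (- \<i> * s) * of_real (\<xi> \<bullet> x) + (- \<i> * of_real (w \<bullet> x))" for x
    by (simp add: cvec_def inner_vec_def algebra_simps sum.distrib sum_distrib_left)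
  then show ?thesis
    by (simp only: fourier_def \<phi>_norm_def exp_add)
qed

text \<open>Replacing the exponential under \<open>\<phi>\<close> by its Taylor polynomial produces
  the moments as coefficients; \<open>phi_exp_rem_bound\<close> controls what remains.\<close>

lemma fourier_line_asymptotics:
  "\<exists>C. \<forall>s>0. s \<le> 1 \<longrightarrow> cmod (fourier \<phi> (of_real s *s cvec \<xi> + cvec w) -
     (\<Sum>m<M. (\<phi>_norm * ((- \<i>) ^ m *
       \<phi> (\<lambda>x. dp (int m) (of_real (\<xi> \<bullet> x)) * exp (- \<i> * of_real (w \<bullet> x))))) * of_real s ^ m)) \<le> C * s ^ M"
proof -
  let ?e = "\<lambda>x. exp (- \<i> * complex_of_real (w \<bullet> x))"
  let ?d = "\<lambda>n. \<phi> (\<lambda>x. dp (int n) (of_real (\<xi> \<bullet> x)) * ?e x)"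
  obtain C where C: "\<And>t. cmod t \<le> 1 \<Longrightarrow>
    cmod (\<phi> (\<lambda>x. exp_rem (M) (t * of_real (\<xi> \<bullet> x)) * ?e x)) \<le> C * cmod t ^ M"
    using phi_exp_rem_bound[of "M" \<xi> "- \<i>" w] by blast
  have sm: "smooth (\<lambda>x. dp (int n) (of_real (\<xi> \<bullet> x)) * ?e x)" for n
    by (intro smooth_mult smooth_dp smooth_exp_linear_form)
  have *: "fourier \<phi> (s *s cvec \<xi> + cvec w) - (\<Sum>m<M. (\<phi>_norm * ((- \<i>) ^ m * ?d m)) * s ^ m)
      = \<phi>_norm * \<phi> (\<lambda>x. exp_rem (M) ((- \<i> * s) * of_real (\<xi> \<bullet> x)) * ?e x)" for s
  proof -
    define t where "t = - \<i> * s"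
    have "exp (t * of_real (\<xi> \<bullet> x)) * ?e x = exp_rem (M) (t * of_real (\<xi> \<bullet> x)) * ?e x
         + (\<Sum>m<M. t ^ m * (dp (int m) (of_real (\<xi> \<bullet> x)) * ?e x))" for x
      unfolding exp_rem_def left_diff_distrib sum_distrib_right dp_scale nat_int mult.assoc by (simp only: diff_add_cancel)
    then have "(\<lambda>x. exp ((- \<i> * s) * of_real (\<xi> \<bullet> x)) * ?e x) =
      (\<lambda>x. exp_rem (M) ((- \<i> * s) * of_real (\<xi> \<bullet> x)) * ?e x
         + (\<Sum>m<M. (- \<i> * s) ^ m * (dp (int m) (of_real (\<xi> \<bullet> x)) * ?e x)))"
      unfolding t_def by (rule ext)
    then have "fourier \<phi> (s *s cvec \<xi> + cvec w) = \<phi>_norm *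
      (\<phi> (\<lambda>x. exp_rem (M) ((- \<i> * s) * of_real (\<xi> \<bullet> x)) * ?e x)
         + \<phi> (\<lambda>x. \<Sum>m<M. (- \<i> * s) ^ m * (dp (int m) (of_real (\<xi> \<bullet> x)) * ?e x)))"
      unfolding fourier_line
      by (simp only: phi_add smooth_sum smooth_mult smooth_const smooth_dp smooth_exp_linear_form smooth_exp_rem)
    also have "\<phi> (\<lambda>x. \<Sum>m<M. (- \<i> * s) ^ m * (dp (int m) (of_real (\<xi> \<bullet> x)) * ?e x)) =
        (\<Sum>m<M. (- \<i> * s) ^ m * ?d m)"
      by (subst phi_sum) (simp_all only: phi_cmult sm smooth_mult smooth_const)
    finally have "fourier \<phi> (s *s cvec \<xi> + cvec w) = \<phi>_norm *
      \<phi> (\<lambda>x. exp_rem (M) ((- \<i> * s) * of_real (\<xi> \<bullet> x)) * ?e x) +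
      (\<Sum>m<M. (\<phi>_norm * ((- \<i>) ^ m * ?d m)) * s ^ m)"
      by (simp only: distrib_left sum_distrib_left power_mult_distrib mult_ac)
    then show ?thesis by (simp only: add_diff_cancel_right')
  qed
  show ?thesis
  proof (intro exI[of _ "cmod \<phi>_norm * C"] allI impI)
    fix s :: real assume s: "0 < s" "s \<le> 1"
    have "cmod (\<phi> (\<lambda>x. exp_rem M ((- \<i> * of_real s) * of_real (\<xi> \<bullet> x)) * ?e x)) \<le> C * s ^ M"
      using C[of "- \<i> * of_real s"] s by (simp add: norm_mult)
    then have "cmod (\<phi>_norm * \<phi> (\<lambda>x. exp_rem M ((- \<i> * of_real s) * of_real (\<xi> \<bullet> x)) * ?e x)) \<le> cmod \<phi>_norm * (C * s ^ M)"
      unfolding norm_mult by (intro mult_left_mono) auto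
    then show "cmod (fourier \<phi> (of_real s *s cvec \<xi> + cvec w) -
        (\<Sum>m<M. (\<phi>_norm * ((- \<i>) ^ m * ?d m)) * of_real s ^ m)) \<le> cmod \<phi>_norm * C * s ^ M"
      unfolding * by (simp only: mult.assoc)
  qed
qed

lemma fourier_line_coeffs:
  assumes "(\<lambda>s. fourier \<phi> (s *s cvec \<xi> + cvec w)) has_fps_expansion F"
  shows "fps_nth F n = \<phi>_norm * ((- \<i>) ^ n *
     \<phi> (\<lambda>x. dp (int n) (of_real (\<xi> \<bullet> x)) * exp (- \<i> * of_real (w \<bullet> x))))"
proof -
  obtain C where "\<forall>s>0. s \<le> 1 \<longrightarrow> cmod (fourier \<phi> (of_real s *s cvec \<xi> + cvec w) -
     (\<Sum>m<Suc n. (\<phi>_norm * ((- \<i>) ^ m *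
       \<phi> (\<lambda>x. dp (int m) (of_real (\<xi> \<bullet> x)) * exp (- \<i> * of_real (w \<bullet> x))))) * of_real s ^ m)) \<le> C * s ^ Suc n"
    using fourier_line_asymptotics[of \<xi> w "Suc n"] by (elim exE)
  then show ?thesis
    by (intro fps_coeffs_of_asymptotics[OF assms, where M = "Suc n" and C = C]) (simp_all del: sum.lessThan_Suc)
qed

end

section \<open>Summation over the integer lattice\<close>

text \<open>Half-open, so that the integer translates tile space without overlap, and centred, so
  that the origin is an interior point, as \<open>concentration\<close> needs.\<close>

definition unit_cube :: "(real ^ 'n) set" where
  "unit_cube = {y. \<forall>i. - (1/2) \<le> y $ i \<and> y $ i < 1/2}"

definition half :: "real ^ 'n" where
  "half = (\<chi> i. 1/2)"

lemma half_inner: "b \<in> Basis \<Longrightarrow> (half :: real ^ 'n) \<bullet> b = 1/2"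
  by (auto simp: half_def Basis_vec_def inner_axis)

lemma box_subset_unit_cube: "box (- half) half \<subseteq> unit_cube"
  by (auto simp: unit_cube_def half_def mem_box_cart intro: less_imp_le)

lemma unit_cube_subset_cbox: "unit_cube \<subseteq> cbox (- half) half"
proof
  fix y assume "y \<in> unit_cube"
  then have "- (1/2) \<le> y $ i" "y $ i < 1/2" for i
    by (simp_all add: unit_cube_def)
  then show "y \<in> cbox (- half) half"
    by (simp add: half_def mem_box_cart less_imp_le)
qed

lemma unit_cube_borel [measurable]: "(unit_cube :: (real ^ 'n) set) \<in> sets borel"
proof -
  have [measurable]: "(\<lambda>y::real^'n. y $ i) \<in> borel_measurable borel" for i
    by (intro borel_measurable_continuous_onI continuous_intros)
  have "{y :: real ^ 'n. \<forall>i. - (1/2) \<le> y $ i \<and> y $ i < 1/2} \<in> sets borel"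
    by measurable
  then show ?thesis
    by (simp add: unit_cube_def)
qed

lemma emeasure_unit_cube: "emeasure lborel (unit_cube :: (real ^ 'n) set) = 1"
proof (rule antisym)
  have p: "(\<Prod>b\<in>Basis. (half - (- half) :: real ^ 'n) \<bullet> b) = 1"
    unfolding inner_diff_left inner_minus_left by (rule prod.neutral) (auto simp: half_inner)
  have b: "emeasure lborel (box (- half) half :: (real ^ 'n) set) = 1"
    by (subst emeasure_lborel_box) (simp_all only: p, auto simp: half_inner)
  have c: "emeasure lborel (cbox (- half) half :: (real ^ 'n) set) = 1"
    by (subst emeasure_lborel_cbox) (simp_all only: p, auto simp: half_inner)
  show "1 \<le> emeasure lborel (unit_cube :: (real ^ 'n) set)"
    unfolding b[symmetric] by (intro emeasure_mono box_subset_unit_cube) auto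
  show "emeasure lborel (unit_cube :: (real ^ 'n) set) \<le> 1"
    unfolding c[symmetric] by (intro emeasure_mono unit_cube_subset_cbox) auto
qed

lemma set_integrable_unit_cube:
  fixes f :: "real ^ 'n \<Rightarrow> 'b::euclidean_space"
  assumes "continuous_on UNIV f"
  shows "set_integrable lborel unit_cube f"
proof (rule set_integrable_subset)
  show "set_integrable lborel (cbox (- half) half) f"
    unfolding set_integrable_def
    by (intro borel_integrable_compact compact_cbox continuous_on_subset[OF assms]) auto
qed (auto simp: unit_cube_subset_cbox)

lemma lborel_integral_translate:
  fixes f :: "real ^ 'n \<Rightarrow> complex"
  assumes "f \<in> borel_measurable borel"
  shows "(LINT x|lborel. f (x + c)) = (LINT x|lborel. f x)"
proof -
  have "(LINT x|lborel. f x) = (LINT x|distr lborel borel ((+) c). f x)"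
    by (simp add: lborel_distr_plus)
  also have "\<dots> = (LINT x|lborel. f (c + x))"
    using assms by (intro integral_distr) auto
  finally show ?thesis
    by (simp add: add.commute)
qed

lemma lborel_integrable_translate:
  fixes f :: "real ^ 'n \<Rightarrow> complex"
  assumes "integrable lborel f"
  shows "integrable lborel (\<lambda>x. f (x + c))"
proof -
  have "integrable (distr lborel borel ((+) c)) f"
    using assms by (simp add: lborel_distr_plus)
  then have "integrable lborel (\<lambda>x. f (c + x))"
    by (rule integrable_distr[rotated]) auto
  then show ?thesis
    by (simp add: add.commute)
qed

definition int_box :: "nat \<Rightarrow> (int ^ 'n) set" where
  "int_box B = {k. \<forall>i. \<bar>k $ i\<bar> \<le> int B}"

lemma finite_int_box: "finite (int_box B :: (int ^ 'n) set)"
proof -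
  have "finite (PiE (UNIV :: 'n set) (\<lambda>_. {- int B..int B}))"
    by (intro finite_PiE) auto
  moreover have "vec_nth ` (int_box B :: (int ^ 'n) set) \<subseteq> PiE UNIV (\<lambda>_. {- int B..int B})"
    by (auto simp: int_box_def abs_le_iff minus_le_iff)
  ultimately have "finite (vec_nth ` (int_box B :: (int ^ 'n) set))"
    by (rule rev_finite_subset)
  then show ?thesis
    by (rule finite_imageD) (auto simp: inj_on_def vec_eq_iff)
qed

lemma unit_cube_translate_unique:
  fixes y :: "real ^ 'n"
  shows "\<exists>k. y - ivec k \<in> unit_cube \<and> (\<forall>k'. y - ivec k' \<in> unit_cube \<longrightarrow> k' = k) \<and>
    (\<forall>i. \<bar>real_of_int (k $ i)\<bar> \<le> \<bar>y $ i\<bar> + 1)"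
proof -
  let ?k = "\<chi> i. \<lfloor>y $ i + 1/2\<rfloor>"
  have k: "real_of_int \<lfloor>y $ i + 1/2\<rfloor> \<le> y $ i + 1/2" "y $ i + 1/2 < real_of_int \<lfloor>y $ i + 1/2\<rfloor> + 1" for i
    by linarith+
  have "y - ivec ?k \<in> unit_cube"
    unfolding unit_cube_def
  proof (intro CollectI allI)
    fix i
    show "- (1/2) \<le> (y - ivec ?k) $ i \<and> (y - ivec ?k) $ i < 1/2"
      using k[of i] by (simp add: ivec_def) linarith
  qed
  moreover have "k' = ?k" if k': "y - ivec k' \<in> unit_cube" for k'
  proof -
    have a: "- (1/2) \<le> y $ i - real_of_int (k' $ i)" "y $ i - real_of_int (k' $ i) < 1/2" for i
      using k' by (auto simp: unit_cube_def ivec_def)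
    have "\<lfloor>y $ i + 1/2\<rfloor> = k' $ i" for i
      by (rule floor_unique) (use a[of i] in linarith)+
    then show ?thesis
      by (simp add: vec_eq_iff)
  qed
  moreover have "\<bar>real_of_int (?k $ i)\<bar> \<le> \<bar>y $ i\<bar> + 1" for i
    using k[of i] by simp linarith
  ultimately show ?thesis
    by (intro exI[of _ ?k]) blast
qed

text \<open>The margin 1 allows for the rounding in passing from \<open>y\<close> to the index of
  its cube.\<close>

lemma sum_indicator_unit_cube:
  fixes y :: "real ^ 'n"
  assumes "\<And>i. \<bar>y $ i\<bar> \<le> real B - 1"
  shows "(\<Sum>k\<in>int_box B. indicator unit_cube (y - ivec k)) = (1 :: real)"
proof -
  obtain k where k: "y - ivec k \<in> unit_cube" "\<forall>k'. y - ivec k' \<in> unit_cube \<longrightarrow> k' = k"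
    "\<forall>i. \<bar>real_of_int (k $ i)\<bar> \<le> \<bar>y $ i\<bar> + 1"
    using unit_cube_translate_unique[of y] by blast
  have "\<bar>k $ i\<bar> \<le> int B" for i
    using k(3)[rule_format, of i] assms[of i] by linarith
  then have "k \<in> int_box B"
    by (simp add: int_box_def)
  moreover have "(\<Sum>k'\<in>int_box B. indicator unit_cube (y - ivec k')) = (\<Sum>k'\<in>int_box B. if k' = k then 1 else (0::real))"
  proof (rule sum.cong[OF refl])
    fix k'
    show "indicator unit_cube (y - ivec k') = (if k' = k then 1 else (0::real))"
    proof (cases "k' = k")
      case False
      then have "y - ivec k' \<notin> unit_cube"
        using k(2) by blast
      then show ?thesis
        using False by simp
    qed (simp add: k(1))
  qed
  ultimately show ?thesis
    by (simp add: finite_int_box)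
qed

lemma integral_tile:
  fixes f :: "real ^ 'n \<Rightarrow> complex"
  assumes f: "integrable lborel f" and supp: "\<And>y. f y \<noteq> 0 \<Longrightarrow> \<forall>i. \<bar>y $ i\<bar> \<le> real B - 1"
  shows "(LINT y|lborel. f y) = (\<Sum>k\<in>int_box B. (LINT y:unit_cube|lborel. f (y + ivec k)))"
proof -
  have [measurable]: "f \<in> borel_measurable borel"
    using f by (simp add: borel_measurable_integrable)
  have cube [measurable]: "(\<lambda>y::real^'n. indicator unit_cube (y - c) :: real) \<in> borel_measurable borel" for c
    by measurable
  have int: "integrable lborel (\<lambda>y. indicator unit_cube (y - ivec k) *\<^sub>R f y)" for k
  proof (rule Bochner_Integration.integrable_bound[OF f])
    show "AE x in lborel. norm (indicat_real unit_cube (x - ivec k) *\<^sub>R f x) \<le> norm (f x)"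
      by (auto simp: indicator_def)
  qed measurable
  have "f y = (\<Sum>k\<in>int_box B. indicator unit_cube (y - ivec k) *\<^sub>R f y)" for y
  proof (cases "f y = 0")
    case False
    then have "(\<Sum>k\<in>int_box B. indicator unit_cube (y - ivec k)) = (1 :: real)"
      using supp by (intro sum_indicator_unit_cube) blast
    then show ?thesis
      by (simp add: scaleR_left.sum[symmetric])
  qed simp
  then have "(LINT y|lborel. f y) = (LINT y|lborel. (\<Sum>k\<in>int_box B. indicator unit_cube (y - ivec k) *\<^sub>R f y))"
    by (rule Bochner_Integration.integral_cong[OF refl])
  also have "\<dots> = (\<Sum>k\<in>int_box B. (LINT y|lborel. indicator unit_cube (y - ivec k) *\<^sub>R f y))"
    by (rule Bochner_Integration.integral_sum) (rule int)
  also have "\<dots> = (\<Sum>k\<in>int_box B. (LINT y:unit_cube|lborel. f (y + ivec k)))"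
  proof (rule sum.cong[OF refl])
    fix k
    have "(LINT y|lborel. indicator unit_cube (y - ivec k) *\<^sub>R f y) =
       (LINT y|lborel. (\<lambda>y. indicator unit_cube (y - ivec k) *\<^sub>R f y) (y + ivec k))"
      by (rule lborel_integral_translate[symmetric]) measurable
    then show "(LINT y|lborel. indicator unit_cube (y - ivec k) *\<^sub>R f y) = (LINT y:unit_cube|lborel. f (y + ivec k))"
      by (simp add: set_lebesgue_integral_def)
  qed
  finally show ?thesis .
qed

section \<open>Characters of the torus and Poisson summation\<close>

definition char :: "int ^ 'n \<Rightarrow> real ^ 'n \<Rightarrow> complex" where
  "char l y = exp (2 * pi * \<i> * of_real (ivec l \<bullet> y))"

lemma ivec_add: "ivec (k + l) = ivec k + ivec l"
  by (simp add: ivec_def vec_eq_iff)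

lemma ivec_minus: "ivec (- l) = - ivec l"
  by (simp add: ivec_def vec_eq_iff)

lemma ivec_0 [simp]: "ivec 0 = 0"
  by (simp add: ivec_def vec_eq_iff)

lemma ivec_inner_ivec: "ivec l \<bullet> ivec k = real_of_int (\<Sum>i\<in>UNIV. l $ i * k $ i)"
  by (simp add: ivec_def inner_vec_def)

lemma char_add: "char (k + l) y = char k y * char l y"
  by (simp add: char_def ivec_add inner_add_left distrib_left exp_add)

lemma char_add_right: "char l (x + y) = char l x * char l y"
  by (simp add: char_def inner_add_right distrib_left exp_add)

lemma char_0 [simp]: "char 0 y = 1"
  by (simp add: char_def)

lemma char_ivec [simp]: "char l (ivec k) = 1"
  using exp_integer_2pi[of "of_int (\<Sum>i\<in>UNIV. l $ i * k $ i)"]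
  by (simp add: char_def ivec_inner_ivec mult_ac del: of_int_sum of_int_mult)

lemma continuous_char: "continuous_on S (char l)"
  unfolding char_def[abs_def] by (intro continuous_intros)

text \<open>The integral over the cube translated by \<open>v\<close> equals the integral over the
  cube by periodicity, and equals its negative by substitution, since
  \<open>char l v = - 1\<close>.\<close>

lemma integral_char_unit_cube:
  fixes l :: "int ^ 'n"
  assumes "l \<noteq> 0"
  shows "(LINT y:unit_cube|lborel. char l y) = 0"
proof -
  obtain i where i: "l $ i \<noteq> 0"
    using assms by (auto simp: vec_eq_iff)
  \<comment> \<open>Half a period in a coordinate where \<open>l\<close> does not vanish.\<close>
  define v :: "real ^ 'n" where "v = axis i (1 / (2 * real_of_int (l $ i)))"
  have lv: "ivec l \<bullet> v = 1/2"
    using i by (simp add: v_def inner_axis ivec_def)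
  have "complex_of_real (2 * pi) * \<i> * complex_of_real (1/2) = pi * \<i>"
    by simp
  then have "char l v = exp (pi * \<i>)"
    unfolding char_def lv by (simp only:)
  then have cv: "char l v = -1"
    by (simp only: exp_pi_i)
  have v: "\<bar>v $ j\<bar> \<le> 1" for j
  proof -
    have "1 \<le> \<bar>l $ i\<bar>"
      using i by linarith
    then have "1 \<le> \<bar>real_of_int (l $ i)\<bar>"
      by linarith
    then have "\<bar>1 / (2 * real_of_int (l $ i))\<bar> \<le> 1"
      by (simp add: abs_mult divide_le_eq)
    then show ?thesis
      by (simp add: v_def axis_def)
  qed
  let ?I = "LINT y:unit_cube|lborel. char l y"
  define f where "f y = indicator unit_cube (y - v) *\<^sub>R char l y" for y :: "real ^ 'n"
  have [measurable]: "char l \<in> borel_measurable borel"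
    by (intro borel_measurable_continuous_onI continuous_char)
  have fm [measurable]: "f \<in> borel_measurable borel"
    unfolding f_def[abs_def] by measurable
  have shift: "f (y + v) = indicator unit_cube y *\<^sub>R (- char l y)" for y
    by (simp add: f_def char_add_right cv)
  have "integrable lborel (\<lambda>y. f (y + v))"
    unfolding shift using set_integrable_unit_cube[OF continuous_on_minus[OF continuous_char]]
    by (simp add: set_integrable_def)
  from lborel_integrable_translate[OF this, of "- v"] have fi: "integrable lborel f"
    by simp
  have "(LINT y|lborel. f y) = (LINT y|lborel. f (y + v))"
    by (rule lborel_integral_translate[symmetric]) (rule fm)
  also have "\<dots> = - ?I"
    unfolding shift set_lebesgue_integral_def by simp
  finally have 1: "(LINT y|lborel. f y) = - ?I" .
  \<comment> \<open>The translated cube has coordinates of modulus at most 2, and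
    \<open>integral_tile\<close> asks for a margin of 1; hence 3.\<close>
  have "(LINT y|lborel. f y) = (\<Sum>k\<in>int_box 3. (LINT y:unit_cube|lborel. f (y + ivec k)))"
  proof (rule integral_tile[OF fi])
    fix y assume "f y \<noteq> 0"
    then have "y - v \<in> unit_cube"
      by (auto simp: f_def indicator_def split: if_splits)
    then have "- (1/2) \<le> y $ j - v $ j" "y $ j - v $ j < 1/2" for j
      by (auto simp: unit_cube_def)
    note c = this
    have "\<bar>y $ j\<bar> \<le> 2" for j
      using v[of j] c[of j] by linarith
    then show "\<forall>i. \<bar>y $ i\<bar> \<le> real 3 - 1"
      by simp
  qed
  also have "\<dots> = (LINT y:unit_cube|lborel. (\<Sum>k\<in>int_box 3. f (y + ivec k)))"
    unfolding set_lebesgue_integral_def scaleR_sum_right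
  proof (rule Bochner_Integration.integral_sum[symmetric])
    fix k
    have "integrable lborel (\<lambda>y. f (y + ivec k))"
      by (rule lborel_integrable_translate[OF fi])
    then show "integrable lborel (\<lambda>y. indicat_real unit_cube y *\<^sub>R f (y + ivec k))"
      by (rule Bochner_Integration.integrable_bound) (auto simp: indicator_def)
  qed
  also have "\<dots> = ?I"
  proof (rule set_lebesgue_integral_cong)
    show "\<forall>y. y \<in> unit_cube \<longrightarrow> (\<Sum>k\<in>int_box 3. f (y + ivec k)) = char l y"
    proof (intro allI impI)
      fix y :: "real ^ 'n" assume y: "y \<in> unit_cube"
      have "\<bar>(y - v) $ j\<bar> \<le> real 3 - 1" for j
      proof -
        have "- (1/2) \<le> y $ j" "y $ j < 1/2"
          using y by (auto simp: unit_cube_def)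
        then show ?thesis
          using v[of j] unfolding vector_minus_component by linarith
      qed
      then have "(\<Sum>k\<in>int_box 3. indicator unit_cube ((y - v) - ivec k)) = (1 :: real)"
        by (rule sum_indicator_unit_cube)
      moreover have "(\<Sum>k\<in>int_box 3. indicator unit_cube ((y - v) - ivec k)) =
        (\<Sum>k\<in>int_box 3. indicator unit_cube ((y - v) + ivec k) :: real)"
        by (rule sum.reindex_bij_witness[of _ uminus uminus]) (auto simp: int_box_def ivec_minus)
      ultimately have s: "(\<Sum>k\<in>int_box 3. indicator unit_cube ((y - v) + ivec k)) = (1 :: real)"
        by simp
      have "(\<Sum>k\<in>int_box 3. f (y + ivec k)) = (\<Sum>k\<in>int_box 3. indicator unit_cube ((y - v) + ivec k) *\<^sub>R char l y)"
        by (intro sum.cong) (auto simp: f_def char_add_right algebra_simps)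
      also have "\<dots> = char l y"
        using s by (simp add: scaleR_left.sum[symmetric])
      finally show "(\<Sum>k\<in>int_box 3. f (y + ivec k)) = char l y" .
    qed
  qed simp
  finally show ?thesis
    using 1 by (simp add: eq_neg_iff_add_eq_0)
qed

text \<open>The powers of \<open>w\<close> concentrate at the origin. If \<open>f 0\<close> were
  positive, the integral would gain at least a constant times \<open>r ^ N\<close> near the origin
  and lose at most a constant times \<open>\<rho> ^ N\<close> elsewhere, with
  \<open>\<rho> < r\<close>, so it could not vanish for every \<open>N\<close>.\<close>

lemma concentration:
  fixes f w :: "real ^ 'n \<Rightarrow> real"
  assumes f: "continuous_on UNIV f" and w: "continuous_on UNIV w"
    and w01: "\<And>y. 0 \<le> w y" "\<And>y. w y \<le> 1" "w 0 = 1"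
    and w1: "\<And>y. y \<in> cbox (- half) half \<Longrightarrow> y \<noteq> 0 \<Longrightarrow> w y < 1"
    and int: "\<And>N. (LINT y:unit_cube|lborel. f y * w y ^ N) = 0"
  shows "f 0 \<le> 0"
proof (rule ccontr)
  assume "\<not> f 0 \<le> 0"
  then have f0: "f 0 > 0" by simp
  have "isCont f 0" "isCont w 0"
    using f w by (auto simp: continuous_on_eq_continuous_at)
  then obtain \<delta>0 where \<delta>0: "\<delta>0 > 0" "\<And>y. norm y < \<delta>0 \<Longrightarrow> \<bar>f y - f 0\<bar> < f 0 / 2"
    using f0 unfolding continuous_at_eps_delta by (auto simp: dist_norm dest!: spec[of _ "f 0 / 2"])
  define \<delta> where "\<delta> = min \<delta>0 (1/2)"
  have \<delta>: "\<delta> > 0" "\<And>y. norm y < \<delta> \<Longrightarrow> f 0 / 2 \<le> f y"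
  proof -
    show "\<delta> > 0"
      using \<delta>0(1) by (simp add: \<delta>_def)
    show "f 0 / 2 \<le> f y" if "norm y < \<delta>" for y
      using \<delta>0(2)[of y] that unfolding \<delta>_def by linarith
  qed
  have ball: "ball 0 \<delta> \<subseteq> (unit_cube :: (real ^ 'n) set)"
  proof
    fix y :: "real ^ 'n" assume "y \<in> ball 0 \<delta>"
    then have "\<bar>y $ i\<bar> < 1/2" for i
      using component_le_norm_cart[of y i] by (auto simp: \<delta>_def)
    then have "- (1/2) \<le> y $ i \<and> y $ i < 1/2" for i
      unfolding abs_less_iff by (metis less_imp_le minus_less_iff)
    then show "y \<in> unit_cube"
      unfolding unit_cube_def by blast
  qed
  let ?C = "cbox (- half) half - ball 0 \<delta> :: (real ^ 'n) set"
  have cC: "compact ?C"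
    by (intro compact_diff) auto
  \<comment> \<open>By compactness of the closed cube without a ball, \<open>w\<close> stays below
    some \<open>\<rho> < 1\<close> there.\<close>
  obtain \<rho> where \<rho>: "0 \<le> \<rho>" "\<rho> < 1" "\<And>y. y \<in> ?C \<Longrightarrow> w y \<le> \<rho>"
  proof (cases "?C = {}")
    case False
    have "continuous_on ?C w"
      using w by (rule continuous_on_subset) simp
    from continuous_attains_sup[OF cC False this]
    obtain z where z: "z \<in> ?C" "\<And>y. y \<in> ?C \<Longrightarrow> w y \<le> w z"
      by blast
    have "w z < 1"
      using z \<delta>(1) by (intro w1) auto
    then show ?thesis
      using that[of "w z"] z w01(1) by blast
  next
    case True
    show ?thesis
      by (rule that[of 0]) (simp_all only: True, simp_all)
  qed
  obtain B where B: "\<And>y. y \<in> cbox (- half) half \<Longrightarrow> \<bar>f y\<bar> \<le> B" and B0: "0 \<le> B"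
  proof -
    have "bounded (f ` cbox (- half) half)"
      by (intro compact_imp_bounded compact_continuous_image continuous_on_subset[OF f]) auto
    then obtain B where "0 < B" "\<forall>x\<in>f ` cbox (- half) half. norm x \<le> B"
      by (auto simp: bounded_pos)
    then show ?thesis
      using that[of B] by auto
  qed
  \<comment> \<open>A value strictly between \<open>\<rho>\<close> and
    \<open>w 0 = 1\<close>.\<close>
  define r where "r = (1 + \<rho>) / 2"
  have r: "\<rho> < r" "r < 1" "0 < r"
    using \<rho> by (auto simp: r_def)
  obtain \<delta>1 where \<delta>1: "\<delta>1 > 0" "\<And>y. norm y < \<delta>1 \<Longrightarrow> \<bar>w y - w 0\<bar> < 1 - r"
    using \<open>isCont w 0\<close> r unfolding continuous_at_eps_delta
    by (auto simp: dist_norm dest!: spec[of _ "1 - r"])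
  define \<epsilon> where "\<epsilon> = min \<delta> \<delta>1"
  have \<epsilon>: "\<epsilon> > 0" "\<epsilon> \<le> \<delta>" "\<And>y. norm y < \<epsilon> \<Longrightarrow> r \<le> w y"
  proof -
    show "\<epsilon> > 0" "\<epsilon> \<le> \<delta>"
      using \<delta> \<delta>1 by (simp_all add: \<epsilon>_def)
    show "r \<le> w y" if "norm y < \<epsilon>" for y
      using \<delta>1(2)[of y] that w01(3) unfolding \<epsilon>_def by linarith
  qed
  define v where "v = measure lborel (ball 0 \<epsilon> :: (real ^ 'n) set)"
  have v: "v > 0"
    unfolding v_def using content_ball_pos[OF \<epsilon>(1)] by simp
  have key: "f 0 / 2 * r ^ N * v \<le> B * \<rho> ^ N" for N
  proof -
    \<comment> \<open>A pointwise minorant of the integrand: guaranteed mass on the small ball,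
      minus the worst possible loss charged to the whole cube.\<close>
    let ?g = "\<lambda>y::real^'n. f 0 / 2 * r ^ N * indicator (ball 0 \<epsilon>) y - B * \<rho> ^ N * indicator unit_cube y"
    have fin: "emeasure lborel (ball 0 \<epsilon> :: (real ^ 'n) set) < \<infinity>"
      using emeasure_bounded_finite[OF bounded_ball] .
    have ig: "integrable lborel (\<lambda>y::real^'n. f 0 / 2 * r ^ N * indicator (ball 0 \<epsilon>) y :: real)"
      "integrable lborel (\<lambda>y::real^'n. B * \<rho> ^ N * indicator unit_cube y :: real)"
      by (intro integrable_mult_right integrable_real_indicator; use fin in \<open>auto simp: emeasure_unit_cube\<close>)+
    have "(LINT y|lborel. ?g y) \<le> (LINT y|lborel. indicator unit_cube y *\<^sub>R (f y * w y ^ N))"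
    proof (rule integral_mono)
      show "integrable lborel ?g"
        using ig by (rule Bochner_Integration.integrable_diff)
      have "set_integrable lborel unit_cube (\<lambda>y. f y * w y ^ N)"
        by (intro set_integrable_unit_cube continuous_intros f w)
      then show "integrable lborel (\<lambda>y. indicator unit_cube y *\<^sub>R (f y * w y ^ N))"
        by (simp add: set_integrable_def)
      fix y :: "real ^ 'n"
      consider "y \<notin> unit_cube" | "y \<in> unit_cube" "norm y < \<epsilon>" | "y \<in> unit_cube" "\<epsilon> \<le> norm y" "norm y < \<delta>"
        | "y \<in> unit_cube" "\<delta> \<le> norm y"
        by linarith
      then show "?g y \<le> indicator unit_cube y *\<^sub>R (f y * w y ^ N)"
      proof cases
        case 1
        then have "y \<notin> ball 0 \<delta>"
          using ball by blast
        then have "y \<notin> ball 0 \<epsilon>"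
          using \<epsilon>(2) by simp
        then show ?thesis using 1 by simp
      next
        case 2
        have "f 0 / 2 * r ^ N \<le> f y * w y ^ N"
          using \<epsilon> \<delta>(2)[of y] 2 r f0 by (intro mult_mono power_mono) auto
        moreover have "0 \<le> B * \<rho> ^ N"
          using B0 \<rho> by simp
        ultimately show ?thesis using 2 by simp
      next
        case 3
        have "0 \<le> f y * w y ^ N"
          using \<delta>(2)[of y] 3 f0 w01(1)[of y] by (intro mult_nonneg_nonneg) auto
        moreover have "0 \<le> B * \<rho> ^ N"
          using B0 \<rho> by simp
        ultimately show ?thesis using 3 by simp
      next
        case 4
        have y: "y \<in> cbox (- half) half"
          using 4 unit_cube_subset_cbox by auto
        then have "w y \<le> \<rho>"
          using 4 by (intro \<rho>(3)) auto
        then have "\<bar>f y * w y ^ N\<bar> \<le> B * \<rho> ^ N"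
          using B[OF y] w01(1)[of y] B0 by (auto simp: abs_mult intro!: mult_mono power_mono)
        then show ?thesis using 4 \<epsilon>(2) by simp
      qed
    qed
    also have "\<dots> = 0"
      using int[of N] by (simp add: set_lebesgue_integral_def)
    finally have "(LINT y|lborel. ?g y) \<le> 0" .
    moreover have "(LINT y|lborel. ?g y) = f 0 / 2 * r ^ N * v - B * \<rho> ^ N * measure lborel (unit_cube :: (real ^ 'n) set)"
      using ig by (simp add: v_def)
    moreover have "measure lborel (unit_cube :: (real ^ 'n) set) = 1"
      by (simp add: measure_def emeasure_unit_cube)
    ultimately show ?thesis by simp
  qed
  have lim: "(\<lambda>N. B * (\<rho> / r) ^ N) \<longlonglongrightarrow> B * 0"
    using r \<rho> by (intro tendsto_intros LIMSEQ_power_zero) auto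
  have "f 0 / 2 * v \<le> B * (\<rho> / r) ^ N" for N
    using key[of N] r by (simp add: power_divide field_simps)
  with lim have "f 0 / 2 * v \<le> B * 0"
    by (intro LIMSEQ_le_const) auto
  then show False
    using f0 v by (simp add: mult_le_0_iff)
qed


text \<open>The functions against which \<open>g\<close> integrates as if it were a constant function on the torus.\<close>

definition torus_like :: "(real ^ 'n \<Rightarrow> complex) \<Rightarrow> (real ^ 'n \<Rightarrow> complex) \<Rightarrow> bool" where
  "torus_like g p \<longleftrightarrow> continuous_on UNIV p \<and>
     (LINT y|lborel. g y * p y) = (LINT y|lborel. g y) * (LINT y:unit_cube|lborel. p y)"

lemma integrable_continuous_bounded_support:
  fixes g :: "real ^ 'n \<Rightarrow> complex"
  assumes "continuous_on UNIV g" "\<And>y. R < norm y \<Longrightarrow> g y = 0"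
  shows "integrable lborel g"
proof -
  have "integrable lborel (\<lambda>y. indicator (cball 0 R) y *\<^sub>R g y)"
    by (rule borel_integrable_compact) (auto intro: continuous_on_subset[OF assms(1)])
  moreover have "indicator (cball 0 R) y *\<^sub>R g y = g y" for y
    using assms(2)[of y] by (auto simp: indicator_def)
  ultimately show ?thesis by simp
qed

lemma torus_like_add:
  assumes g: "continuous_on UNIV g" "\<And>y. R < norm y \<Longrightarrow> g y = 0"
    and p: "torus_like g p" "torus_like g q"
  shows "torus_like g (\<lambda>y. a * p y + b * q y)"
proof -
  have cont: "continuous_on UNIV p" "continuous_on UNIV q"
    using p by (auto simp: torus_like_def)
  have i: "integrable lborel (\<lambda>y. g y * p y)" "integrable lborel (\<lambda>y. g y * q y)"
    by (rule integrable_continuous_bounded_support[where R = R]; use g cont in \<open>auto intro: continuous_intros\<close>)+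
  have s: "set_integrable lborel unit_cube p" "set_integrable lborel unit_cube q"
    using cont by (auto intro: set_integrable_unit_cube)
  have "(LINT y|lborel. g y * (a * p y + b * q y)) = (LINT y|lborel. a * (g y * p y) + b * (g y * q y))"
    by (simp add: algebra_simps)
  also have "\<dots> = a * (LINT y|lborel. g y * p y) + b * (LINT y|lborel. g y * q y)"
    using i by simp
  finally have 1: "(LINT y|lborel. g y * (a * p y + b * q y)) = a * (LINT y|lborel. g y * p y) + b * (LINT y|lborel. g y * q y)" .
  have "(LINT y:unit_cube|lborel. a * p y + b * q y) = a * (LINT y:unit_cube|lborel. p y) + b * (LINT y:unit_cube|lborel. q y)"
    using s by (simp add: set_integral_add set_integral_mult_right)
  with 1 p show ?thesis
    unfolding torus_like_def by (auto simp: algebra_simps intro!: continuous_intros)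
qed

text \<open>A trigonometric polynomial with values in [0, 1] that attains 1 on the closed cube only
  at the origin. Its powers play the part of Fejer kernels.\<close>

definition cos_kernel :: "real ^ 'n \<Rightarrow> real" where
  "cos_kernel y = (\<Prod>i\<in>UNIV. (1 + cos (2 * pi * y $ i)) / 2)"

lemma continuous_cos_kernel: "continuous_on S cos_kernel"
  unfolding cos_kernel_def[abs_def] by (intro continuous_intros) auto

lemma half_cos_bounds: "0 \<le> (1 + cos t) / (2::real)" "(1 + cos t) / (2::real) \<le> 1"
proof -
  have "1 + (- 1) \<le> 1 + cos t"
    by (intro add_left_mono cos_ge_minus_one)
  then show "0 \<le> (1 + cos t) / 2"
    by simp
  have "1 + cos t \<le> 1 + 1"
    by (intro add_left_mono cos_le_one)
  then show "(1 + cos t) / 2 \<le> 1"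
    by simp
qed

lemma cos_kernel_bounds: "0 \<le> cos_kernel y" "cos_kernel y \<le> 1"
  unfolding cos_kernel_def by (intro prod_nonneg prod_le_1 ballI conjI half_cos_bounds)+

lemma cos_kernel_0: "cos_kernel 0 = 1"
  by (simp add: cos_kernel_def)

lemma cos_kernel_less_1:
  assumes "y \<in> cbox (- half) half" "y \<noteq> 0"
  shows "cos_kernel y < 1"
proof -
  obtain i where i: "y $ i \<noteq> 0"
    using assms by (auto simp: vec_eq_iff)
  let ?f = "\<lambda>i. (1 + cos (2 * pi * y $ i)) / 2"
  have f: "0 \<le> ?f j" "?f j \<le> 1" for j
    by (rule half_cos_bounds)+
  have "- (1/2) \<le> y $ i" "y $ i \<le> 1/2"
    using assms(1) by (auto simp: mem_box_cart half_def)
  then have a: "\<bar>2 * pi * y $ i\<bar> \<le> pi"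
    by (auto simp: abs_mult abs_le_iff)
  have "cos (2 * pi * y $ i) = cos \<bar>2 * pi * y $ i\<bar>"
    by (simp add: cos_abs_real)
  also have "\<dots> < cos 0"
    using a i by (intro cos_monotone_0_pi) auto
  finally have "?f i < 1"
    by simp
  moreover have "cos_kernel y = ?f i * (\<Prod>j\<in>UNIV - {i}. ?f j)"
    unfolding cos_kernel_def by (rule prod.remove) auto
  moreover have "?f i * (\<Prod>j\<in>UNIV - {i}. ?f j) \<le> ?f i * 1"
    using f by (intro mult_left_mono prod_le_1) auto
  ultimately show ?thesis by linarith
qed

lemma cos_eq_char: "complex_of_real (cos (2 * pi * y $ i)) = (char (axis i 1) y + char (- axis i 1) y) / 2"
proof -
  have "ivec (axis i 1) \<bullet> y = y $ i"
    by (simp add: ivec_def axis_def inner_vec_def if_distrib if_distribR cong: if_cong)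
  then show ?thesis
    by (simp add: char_def ivec_minus cos_of_real[symmetric] cos_exp_eq mult_ac)
qed

text \<open>The identity holds on every character, by hypothesis and by
  \<open>integral_char_unit_cube\<close>, hence on trigonometric polynomials, among them the powers
  of the kernel.\<close>

lemma torus_like_cos_kernel:
  fixes g :: "real ^ 'n \<Rightarrow> complex"
  assumes g: "continuous_on UNIV g" "\<And>y. R < norm y \<Longrightarrow> g y = 0"
    and ft: "\<And>l. l \<noteq> 0 \<Longrightarrow> (LINT y|lborel. g y * char l y) = 0"
  shows "torus_like g (\<lambda>y. of_real (cos_kernel y ^ N))"
proof -
  \<comment> \<open>Quantifying over all characters makes the property stable under one more cosine
    factor, which shifts \<open>l\<close> by plus or minus a coordinate vector.\<close>
  define good where "good p \<longleftrightarrow> (\<forall>l. torus_like g (\<lambda>y. p y * char l y))" for p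
  have good_1: "good (\<lambda>_. 1)"
    unfolding good_def
  proof
    fix l
    show "torus_like g (\<lambda>y. 1 * char l y)"
    proof (cases "l = 0")
      case True
      have "(LINT y:(unit_cube :: (real ^ 'n) set)|lborel. 1) = (1 :: complex)"
        by (simp add: set_lebesgue_integral_def measure_def emeasure_unit_cube)
      then show ?thesis
        by (simp add: True torus_like_def)
    next
      case False
      then show ?thesis
        by (simp add: torus_like_def continuous_char ft integral_char_unit_cube)
    qed
  qed
  have good_cos: "good (\<lambda>y. p y * of_real ((1 + cos (2 * pi * y $ i)) / 2))" if p: "good p" for p i
    unfolding good_def
  proof
    fix l
    have "torus_like g (\<lambda>y. (1/4) * (p y * char (axis i 1 + l) y) + (1/4) * (p y * char (- axis i 1 + l) y))"
      using p by (intro torus_like_add[OF g]) (auto simp: good_def)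
    from torus_like_add[OF g this, where q = "\<lambda>y. p y * char l y" and a = 1 and b = "1/2"]
    have "torus_like g (\<lambda>y. 1 * ((1/4) * (p y * char (axis i 1 + l) y) + (1/4) * (p y * char (- axis i 1 + l) y))
        + (1/2) * (p y * char l y))"
      using p by (simp add: good_def)
    moreover have "(\<lambda>y. 1 * ((1/4) * (p y * char (axis i 1 + l) y) + (1/4) * (p y * char (- axis i 1 + l) y))
        + (1/2) * (p y * char l y)) = (\<lambda>y. p y * of_real ((1 + cos (2 * pi * y $ i)) / 2) * char l y)"
      unfolding char_add of_real_divide of_real_add cos_eq_char by (rule ext) (simp add: field_simps)
    ultimately show "torus_like g (\<lambda>y. p y * of_real ((1 + cos (2 * pi * y $ i)) / 2) * char l y)"
      by (simp only:)
  qed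
  have good_prod: "good (\<lambda>y. p y * of_real (\<Prod>i\<in>I. (1 + cos (2 * pi * y $ i)) / 2))" if "good p" "finite I" for p I
    using that(2)
  proof induction
    case empty
    then show ?case using that(1) by simp
  next
    case (insert i I)
    from good_cos[OF insert.IH, of i] show ?case
      using insert.hyps by (simp add: mult_ac)
  qed
  have "good (\<lambda>y. of_real (cos_kernel y ^ N))"
  proof (induction N)
    case 0
    then show ?case using good_1 by simp
  next
    case (Suc N)
    from good_prod[OF this finite[of UNIV]]
    have "good (\<lambda>y. of_real (cos_kernel y ^ N) * of_real (cos_kernel y))"
      by (simp only: cos_kernel_def)
    then show ?case
      by (simp only: power_Suc2 of_real_mult)
  qed
  then have "torus_like g (\<lambda>y. of_real (cos_kernel y ^ N) * char 0 y)"
    unfolding good_def by blast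
  then show ?thesis by simp
qed

text \<open>Poisson summation when only the zero frequency contributes. The periodization minus the
  integral is orthogonal on the cube to all powers of the kernel, and so vanishes at the origin,
  where the periodization is the lattice sum.\<close>

theorem has_sum_lattice:
  fixes g :: "real ^ 'n \<Rightarrow> complex"
  assumes g: "continuous_on UNIV g" "\<And>y. R < norm y \<Longrightarrow> g y = 0"
    and ft: "\<And>l. l \<noteq> 0 \<Longrightarrow> (LINT y|lborel. g y * char l y) = 0"
  shows "((\<lambda>k. g (ivec k)) has_sum (LINT y|lborel. g y)) UNIV"
proof -
  let ?I = "LINT y|lborel. g y"
  define B where "B = nat \<lceil>\<bar>R\<bar>\<rceil> + 1"
  have B: "\<bar>R\<bar> \<le> real B - 1"
    unfolding B_def using real_nat_ceiling_ge[of "\<bar>R\<bar>"] by simp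
  have supp: "\<forall>i. \<bar>y $ i\<bar> \<le> real B - 1" if "g y \<noteq> 0" for y
  proof
    fix i
    have "norm y \<le> R"
      using g(2)[of y] that by force
    then show "\<bar>y $ i\<bar> \<le> real B - 1"
      using component_le_norm_cart[of y i] B by linarith
  qed
  \<comment> \<open>On the cube this finite sum is the whole periodization of \<open>g\<close>: the
    remaining translates vanish there.\<close>
  define H where "H y = (\<Sum>k\<in>int_box B. g (y + ivec k))" for y
  have H: "continuous_on UNIV H"
    unfolding H_def[abs_def] by (intro continuous_intros continuous_on_compose2[OF g(1)]) auto
  have wN: "continuous_on UNIV (\<lambda>y::real^'n. complex_of_real (cos_kernel y ^ N))" for N
    by (intro continuous_intros continuous_cos_kernel)
  have per: "cos_kernel (y + ivec k) = cos_kernel y" for y and k :: "int ^ 'n"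
  proof -
    have "cos (2 * pi * (y + ivec k) $ i) = cos (2 * pi * y $ i)" for i
      using cos_int_2pin[of "k $ i"] sin_int_2pin[of "k $ i"]
      by (simp add: ivec_def distrib_left cos_add)
    then show ?thesis
      by (simp add: cos_kernel_def)
  qed
  have int0: "(LINT y:unit_cube|lborel. (H y - ?I) * of_real (cos_kernel y ^ N)) = 0" for N
  proof -
    let ?w = "\<lambda>y::real^'n. complex_of_real (cos_kernel y ^ N)"
    have gw: "integrable lborel (\<lambda>y. g y * ?w y)"
    proof (rule integrable_continuous_bounded_support[where R = R])
      show "continuous_on UNIV (\<lambda>y. g y * ?w y)"
        by (intro continuous_on_mult g(1) wN)
    qed (simp add: g(2))
    have "?I * (LINT y:unit_cube|lborel. ?w y) = (LINT y|lborel. g y * ?w y)"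
    proof -
      have "torus_like g ?w"
        by (rule torus_like_cos_kernel[OF g ft])
      then show ?thesis
        unfolding torus_like_def by (elim conjE) (erule sym)
    qed
    also have "\<dots> = (\<Sum>k\<in>int_box B. (LINT y:unit_cube|lborel. g (y + ivec k) * ?w (y + ivec k)))"
      by (rule integral_tile[OF gw]) (use supp in auto)
    also have "\<dots> = (\<Sum>k\<in>int_box B. (LINT y:unit_cube|lborel. g (y + ivec k) * ?w y))"
      by (simp add: per)
    also have "\<dots> = (LINT y:unit_cube|lborel. (\<Sum>k\<in>int_box B. g (y + ivec k) * ?w y))"
      unfolding set_lebesgue_integral_def scaleR_sum_right
    proof (rule Bochner_Integration.integral_sum[symmetric])
      fix k
      have "set_integrable lborel unit_cube (\<lambda>y. g (y + ivec k) * ?w y)"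
        by (intro set_integrable_unit_cube continuous_on_mult wN continuous_on_compose2[OF g(1)] continuous_intros) auto
      then show "integrable lborel (\<lambda>y. indicat_real unit_cube y *\<^sub>R (g (y + ivec k) * ?w y))"
        by (simp add: set_integrable_def)
    qed
    also have "\<dots> = (LINT y:unit_cube|lborel. H y * ?w y)"
      by (simp add: H_def sum_distrib_right)
    finally have 1: "?I * (LINT y:unit_cube|lborel. ?w y) = (LINT y:unit_cube|lborel. H y * ?w y)" .
    have "(LINT y:unit_cube|lborel. (H y - ?I) * ?w y) = (LINT y:unit_cube|lborel. H y * ?w y - ?I * ?w y)"
      by (simp only: left_diff_distrib)
    also have "\<dots> = (LINT y:unit_cube|lborel. H y * ?w y) - (LINT y:unit_cube|lborel. ?I * ?w y)"
      by (intro set_integral_diff set_integrable_unit_cube continuous_on_mult H wN continuous_on_const)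
    also have "\<dots> = 0"
      using 1 by (simp add: set_integral_mult_right)
    finally show ?thesis .
  qed
  \<comment> \<open>The factor \<open>cnj (H 0 - ?I)\<close> turns the one-sided conclusion of
    \<open>concentration\<close> into a bound for the squared modulus of
    \<open>H 0 - ?I\<close>.\<close>
  define f where "f y = Re ((H y - ?I) * cnj (H 0 - ?I))" for y
  have "f 0 \<le> 0"
  proof (rule concentration)
    show "continuous_on UNIV f"
      unfolding f_def[abs_def] by (intro continuous_intros H)
    show "(LINT y:unit_cube|lborel. f y * cos_kernel y ^ N) = 0" for N
    proof -
      let ?h = "\<lambda>y::real^'n. (H y - ?I) * of_real (cos_kernel y ^ N)"
      have hi: "integrable lborel (\<lambda>y. indicator unit_cube y *\<^sub>R ?h y)"
        unfolding set_integrable_def[symmetric]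
        by (intro set_integrable_unit_cube continuous_on_mult continuous_on_diff H wN continuous_on_const)
      have "(LINT y|lborel. Re ((indicator unit_cube y *\<^sub>R ?h y) * cnj (H 0 - ?I))) =
          Re (LINT y|lborel. (indicator unit_cube y *\<^sub>R ?h y) * cnj (H 0 - ?I))"
        by (rule integral_Re, rule integrable_mult_left, rule hi)
      also have "\<dots> = Re ((LINT y|lborel. indicator unit_cube y *\<^sub>R ?h y) * cnj (H 0 - ?I))"
        by (simp only: integral_mult_left_zero)
      also have "\<dots> = 0"
        using int0[of N] by (simp add: set_lebesgue_integral_def)
      also have "(\<lambda>y. Re ((indicator unit_cube y *\<^sub>R ?h y) * cnj (H 0 - ?I))) =
          (\<lambda>y. indicator unit_cube y *\<^sub>R (f y * cos_kernel y ^ N))"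
      proof
        fix y
        have "Re ((i *\<^sub>R (a * of_real r)) * b) = i *\<^sub>R (Re (a * b) * r)" for i r and a b :: complex
          by (simp add: algebra_simps)
        then show "Re ((indicator unit_cube y *\<^sub>R ?h y) * cnj (H 0 - ?I)) = indicator unit_cube y *\<^sub>R (f y * cos_kernel y ^ N)"
          unfolding f_def .
      qed
      finally show ?thesis
        unfolding set_lebesgue_integral_def .
    qed
  qed (auto intro: continuous_cos_kernel cos_kernel_less_1 simp: cos_kernel_bounds cos_kernel_0)
  moreover have "f 0 = cmod (H 0 - ?I) ^ 2"
    unfolding f_def complex_norm_square[symmetric]
    by (simp only: of_real_power[symmetric] Re_complex_of_real)
  ultimately have "H 0 = ?I"
    by simp
  moreover have "((\<lambda>k. g (ivec k)) has_sum H 0) UNIV"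
  proof -
    have "g (ivec k) = 0" if "k \<notin> int_box B" for k
    proof (rule ccontr)
      assume "g (ivec k) \<noteq> 0"
      then have *: "\<bar>ivec k $ i\<bar> \<le> real B - 1" for i
        using supp by blast
      have "\<bar>k $ i\<bar> \<le> int B" for i
      proof -
        have "\<bar>real_of_int (k $ i)\<bar> \<le> real B - 1"
          using *[of i] by (simp add: ivec_def)
        then show ?thesis
          by linarith
      qed
      then show False
        using that by (simp add: int_box_def)
    qed
    then have "((\<lambda>k. g (ivec k)) has_sum H 0) (int_box B) \<longleftrightarrow> ((\<lambda>k. g (ivec k)) has_sum H 0) UNIV"
      by (intro has_sum_cong_neutral) auto
    moreover have "((\<lambda>k. g (ivec k)) has_sum H 0) (int_box B)"
      using has_sum_finite[OF finite_int_box[of B], of "\<lambda>k. g (ivec k)"] by (simp add: H_def)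
    ultimately show ?thesis by blast
  qed
  ultimately show ?thesis by simp
qed

section \<open>The dilation and the digit set\<close>

declare transpose_matrix_vector [simp del]

lemma matrix_inv_mult:
  fixes M :: "'a::field ^ 'n ^ 'n"
  assumes "invertible M"
  shows "M ** matrix_inv M = mat 1" "matrix_inv M ** M = mat 1"
proof -
  have "\<exists>A'. M ** A' = mat 1 \<and> A' ** M = mat 1"
    using assms by (simp add: invertible_def)
  then have "M ** matrix_inv M = mat 1 \<and> matrix_inv M ** M = mat 1"
    unfolding matrix_inv_def by (rule someI_ex)
  then show "M ** matrix_inv M = mat 1" "matrix_inv M ** M = mat 1"
    by simp_all
qed

lemma det_cmat: "det (cmat A) = of_real (det A)"
  by (simp add: det_def cmat_def)

text \<open>After diagonalization every diagonal entry is an eigenvalue, so the determinant is a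
  product of numbers of modulus above 1.\<close>

lemma abs_det_gt_1:
  fixes A :: "real ^ 'n ^ 'n"
  assumes "dilation_matrix A" "isotropic A"
  shows "\<bar>det A\<bar> > 1"
proof -
  obtain P D :: "complex ^ 'n ^ 'n" where P: "invertible P" and D: "\<forall>i j. i \<noteq> j \<longrightarrow> D $ i $ j = 0"
    and A: "cmat A = P ** D ** matrix_inv P"
    using assms(2) unfolding isotropic_def diagonalizable_def by (elim conjE exE) (rule that; assumption)
  note Pi = matrix_inv_mult[OF P]
  have "1 < cmod (D $ i $ i)" for i
  proof -
    define v where "v = P *v axis i 1"
    have iP: "matrix_inv P *v v = axis i 1"
      by (simp add: v_def matrix_vector_mul_assoc Pi)
    have De: "D *v axis i 1 = D $ i $ i *s axis i 1"
      using D by (auto simp: vec_eq_iff matrix_vector_mult_def axis_def if_distrib cong: if_cong)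
    have "cmat A *v v = P *v (D *v (matrix_inv P *v v))"
      by (simp add: A matrix_vector_mul_assoc matrix_mul_assoc)
    also have "\<dots> = P *v (D $ i $ i *s axis i 1)"
      by (simp only: iP De)
    also have "\<dots> = D $ i $ i *s v"
      by (simp add: v_def vector_scalar_commute)
    finally have "cmat A *v v = D $ i $ i *s v" .
    moreover have "v \<noteq> 0"
    proof
      assume "v = 0"
      then have "axis i (1::complex) = 0"
        using iP by simp
      then show False
        by (simp add: axis_eq_0_iff)
    qed
    ultimately have "eigenvalue_of (cmat A) (D $ i $ i)"
      unfolding eigenvalue_of_def by (intro exI[of _ v] conjI)
    then show ?thesis
      by (rule assms(1)[unfolded dilation_matrix_def, THEN conjunct2, rule_format])
  qed
  then have "1 < (\<Prod>i\<in>UNIV. cmod (D $ i $ i))"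
    by (intro less_1_prod) auto
  also have "\<dots> = cmod (det D)"
    using D by (simp add: det_diagonal prod_norm)
  also have "det D = det P * det D * det (matrix_inv P)"
  proof -
    have "det P * det (matrix_inv P) = 1"
      using Pi(1) by (metis det_I det_mul)
    then show ?thesis
      by (simp add: mult_ac)
  qed
  also have "\<dots> = of_real (det A)"
    by (simp add: det_cmat[symmetric] A det_mul)
  finally show ?thesis
    by simp
qed

lemma matrix_scaleR_vector: "(c *\<^sub>R M) *v x = c *\<^sub>R (M *v x)" for M :: "real ^ 'n ^ 'm"
  by (simp add: vec_eq_iff matrix_vector_mult_def sum_distrib_left mult.assoc)

lemma ivec_eq_0_iff [simp]: "ivec k = 0 \<longleftrightarrow> k = 0"
  by (auto simp: ivec_def vec_eq_iff)

section \<open>Contraction by the inverse dilation, and arithmetic of the digits\<close>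

locale dilation_setup =
  fixes A U Q :: "real ^ 'n ^ 'n" and S :: "(real ^ 'n) set"
  assumes A: "dilation_matrix A" "isotropic A" "isotropic_factorization A U Q"
    and S: "digit_set (transpose A) S"
begin

abbreviation "M \<equiv> transpose A"
abbreviation "B \<equiv> inv_transp A"

lemma MB: "M ** B = mat 1" "B ** M = mat 1"
proof -
  have "det M \<noteq> 0"
    using abs_det_gt_1[OF A(1,2)] by (auto simp: det_transpose)
  then have "invertible M"
    by (simp add: invertible_det_nz)
  from matrix_inv_mult[OF this] show "M ** B = mat 1" "B ** M = mat 1"
    by (simp_all add: inv_transp_def)
qed

lemma MB_vec: "M *v (B *v x) = x" "B *v (M *v x) = x"
  by (simp_all add: matrix_vector_mul_assoc MB)

definition Bpow :: "nat \<Rightarrow> real ^ 'n ^ 'n" where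
  "Bpow n = mat_powi B (int n)"

lemma Bpow_0 [simp]: "Bpow 0 = mat 1"
  by (simp add: Bpow_def mat_powi_def)

lemma Bpow_Suc: "Bpow (Suc n) = B ** Bpow n"
  by (simp add: Bpow_def mat_powi_def nat_add_distrib)

lemma Bpow_Suc_vec: "Bpow (Suc n) *v x = B *v (Bpow n *v x)"
  by (simp add: Bpow_Suc matrix_vector_mul_assoc)

lemma Q_inj: "Q *v x = 0 \<Longrightarrow> x = 0"
  using A(3) unfolding isotropic_factorization_def sym_pos_def_def by force

text \<open>Conjugated by \<open>Q\<close>, the matrix \<open>B\<close> is a multiple of the
  orthogonal \<open>U\<close>, with a factor below 1 because the determinant exceeds 1 in absolute
  value.\<close>

lemma Q_contraction:
  obtains \<rho> where "0 \<le> \<rho>" "\<rho> < 1" "\<And>x. norm (Q *v (B *v x)) = \<rho> * norm (Q *v x)"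
proof
  let ?\<rho> = "\<bar>det A\<bar> powr (- 1 / real CARD('n))"
  show "0 \<le> ?\<rho>"
    by simp
  show "?\<rho> < 1"
    by (rule powr_less_one[OF abs_det_gt_1[OF A(1,2)]]) simp
  have U: "orthogonal_matrix U" and B: "B = ?\<rho> *\<^sub>R (matrix_inv Q ** U ** Q)"
    using A(3) unfolding isotropic_factorization_def by auto
  have "inj ((*v) Q)"
    by (rule linear_injective_0[THEN iffD2]) (auto intro: Q_inj)
  then have "invertible Q"
    using matrix_left_invertible_injective invertible_left_inverse by blast
  note Qi = matrix_inv_mult[OF this]
  fix x
  have "Q *v (B *v x) = ?\<rho> *\<^sub>R (Q *v ((matrix_inv Q ** U ** Q) *v x))"
    unfolding B matrix_scaleR_vector matrix_vector_mult_scaleR ..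
  also have "\<dots> = ?\<rho> *\<^sub>R (U *v (Q *v x))"
    by (simp add: matrix_vector_mul_assoc matrix_mul_assoc Qi)
  finally have "Q *v (B *v x) = ?\<rho> *\<^sub>R (U *v (Q *v x))" .
  then show "norm (Q *v (B *v x)) = ?\<rho> * norm (Q *v x)"
  proof -
    have "orthogonal_transformation ((*v) U)"
      using U by (simp add: orthogonal_transformation_matrix)
    from orthogonal_transformation_norm[OF this] show ?thesis
      using \<open>Q *v (B *v x) = ?\<rho> *\<^sub>R (U *v (Q *v x))\<close> by simp
  qed
qed

text \<open>If all quotients of \<open>l\<close> by powers of \<open>M\<close> were integral, they
  would be nonzero integer vectors, hence bounded away from 0, although they shrink geometrically by
  \<open>Q_contraction\<close>. \<open>l'\<close> is the last integral quotient.\<close>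

lemma eventually_not_divisible:
  fixes l :: "int ^ 'n"
  assumes "l \<noteq> 0"
  obtains p l' where "Bpow p *v ivec l = ivec l'" "\<And>n. ivec l' \<noteq> M *v ivec n"
proof -
  have "\<exists>n. Bpow n *v ivec l \<notin> range ivec"
  proof (rule ccontr)
    assume "\<not> ?thesis"
    then have "\<forall>n. \<exists>k. Bpow n *v ivec l = ivec k"
      by blast
    then obtain K where K: "\<And>n. Bpow n *v ivec l = ivec (K n)"
      by metis
    obtain \<rho> where \<rho>: "0 \<le> \<rho>" "\<rho> < 1" "\<And>x. norm (Q *v (B *v x)) = \<rho> * norm (Q *v x)"
      by (rule Q_contraction) blast
    have nQ: "norm (Q *v ivec (K n)) = \<rho> ^ n * norm (Q *v ivec l)" for n
    proof (induction n)
      case 0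
      then show ?case using K[of 0] by simp
    next
      case (Suc n)
      have "ivec (K (Suc n)) = B *v ivec (K n)"
        using K[of "Suc n"] K[of n] by (simp add: Bpow_Suc_vec)
      then show ?case
        using Suc \<rho>(3) by simp
    qed
    have "inj ((*v) Q)"
      by (rule linear_injective_0[THEN iffD2]) (auto intro: Q_inj)
    then obtain c where c: "c > 0" "\<And>x. c * norm x \<le> norm (Q *v x)"
      using linear_inj_bounded_below_pos[of "(*v) Q"] by auto
    have Kn: "K n \<noteq> 0" for n
    proof (induction n)
      case 0
      have "ivec (K 0) = (ivec l :: real ^ 'n)"
        using K[of 0] by simp
      then show ?case
        using assms by (auto simp: ivec_def vec_eq_iff)
    next
      case (Suc n)
      have "ivec (K (Suc n)) = B *v ivec (K n)"
        using K[of "Suc n"] K[of n] by (simp add: Bpow_Suc_vec)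
      then have "ivec (K n) = M *v ivec (K (Suc n))"
        by (simp only: MB_vec)
      then show ?case
        using Suc by (metis ivec_eq_0_iff matrix_vector_mult_0_right)
    qed
    have "c \<le> \<rho> ^ n * norm (Q *v ivec l)" for n
    proof -
      obtain i where "K n $ i \<noteq> 0"
        using Kn[of n] by (auto simp: vec_eq_iff)
      then have "1 \<le> \<bar>K n $ i\<bar>"
        by linarith
      then have "1 \<le> \<bar>ivec (K n) $ i\<bar>"
        by (simp add: ivec_def)
      then have "1 \<le> norm (ivec (K n) :: real ^ 'n)"
        using component_le_norm_cart[of "ivec (K n)" i] by linarith
      then have "c * 1 \<le> c * norm (ivec (K n) :: real ^ 'n)"
        using c(1) by (intro mult_left_mono) auto
      then show ?thesis
        using c(2)[of "ivec (K n)"] nQ[of n] by simp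
    qed
    moreover have "(\<lambda>n. \<rho> ^ n * norm (Q *v ivec l)) \<longlonglongrightarrow> 0 * norm (Q *v ivec l)"
      using \<rho> by (intro tendsto_intros LIMSEQ_power_zero) auto
    ultimately have "c \<le> 0 * norm (Q *v ivec l)"
      by (intro LIMSEQ_le_const) auto
    then show False
      using c(1) by simp
  qed
  \<comment> \<open>The first quotient that is not integral; \<open>N\<close> is positive because
    \<open>l\<close> itself is integral.\<close>
  define N where "N = (LEAST n. Bpow n *v ivec l \<notin> range ivec)"
  have N: "Bpow N *v ivec l \<notin> range ivec"
    unfolding N_def by (rule LeastI_ex) fact
  then obtain p where p: "N = Suc p"
    by (cases N) auto
  have "Bpow p *v ivec l \<in> range ivec"
    using not_less_Least[of p "\<lambda>n. Bpow n *v ivec l \<notin> range ivec"] p by (auto simp: N_def)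
  then obtain l' where l': "Bpow p *v ivec l = ivec l'"
    by blast
  have "ivec l' \<noteq> M *v ivec n" for n
  proof
    assume "ivec l' = M *v ivec n"
    then have "Bpow N *v ivec l = ivec n"
      by (simp add: p Bpow_Suc_vec l' MB_vec)
    then show False
      using N by blast
  qed
  then show ?thesis
    using that l' by blast
qed

text \<open>\<open>l'\<close> is congruent modulo \<open>M\<close> to \<open>M *v s\<close> for some
  digit \<open>s\<close>; a zero digit would make \<open>l'\<close> divisible by
  \<open>M\<close>.\<close>

lemma digit_complement:
  assumes "\<And>n. ivec l' \<noteq> M *v ivec n"
  obtains s n where "s \<in> S - {0}" "B *v ivec l' = s + ivec n"
proof -
  have "\<exists>s. s \<in> S \<and> ivec l' - M *v s \<in> (\<lambda>n. M *v ivec n) ` UNIV"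
    using S unfolding digit_set_def by blast
  then obtain s n where s: "s \<in> S" "ivec l' - M *v s = M *v ivec n"
    by blast
  then have l': "ivec l' = M *v (s + ivec n)"
    by (simp add: matrix_vector_right_distrib algebra_simps)
  then have "B *v ivec l' = s + ivec n"
    by (simp add: MB_vec)
  moreover have "s \<noteq> 0"
    using assms[of n] l' by auto
  ultimately show ?thesis
    using that s(1) by blast
qed

text \<open>The images of the digits under \<open>M\<close> are integer vectors in a bounded
  set.\<close>

lemma finite_S: "finite S"
proof -
  have "S \<subseteq> (\<lambda>k. B *v ivec k) ` int_box (nat \<lceil>onorm ((*v) M) * real CARD('n)\<rceil>)"
  proof
    fix s assume s: "s \<in> S"
    then obtain k where k: "M *v s = ivec k"
      using S unfolding digit_set_def by blast
    have "norm s \<le> (\<Sum>i\<in>UNIV. \<bar>s $ i\<bar>)"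
      by (rule norm_le_l1_cart)
    also have "\<dots> \<le> (\<Sum>i\<in>(UNIV :: 'n set). 1)"
    proof (rule sum_mono)
      fix i
      have "0 \<le> s $ i \<and> s $ i < 1"
        using S s unfolding digit_set_def by blast
      then show "\<bar>s $ i\<bar> \<le> 1"
        by simp
    qed
    finally have "norm s \<le> real CARD('n)"
      by simp
    then have "onorm ((*v) M) * norm s \<le> onorm ((*v) M) * real CARD('n)"
      by (intro mult_left_mono onorm_pos_le matrix_vector_mul_bounded_linear)
    then have "norm (M *v s) \<le> onorm ((*v) M) * real CARD('n)"
      using onorm[OF matrix_vector_mul_bounded_linear, of M s] by linarith
    then have b: "\<bar>real_of_int (k $ i)\<bar> \<le> onorm ((*v) M) * real CARD('n)" for i
      using component_le_norm_cart[of "ivec k" i] by (simp add: k ivec_def)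
    have "\<bar>k $ i\<bar> \<le> int (nat \<lceil>onorm ((*v) M) * real CARD('n)\<rceil>)" for i
      using b[of i] by linarith
    then have "k \<in> int_box (nat \<lceil>onorm ((*v) M) * real CARD('n)\<rceil>)"
      by (simp add: int_box_def)
    moreover have "s = B *v ivec k"
      using k MB_vec(2)[of s] by simp
    ultimately show "s \<in> (\<lambda>k. B *v ivec k) ` int_box (nat \<lceil>onorm ((*v) M) * real CARD('n)\<rceil>)"
      by blast
  qed
  then show ?thesis
    using finite_int_box finite_surj by blast
qed

lemma digit_unique:
  assumes "s \<in> S" "s' \<in> S" "s - s' = ivec n"
  shows "s = s'"
proof -
  have "s $ i = s' $ i" for i
  proof -
    have "0 \<le> s $ i" "s $ i < 1" "0 \<le> s' $ i" "s' $ i < 1"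
      using S assms(1,2) unfolding digit_set_def by blast+
    moreover have "s $ i - s' $ i = real_of_int (n $ i)"
      using assms(3) by (simp add: vec_eq_iff ivec_def)
    ultimately have "real_of_int (n $ i) < 1" "- 1 < real_of_int (n $ i)"
      by linarith+
    then have "n $ i = 0"
      by linarith
    with \<open>s $ i - s' $ i = real_of_int (n $ i)\<close> show ?thesis
      by simp
  qed
  then show ?thesis
    by (simp add: vec_eq_iff)
qed

text \<open>Negation permutes the nonzero cosets. This is why conjugating a mask built from
  \<open>G\<close> with real coefficients only permutes the factors of its numerator.\<close>

lemma digit_negation:
  obtains \<sigma> where "bij_betw \<sigma> (S - {0}) (S - {0})" "\<And>s. s \<in> S - {0} \<Longrightarrow> \<exists>n. - s = \<sigma> s + ivec n"
proof -
  have "\<exists>s'\<in>S - {0}. \<exists>n. - s = s' + ivec n" if s: "s \<in> S - {0}" for s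
  proof -
    obtain k where k: "M *v s = ivec k"
      using S s unfolding digit_set_def by blast
    have neg: "ivec (- k) = M *v (- s)"
      by (simp add: ivec_minus k[symmetric] linear_neg[OF matrix_vector_mul_linear])
    have "ivec (- k) \<noteq> M *v ivec n" for n
    proof
      assume "ivec (- k) = M *v ivec n"
      then have "M *v (- s) = M *v ivec n"
        using neg by simp
      then have "- s = ivec n"
        using MB_vec(2) by metis
      then have n: "s = ivec (- n)"
        by (metis add.inverse_inverse ivec_minus)
      have "s $ i = 0" for i
      proof -
        have "0 \<le> s $ i" "s $ i < 1"
          using S s unfolding digit_set_def by blast+
        then show ?thesis
          by (simp add: n ivec_def)
      qed
      then show False
        using s by (simp add: vec_eq_iff)
    qed
    from digit_complement[OF this] obtain s' n where s': "s' \<in> S - {0}" "B *v ivec (- k) = s' + ivec n"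
      by blast
    have "B *v ivec (- k) = - s"
      by (simp only: neg MB_vec)
    then have "- s = s' + ivec n"
      using s'(2) by simp
    then show ?thesis
      using s'(1) by blast
  qed
  then obtain \<sigma> where \<sigma>: "\<And>s. s \<in> S - {0} \<Longrightarrow> \<sigma> s \<in> S - {0}"
    "\<And>s. s \<in> S - {0} \<Longrightarrow> \<exists>n. - s = \<sigma> s + ivec n"
    by metis
  \<comment> \<open>Two negations return to the same coset, and a coset contains only one
    digit.\<close>
  have inv: "\<sigma> (\<sigma> s) = s" if s: "s \<in> S - {0}" for s
  proof -
    obtain n n' where n: "- s = \<sigma> s + ivec n" and n': "- \<sigma> s = \<sigma> (\<sigma> s) + ivec n'"
      using \<sigma>(2)[OF s] \<sigma>(2)[OF \<sigma>(1)[OF s]] by blast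
    have e1: "\<sigma> (\<sigma> s) = - \<sigma> s - ivec n'"
      by (simp only: n' add_diff_cancel_right')
    have e2: "\<sigma> s = - s - ivec n"
      by (simp only: n add_diff_cancel_right')
    have "\<sigma> (\<sigma> s) - s = ivec n - ivec n'"
      by (subst e1, subst e2) simp
    then have eq: "\<sigma> (\<sigma> s) - s = ivec (n + - n')"
      by (simp only: ivec_add ivec_minus diff_conv_add_uminus)
    have "\<sigma> (\<sigma> s) \<in> S" "s \<in> S"
      using \<sigma>(1)[OF \<sigma>(1)[OF s]] s by simp_all
    from digit_unique[OF this eq] show ?thesis .
  qed
  have "bij_betw \<sigma> (S - {0}) (S - {0})"
  proof (rule bij_betw_byWitness[of _ \<sigma>])
    show "\<forall>s\<in>S - {0}. \<sigma> (\<sigma> s) = s" "\<forall>s\<in>S - {0}. \<sigma> (\<sigma> s) = s"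
      by (rule ballI, erule inv)+
    show "\<sigma> ` (S - {0}) \<subseteq> S - {0}" "\<sigma> ` (S - {0}) \<subseteq> S - {0}"
      by (rule image_subsetI, erule \<sigma>(1))+
  qed
  then show ?thesis
    by (rule that) (rule \<sigma>(2))
qed

end

section \<open>Convolution of a distribution with a test function\<close>

lemma foldr_pd_vanish:
  assumes f: "smooth f" and O: "open O'" and z: "\<And>x. x \<in> O' \<Longrightarrow> f x = 0" and x: "x \<in> O'"
  shows "foldr pd is f x = 0"
  using x
proof (induction "is" arbitrary: x)
  case (Cons i "is")
  have "(foldr pd is f has_derivative (\<lambda>h. 0)) (at x)"
    by (rule has_derivative_transform_within_open[of "\<lambda>_. 0" _ x UNIV O'])
      (use O Cons in auto)
  from pd_eq_derivative[OF this] show ?case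
    by simp
qed (simp add: z)

context cdist
begin

lemma phi_continuous:
  assumes \<psi>: "smooth \<psi>"
  shows "continuous_on UNIV (\<lambda>y. \<phi> (\<lambda>x. \<psi> (x + y)))"
proof -
  obtain r C N where r: "0 \<le> r" and C: "0 \<le> C"
    and bound: "\<forall>\<psi> B. smooth \<psi> \<longrightarrow>
      (\<forall>is x. length is \<le> N \<longrightarrow> norm x \<le> r \<longrightarrow> cmod (foldr pd is \<psi> x) \<le> B) \<longrightarrow> cmod (\<phi> \<psi>) \<le> C * B"
    using phi_bound by (elim exE conjE)
  let ?I = "{is :: 'n list. length is \<le> N}"
  have fin: "finite ?I"
    using finite_lists_length_le[of "UNIV :: 'n set" N] by simp
  have ne: "?I \<noteq> {}"
    by (auto intro: exI[of _ "[]"])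
  show ?thesis
    unfolding continuous_on_iff
  proof (intro ballI allI impI)
    fix y :: "real ^ 'n" and e :: real assume e: "e > 0"
    define \<epsilon> where "\<epsilon> = e / (C + 1)"
    have \<epsilon>: "\<epsilon> > 0"
      using e C by (simp add: \<epsilon>_def)
    \<comment> \<open>Contains \<open>x + y'\<close> for every \<open>x\<close> in the ball of the
      seminorm and every \<open>y'\<close> within distance 1 of \<open>y\<close>; hence
      \<open>\<delta> \<le> 1\<close> below.\<close>
    let ?Z = "cball (0 :: real ^ 'n) (r + norm y + 1)"
    have "\<exists>d>0. \<forall>u\<in>?Z. \<forall>v\<in>?Z. dist v u < d \<longrightarrow> cmod (foldr pd is \<psi> v - foldr pd is \<psi> u) \<le> \<epsilon>" for "is"
    proof -
      have "uniformly_continuous_on ?Z (foldr pd is \<psi>)"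
        by (intro compact_uniformly_continuous smooth_continuous smooth_foldr_pd \<psi>) auto
      then obtain d where d: "d > 0"
        "\<forall>u\<in>?Z. \<forall>v\<in>?Z. dist v u < d \<longrightarrow> dist (foldr pd is \<psi> v) (foldr pd is \<psi> u) < \<epsilon>"
        using \<epsilon> unfolding uniformly_continuous_on_def by blast
      then show ?thesis
        by (intro exI[of _ d]) (auto simp: dist_norm intro: less_imp_le)
    qed
    then have "\<forall>is. \<exists>d. d > 0 \<and> (\<forall>u\<in>?Z. \<forall>v\<in>?Z. dist v u < d \<longrightarrow> cmod (foldr pd is \<psi> v - foldr pd is \<psi> u) \<le> \<epsilon>)"
      by blast
    from choice[OF this] obtain d where d: "\<forall>is. d is > 0 \<and>
      (\<forall>u\<in>?Z. \<forall>v\<in>?Z. dist v u < d is \<longrightarrow> cmod (foldr pd is \<psi> v - foldr pd is \<psi> u) \<le> \<epsilon>)"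
      by (elim exE)
    define \<delta> where "\<delta> = min 1 (Min (d ` ?I))"
    have \<delta>: "\<delta> > 0" "\<delta> \<le> 1" "\<And>is. length is \<le> N \<Longrightarrow> \<delta> \<le> d is"
      using fin ne d by (auto simp: \<delta>_def min_le_iff_disj)
    show "\<exists>\<delta>>0. \<forall>y'\<in>UNIV. dist y' y < \<delta> \<longrightarrow> dist (\<phi> (\<lambda>x. \<psi> (x + y'))) (\<phi> (\<lambda>x. \<psi> (x + y))) < e"
    proof (intro exI[of _ \<delta>] conjI ballI impI \<delta>(1))
      fix y' :: "real ^ 'n" assume y': "dist y' y < \<delta>"
      have "cmod (\<phi> (\<lambda>x. \<psi> (x + y') - \<psi> (x + y))) \<le> C * \<epsilon>"
      proof (rule bound[rule_format])
        show "smooth (\<lambda>x. \<psi> (x + y') - \<psi> (x + y))"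
          by (intro smooth_diff smooth_translate \<psi>)
        fix "is" :: "'n list" and x :: "real ^ 'n" assume len: "length is \<le> N" and x: "norm x \<le> r"
        have sm: "smooth (\<lambda>x. \<psi> (x + y))" for y
          by (rule smooth_translate[OF \<psi>])
        have "foldr pd is (\<lambda>x. \<psi> (x + y') + (-1) * \<psi> (x + y)) x = foldr pd is \<psi> (x + y') + (-1) * foldr pd is \<psi> (x + y)"
          using foldr_pd_add[OF sm smooth_mult[OF smooth_const sm], of "is" y' "-1" y]
            foldr_pd_cmult[OF sm, of "is" "-1" y] by (simp add: foldr_pd_translate)
        then have e1: "foldr pd is (\<lambda>x. \<psi> (x + y') - \<psi> (x + y)) x = foldr pd is \<psi> (x + y') - foldr pd is \<psi> (x + y)"
          by simp
        have "norm (y' - y) \<le> 1"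
          using y' \<delta>(2) by (simp add: dist_norm)
        then have "norm y' \<le> norm y + 1"
          using norm_triangle_ineq[of "y' - y" y] by simp
        then have "x + y' \<in> ?Z" "x + y \<in> ?Z"
          using x norm_triangle_ineq[of x y'] norm_triangle_ineq[of x y] by (simp_all)
        moreover have "dist (x + y') (x + y) < d is"
          using y' \<delta>(3)[OF len] by simp
        ultimately show "cmod (foldr pd is (\<lambda>x. \<psi> (x + y') - \<psi> (x + y)) x) \<le> \<epsilon>"
          unfolding e1 using d by blast
      qed
      also have "C * \<epsilon> < e"
        using e C by (simp add: \<epsilon>_def field_simps)
      finally show "dist (\<phi> (\<lambda>x. \<psi> (x + y'))) (\<phi> (\<lambda>x. \<psi> (x + y))) < e"
        by (simp add: phi_diff smooth_translate \<psi> dist_norm)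
    qed
  qed
qed

text \<open>Agreement on the open ball of radius \<open>r + 1\<close> gives agreement of all
  derivatives on the closed ball of radius \<open>r\<close>, which is all that the seminorm
  sees.\<close>

lemma phi_local:
  "\<exists>r\<ge>0. \<forall>f g. smooth f \<longrightarrow> smooth g \<longrightarrow> (\<forall>x. norm x < r \<longrightarrow> f x = g x) \<longrightarrow> \<phi> f = \<phi> g"
proof -
  obtain r C N where r: "0 \<le> r" and C: "0 \<le> C"
    and bound: "\<forall>\<psi> B. smooth \<psi> \<longrightarrow>
      (\<forall>is x. length is \<le> N \<longrightarrow> norm x \<le> r \<longrightarrow> cmod (foldr pd is \<psi> x) \<le> B) \<longrightarrow> cmod (\<phi> \<psi>) \<le> C * B"
    using phi_bound by (elim exE conjE)
  show ?thesis
  proof (rule exI[of _ "r + 1"], intro conjI allI impI)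
    show "0 \<le> r + 1"
      using r by simp
    fix f g :: "real ^ 'n \<Rightarrow> complex"
    assume f: "smooth f" and g: "smooth g" and eq: "\<forall>x. norm x < r + 1 \<longrightarrow> f x = g x"
    have "cmod (\<phi> (\<lambda>x. f x - g x)) \<le> C * 0"
    proof (rule bound[rule_format])
      show "smooth (\<lambda>x. f x - g x)"
        by (intro smooth_diff f g)
      fix "is" :: "'n list" and x :: "real ^ 'n" assume "norm x \<le> r"
      then have "foldr pd is (\<lambda>x. f x - g x) x = 0"
        by (intro foldr_pd_vanish[of _ "ball 0 (r + 1)"] smooth_diff f g) (use eq in auto)
      then show "cmod (foldr pd is (\<lambda>x. f x - g x) x) \<le> 0"
        by simp
    qed
    then show "\<phi> f = \<phi> g"
      by (simp add: phi_diff f g)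
  qed
qed

lemma convolution_support:
  assumes \<psi>: "smooth \<psi>" "\<And>x. \<rho> < norm x \<Longrightarrow> \<psi> x = 0"
  shows "\<exists>R. \<forall>y. R < norm y \<longrightarrow> \<phi> (\<lambda>x. \<psi> (x + y)) = 0"
proof -
  obtain r where r: "0 \<le> r" "\<forall>f g. smooth f \<longrightarrow> smooth g \<longrightarrow> (\<forall>x. norm x < r \<longrightarrow> f x = g x) \<longrightarrow> \<phi> f = \<phi> g"
    using phi_local by blast
  have "\<phi> (\<lambda>x. \<psi> (x + y)) = \<phi> (\<lambda>x. 0)" if y: "\<rho> + r < norm y" for y
  proof (rule r(2)[rule_format])
    fix x :: "real ^ 'n" assume "norm x < r"
    then have "\<rho> < norm (x + y)"
      using y norm_diff_ineq[of y x] by (simp add: add.commute)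
    then show "\<psi> (x + y) = 0"
      by (rule \<psi>(2))
  qed (intro smooth_translate \<psi>, rule smooth_const)
  then show ?thesis
    by (intro exI[of _ "\<rho> + r"]) simp
qed

text \<open>Moves the convolution from the test function to \<open>q\<close>. By
  \<open>phi_integral\<close> the left side is \<open>\<phi>\<close> of an integral; after the
  substitution \<open>u = x + y\<close>, the finite separation of \<open>q (u - x)\<close> lets
  \<open>\<phi>\<close> act term by term under the integral over \<open>u\<close>.\<close>

lemma convolution_integral:
  fixes q \<psi> :: "real ^ 'n \<Rightarrow> complex"
  assumes \<psi>: "smooth \<psi>" "\<And>x. \<rho> < norm x \<Longrightarrow> \<psi> x = 0"
    and q: "continuous_on UNIV q" and I: "finite I"
    and sep: "\<And>u x. q (u - x) = (\<Sum>j\<in>I. \<alpha> j u * \<beta> j x)"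
    and \<alpha>: "\<And>j. j \<in> I \<Longrightarrow> continuous_on UNIV (\<alpha> j)" and \<beta>: "\<And>j. j \<in> I \<Longrightarrow> smooth (\<beta> j)"
  shows "(LINT y|lborel. q y * \<phi> (\<lambda>x. \<psi> (x + y))) = (LINT u|lborel. \<phi> (\<lambda>x. q (u - x)) * \<psi> u)"
proof -
  have "\<exists>R. \<forall>y. R < norm y \<longrightarrow> \<phi> (\<lambda>x. \<psi> (x + y)) = 0"
    by (rule convolution_support[OF \<psi>])
  then obtain R where R: "\<forall>y. R < norm y \<longrightarrow> \<phi> (\<lambda>x. \<psi> (x + y)) = 0"
    by (elim exE)
  obtain r where r: "0 \<le> r" "\<forall>f g. smooth f \<longrightarrow> smooth g \<longrightarrow> (\<forall>x. norm x < r \<longrightarrow> f x = g x) \<longrightarrow> \<phi> f = \<phi> g"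
    using phi_local by blast
  \<comment> \<open>Covers the support of the convolution and also, for every \<open>x\<close> in
    the ball on which \<open>\<phi>\<close> depends, the support of \<open>\<psi> (x + y)\<close> in
    \<open>y\<close>.\<close>
  define T where "T = max R (\<rho> + r)"
  obtain b where b: "cball (0::real^'n) T \<subseteq> cbox (- b) b"
    using bounded_subset_cbox_symmetric[OF bounded_cball] by blast
  have out: "T < norm y" if "y \<notin> cbox (- b) b" for y
    using b that by (meson in_mono mem_cball_0 not_le)
  have lint: "integral (cbox (- b) b) f = (LINT y|lborel. f y)"
    if f: "continuous_on UNIV f" "\<And>y. T < norm y \<Longrightarrow> f y = 0" for f :: "real ^ 'n \<Rightarrow> complex"
  proof -
    have "integrable lborel f"
      by (rule integrable_continuous_bounded_support[OF f])
    then have "(f has_integral (LINT y|lborel. f y)) UNIV"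
      by (rule has_integral_integral_lborel)
    moreover have "(\<lambda>y. if y \<in> cbox (- b) b then f y else 0) = f"
      using f(2) out by auto
    ultimately have "((\<lambda>y. if y \<in> cbox (- b) b then f y else 0) has_integral (LINT y|lborel. f y)) UNIV"
      by (simp only:)
    then have "(f has_integral (LINT y|lborel. f y)) (cbox (- b) b)"
      by (simp only: has_integral_restrict_UNIV)
    then show ?thesis
      by (rule integral_unique)
  qed
  have "((\<lambda>y. q y * \<phi> (\<lambda>x. \<psi> (x + y))) has_integral
     \<phi> (\<lambda>x. integral (cbox (- b) b) (\<lambda>y. q y * \<psi> (x + y)))) (cbox (- b) b)"
    by (rule phi_integral[OF \<psi>(1) q])
  then have "integral (cbox (- b) b) (\<lambda>y. q y * \<phi> (\<lambda>x. \<psi> (x + y))) =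
      \<phi> (\<lambda>x. integral (cbox (- b) b) (\<lambda>y. q y * \<psi> (x + y)))"
    by (rule integral_unique)
  moreover have "integral (cbox (- b) b) (\<lambda>y. q y * \<phi> (\<lambda>x. \<psi> (x + y))) = (LINT y|lborel. q y * \<phi> (\<lambda>x. \<psi> (x + y)))"
    by (rule lint) (auto intro!: continuous_on_mult q phi_continuous \<psi>(1) simp: T_def R)
  moreover have "\<phi> (\<lambda>x. integral (cbox (- b) b) (\<lambda>y. q y * \<psi> (x + y))) =
      \<phi> (\<lambda>x. \<Sum>j\<in>I. (LINT u|lborel. \<alpha> j u * \<psi> u) * \<beta> j x)"
  proof (rule r(2)[rule_format])
    show "smooth (\<lambda>x. integral (cbox (- b) b) (\<lambda>y. q y * \<psi> (x + y)))"
      using smooth_param_int[OF \<psi>(1) q, of "- b" b] by (simp add: param_int_def[abs_def])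
    show "smooth (\<lambda>x. \<Sum>j\<in>I. (LINT u|lborel. \<alpha> j u * \<psi> u) * \<beta> j x)"
      by (intro smooth_sum smooth_mult smooth_const \<beta>)
    fix x :: "real ^ 'n" assume x: "norm x < r"
    have cont: "continuous_on UNIV (\<lambda>u. q (u - x) * \<psi> u)"
      by (intro continuous_on_mult continuous_on_compose2[OF q] continuous_intros smooth_continuous \<psi>(1)) auto
    have "continuous_on UNIV (\<lambda>y. q y * \<psi> (x + y))"
      by (intro continuous_on_mult q continuous_on_compose2[OF smooth_continuous[OF \<psi>(1), of UNIV]] continuous_intros) auto
    then have "integral (cbox (- b) b) (\<lambda>y. q y * \<psi> (x + y)) = (LINT y|lborel. q y * \<psi> (x + y))"
    proof (rule lint)
      fix y :: "real ^ 'n" assume "T < norm y"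
      then have "\<rho> < norm (x + y)"
        using x norm_diff_ineq[of y x] by (simp add: T_def add.commute)
      then show "q y * \<psi> (x + y) = 0"
        by (simp add: \<psi>(2))
    qed
    also have "\<dots> = (LINT y|lborel. (\<lambda>u. q (u - x) * \<psi> u) (y + x))"
      by (simp add: add.commute)
    also have "\<dots> = (LINT u|lborel. q (u - x) * \<psi> u)"
      by (rule lborel_integral_translate) (rule borel_measurable_continuous_onI[OF cont])
    also have "\<dots> = (LINT u|lborel. (\<Sum>j\<in>I. \<beta> j x * (\<alpha> j u * \<psi> u)))"
      by (simp add: sep sum_distrib_right sum_distrib_left mult_ac)
    also have "\<dots> = (\<Sum>j\<in>I. (LINT u|lborel. \<beta> j x * (\<alpha> j u * \<psi> u)))"
    proof (rule Bochner_Integration.integral_sum)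
      fix j assume "j \<in> I"
      then have "integrable lborel (\<lambda>u. \<alpha> j u * \<psi> u)"
        by (intro integrable_continuous_bounded_support[of _ \<rho>] continuous_on_mult \<alpha> smooth_continuous \<psi>(1)) (simp_all add: \<psi>(2))
      then show "integrable lborel (\<lambda>u. \<beta> j x * (\<alpha> j u * \<psi> u))"
        by (rule integrable_mult_right)
    qed
    also have "\<dots> = (\<Sum>j\<in>I. (LINT u|lborel. \<alpha> j u * \<psi> u) * \<beta> j x)"
      by (simp add: mult.commute)
    finally show "integral (cbox (- b) b) (\<lambda>y. q y * \<psi> (x + y)) = (\<Sum>j\<in>I. (LINT u|lborel. \<alpha> j u * \<psi> u) * \<beta> j x)" .
  qed
  moreover have "\<phi> (\<lambda>x. \<Sum>j\<in>I. (LINT u|lborel. \<alpha> j u * \<psi> u) * \<beta> j x) = (\<Sum>j\<in>I. (LINT u|lborel. \<alpha> j u * \<psi> u) * \<phi> (\<beta> j))"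
    by (subst phi_sum) (auto intro!: smooth_mult smooth_const \<beta> sum.cong phi_cmult)
  moreover have "(\<Sum>j\<in>I. (LINT u|lborel. \<alpha> j u * \<psi> u) * \<phi> (\<beta> j)) = (LINT u|lborel. (\<Sum>j\<in>I. \<alpha> j u * \<psi> u * \<phi> (\<beta> j)))"
  proof (subst Bochner_Integration.integral_sum)
    fix j assume "j \<in> I"
    then have "integrable lborel (\<lambda>u. \<alpha> j u * \<psi> u)"
      by (intro integrable_continuous_bounded_support[of _ \<rho>] continuous_on_mult \<alpha> smooth_continuous \<psi>(1)) (simp_all add: \<psi>(2))
    then show "integrable lborel (\<lambda>u. \<alpha> j u * \<psi> u * \<phi> (\<beta> j))"
      by (rule integrable_mult_left)
  qed simp
  moreover have "(\<Sum>j\<in>I. \<alpha> j u * \<psi> u * \<phi> (\<beta> j)) = \<phi> (\<lambda>x. q (u - x)) * \<psi> u" for u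
  proof -
    have "\<phi> (\<lambda>x. q (u - x)) = (\<Sum>j\<in>I. \<phi> (\<lambda>x. \<alpha> j u * \<beta> j x))"
      unfolding sep by (rule phi_sum) (intro smooth_mult smooth_const \<beta>)
    also have "\<dots> = (\<Sum>j\<in>I. \<alpha> j u * \<phi> (\<beta> j))"
      by (intro sum.cong refl phi_cmult \<beta>)
    finally show ?thesis
      by (simp add: sum_distrib_right sum_distrib_left mult_ac)
  qed
  ultimately show ?thesis
    by simp
qed

end

section \<open>Exponential sums\<close>

text \<open>Bilinear, without conjugation, so that its exponentials are entire in
  \<open>\<zeta>\<close>.\<close>

definition ip :: "real ^ 'n \<Rightarrow> complex ^ 'n \<Rightarrow> complex" where
  "ip v \<zeta> = (\<Sum>i\<in>UNIV. of_real (v $ i) * \<zeta> $ i)"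

lemma ip_add_right: "ip v (\<zeta> + \<eta>) = ip v \<zeta> + ip v \<eta>"
  by (simp add: ip_def distrib_left sum.distrib)

lemma ip_add_left: "ip (v + w) \<zeta> = ip v \<zeta> + ip w \<zeta>"
  by (simp add: ip_def distrib_right sum.distrib)

lemma ip_zero_left [simp]: "ip 0 \<zeta> = 0"
  by (simp add: ip_def)

lemma ip_scale: "ip v (s *s \<zeta>) = s * ip v \<zeta>"
  by (simp add: ip_def sum_distrib_left mult_ac)

lemma ip_cvec: "ip v (cvec x) = of_real (v \<bullet> x)"
  by (simp add: ip_def cvec_def inner_vec_def)

lemma ip_cmat: "ip v (cmat N *v \<zeta>) = ip (transpose N *v v) \<zeta>"
proof -
  have "ip v (cmat N *v \<zeta>) = (\<Sum>i\<in>UNIV. \<Sum>j\<in>UNIV. of_real (v $ i) * (of_real (N $ i $ j) * \<zeta> $ j))"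
    by (simp add: ip_def cmat_def matrix_vector_mult_def sum_distrib_left)
  also have "\<dots> = (\<Sum>j\<in>UNIV. \<Sum>i\<in>UNIV. of_real (v $ i) * (of_real (N $ i $ j) * \<zeta> $ j))"
    by (rule sum.swap)
  also have "\<dots> = ip (transpose N *v v) \<zeta>"
    by (simp add: ip_def matrix_vector_mult_def transpose_def sum_distrib_left sum_distrib_right mult_ac)
  finally show ?thesis .
qed

lemma exp_ip_add:
  "exp (- \<i> * ip (v + w) \<zeta>) = exp (- \<i> * ip v \<zeta>) * exp (- \<i> * ip w \<zeta>)"
  "exp (- \<i> * ip v (\<zeta> + \<eta>)) = exp (- \<i> * ip v \<zeta>) * exp (- \<i> * ip v \<eta>)"
  by (simp_all only: ip_add_left ip_add_right distrib_left exp_add)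

lemma cmat_cvec: "cmat N *v cvec x = cvec (N *v x)"
  by (simp add: cmat_def cvec_def matrix_vector_mult_def vec_eq_iff)

lemma cvec_add: "cvec (x + y) = cvec x + cvec y"
  by (simp add: cvec_def vec_eq_iff)

lemma cvec_scale: "of_real s *s cvec x = cvec (s *\<^sub>R x)"
  by (simp add: cvec_def vec_eq_iff)

lemma cvec_0 [simp]: "cvec 0 = 0"
  by (simp add: cvec_def vec_eq_iff)

lemma cmat_scale: "cmat N *v (s *s \<zeta>) = s *s (cmat N *v \<zeta>)"
  by (simp add: vector_scalar_commute)

inductive exp_sum :: "(complex ^ 'n \<Rightarrow> complex) \<Rightarrow> bool" where
  single: "exp_sum (\<lambda>\<zeta>. c * exp (- \<i> * ip v \<zeta>))"
| plus: "exp_sum f \<Longrightarrow> exp_sum g \<Longrightarrow> exp_sum (\<lambda>\<zeta>. f \<zeta> + g \<zeta>)"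

lemma exp_sum_const: "exp_sum (\<lambda>\<zeta>. c)"
  using exp_sum.single[of c 0] by simp

lemma exp_sum_single_mult: "exp_sum g \<Longrightarrow> exp_sum (\<lambda>\<zeta>. c * exp (- \<i> * ip v \<zeta>) * g \<zeta>)"
proof (induction rule: exp_sum.induct)
  case (single c' v')
  have "(\<lambda>\<zeta>. c * exp (- \<i> * ip v \<zeta>) * (c' * exp (- \<i> * ip v' \<zeta>))) = (\<lambda>\<zeta>. (c * c') * exp (- \<i> * ip (v + v') \<zeta>))"
    by (simp only: exp_ip_add mult_ac)
  then show ?case
    using exp_sum.single by simp
next
  case (plus f g)
  then show ?case
    using exp_sum.plus[OF plus.IH] by (simp add: distrib_left)
qed

lemma exp_sum_mult: "exp_sum f \<Longrightarrow> exp_sum g \<Longrightarrow> exp_sum (\<lambda>\<zeta>. f \<zeta> * g \<zeta>)"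
proof (induction rule: exp_sum.induct)
  case (single c v)
  then show ?case
    by (rule exp_sum_single_mult)
next
  case (plus f f')
  then show ?case
    using exp_sum.plus[of "\<lambda>\<zeta>. f \<zeta> * g \<zeta>" "\<lambda>\<zeta>. f' \<zeta> * g \<zeta>"] by (simp add: distrib_right)
qed

lemma exp_sum_prod: "(\<And>i. i \<in> I \<Longrightarrow> exp_sum (f i)) \<Longrightarrow> exp_sum (\<lambda>\<zeta>. \<Prod>i\<in>I. f i \<zeta>)"
  by (induction I rule: infinite_finite_induct) (auto intro: exp_sum_const exp_sum_mult)

lemma exp_sum_sum: "(\<And>i. i \<in> I \<Longrightarrow> exp_sum (f i)) \<Longrightarrow> exp_sum (\<lambda>\<zeta>. \<Sum>i\<in>I. f i \<zeta>)"
  by (induction I rule: infinite_finite_induct) (auto intro: exp_sum_const exp_sum.plus)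

lemma exp_sum_affine: "exp_sum f \<Longrightarrow> exp_sum (\<lambda>\<zeta>. f (cmat N *v \<zeta> + \<eta>))"
proof (induction rule: exp_sum.induct)
  case (single c v)
  have "(\<lambda>\<zeta>. c * exp (- \<i> * ip v (cmat N *v \<zeta> + \<eta>))) =
      (\<lambda>\<zeta>. (c * exp (- \<i> * ip v \<eta>)) * exp (- \<i> * ip (transpose N *v v) \<zeta>))"
    by (simp only: exp_ip_add ip_cmat mult_ac)
  then show ?case
    using exp_sum.single by simp
qed (rule exp_sum.plus)

lemma exp_sum_trig_poly:
  fixes g :: "complex ^ 'n \<Rightarrow> complex"
  assumes "trig_poly K g"
  shows "exp_sum g"
proof -
  obtain F c where g: "\<forall>\<zeta>. g \<zeta> = (\<Sum>k\<in>F. c k * exp (- \<i> * (\<Sum>i\<in>UNIV. of_int ((k :: int ^ 'n) $ i) * \<zeta> $ i)))"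
    using assms unfolding trig_poly_def by blast
  have "g = (\<lambda>\<zeta>. \<Sum>k\<in>F. c k * exp (- \<i> * ip (ivec k) \<zeta>))"
    using g by (auto simp: ip_def ivec_def)
  then show ?thesis
    by (simp only: exp_sum_sum exp_sum.single)
qed

lemma exp_sum_holomorphic: "exp_sum f \<Longrightarrow> (\<lambda>s. f (s *s \<xi> + \<eta>)) holomorphic_on UNIV"
proof (induction rule: exp_sum.induct)
  case (single c v)
  show ?case
    unfolding ip_add_right ip_scale by (intro holomorphic_intros)
qed (rule holomorphic_on_add)

lemma trig_poly_periodic:
  fixes g :: "complex ^ 'n \<Rightarrow> complex"
  assumes "trig_poly K g"
  shows "g (\<zeta> + cvec ((2 * pi) *\<^sub>R ivec n)) = g \<zeta>"
proof -
  obtain F c where g: "\<forall>\<zeta>. g \<zeta> = (\<Sum>k\<in>F. c k * exp (- \<i> * (\<Sum>i\<in>UNIV. of_int ((k :: int ^ 'n) $ i) * \<zeta> $ i)))"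
    using assms unfolding trig_poly_def by blast
  have g': "g \<zeta> = (\<Sum>k\<in>F. c k * exp (- \<i> * ip (ivec k) \<zeta>))" for \<zeta>
    using g by (simp add: ip_def ivec_def)
  have "exp (- \<i> * ip (ivec k) (\<zeta> + cvec ((2 * pi) *\<^sub>R ivec n))) = exp (- \<i> * ip (ivec k) \<zeta>)" for k
  proof -
    have "- \<i> * ip (ivec k) (\<zeta> + cvec ((2 * pi) *\<^sub>R ivec n)) =
        - \<i> * ip (ivec k) \<zeta> + 2 * pi * \<i> * of_real (ivec k \<bullet> ivec (- n))"
      by (simp add: ip_add_right ip_cvec ivec_minus algebra_simps)
    also have "exp \<dots> = exp (- \<i> * ip (ivec k) \<zeta>) * char k (ivec (- n))"
      by (simp only: exp_add char_def)
    finally show ?thesis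
      by (simp only: char_ivec mult_1_right)
  qed
  then show ?thesis
    unfolding g' by simp
qed

lemma trig_poly_conj:
  fixes g :: "complex ^ 'n \<Rightarrow> complex"
  assumes "trig_poly \<real> g"
  shows "cnj (g (cvec x)) = g (cvec (- x))"
proof -
  obtain F c where F: "c ` F \<subseteq> \<real>"
    and g: "\<forall>\<zeta>. g \<zeta> = (\<Sum>k\<in>F. c k * exp (- \<i> * (\<Sum>i\<in>UNIV. of_int ((k :: int ^ 'n) $ i) * \<zeta> $ i)))"
    using assms unfolding trig_poly_def by blast
  have g': "g \<zeta> = (\<Sum>k\<in>F. c k * exp (- \<i> * ip (ivec k) \<zeta>))" for \<zeta>
    using g by (simp add: ip_def ivec_def)
  show ?thesis
    unfolding g' cnj_sum
  proof (rule sum.cong[OF refl])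
    fix k assume "k \<in> F"
    then have "cnj (c k) = c k"
      using F by (auto simp: Reals_cnj_iff)
    then show "cnj (c k * exp (- \<i> * ip (ivec k) (cvec x))) = c k * exp (- \<i> * ip (ivec k) (cvec (- x)))"
      by (simp add: ip_cvec exp_cnj)
  qed
qed

text \<open>If \<open>L\<close> solves the mixed equation, the functional attached to \<open>L\<close> kills every product of
  \<open>X + W ^ m\<close> with an exponential, hence with every exponential sum; below, \<open>H \<xi>\<close> is the Taylor series
  of such a sum in the direction \<open>\<xi>\<close>.\<close>

definition fps_ext :: "complex fps \<Rightarrow> int \<Rightarrow> complex" where
  "fps_ext F n = (if n < 0 then 0 else fps_nth F (nat n))"

text \<open>The multiplier of a homogeneous operator of order \<open>k\<close> on divided powers of
  \<open>\<xi> \<bullet> x\<close>; each derivative brings one factor \<open>- \<i>\<close>.\<close>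

definition X_symb :: "nat \<Rightarrow> (real ^ 'n \<Rightarrow> real) \<Rightarrow> real ^ 'n \<Rightarrow> complex" where
  "X_symb k X \<xi> = (- \<i>) ^ k * of_real (X \<xi>)"

lemma sum_list_add:
  fixes f g :: "'a \<Rightarrow> complex"
  shows "(\<Sum>p\<leftarrow>L. f p + g p) = (\<Sum>p\<leftarrow>L. f p) + (\<Sum>p\<leftarrow>L. g p)"
  by (induction L) auto

text \<open>Of the \<open>n\<close> factors \<open>- \<i>\<close> on the left, \<open>k\<close>
  remain outside; each of the others meets one in the argument and turns it into
  \<open>- 1\<close>.\<close>

lemma minus_i_power_dp:
  assumes "0 \<le> n"
  shows "(- \<i>) ^ nat n * dp (n - int k) (- \<i> * z) = (- \<i>) ^ k * dp (n - int k) (- z)"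
proof (cases "n < int k")
  case False
  then obtain a where a: "nat n = k + a" "n - int k = int a"
    by (metis add_diff_cancel_left' assms le_add_diff_inverse linorder_not_le nat_int_add nat_le_eq_zle nonneg_int_cases of_nat_0_le_iff int_ops(6) nat_int)
  have "(- \<i>) ^ a * (- \<i> * z) ^ a = (- z) ^ a"
    by (simp add: power_mult_distrib[symmetric])
  then show ?thesis
    by (simp add: a dp_int power_add)
qed simp

lemma mixed_functional_vanishes:
  fixes L :: "(complex \<times> int \<times> (real ^ 'n)) list"
  assumes L: "\<And>x. psum (symb k (X_symb k X) L) x + psum (symb w (X_symb w Z) L) x = 0"
    and deg: "\<forall>p\<in>set L. 0 \<le> fst (snd p)"
    and h: "exp_sum h" and H: "\<And>\<xi>. (\<lambda>s. h (s *s cvec \<xi>)) has_fps_expansion H \<xi>"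
  shows "(\<Sum>p\<leftarrow>L. fst p * (- \<i>) ^ nat (fst (snd p)) *
     (of_real (X (snd (snd p))) * fps_ext (H (snd (snd p))) (fst (snd p) - int k) +
      of_real (Z (snd (snd p))) * fps_ext (H (snd (snd p))) (fst (snd p) - int w))) = 0"
  using h H
proof (induction arbitrary: H rule: exp_sum.induct)
  case (single c v)
  have coeff: "fps_ext (H \<xi>) n = c * dp n (- \<i> * of_real (v \<bullet> \<xi>))" for \<xi> n
  proof -
    have "(\<lambda>s. c * exp ((- \<i> * of_real (v \<bullet> \<xi>)) * s)) has_fps_expansion fps_const c * fps_exp (- \<i> * of_real (v \<bullet> \<xi>))"
      by (intro fps_expansion_intros)
    moreover have "(\<lambda>s. c * exp (- \<i> * ip v (s *s cvec \<xi>))) = (\<lambda>s. c * exp ((- \<i> * of_real (v \<bullet> \<xi>)) * s))"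
      by (simp add: ip_scale ip_cvec mult_ac)
    ultimately have "H \<xi> = fps_const c * fps_exp (- \<i> * of_real (v \<bullet> \<xi>))"
      using single.prems[of \<xi>] fps_expansion_unique_complex by metis
    then show ?thesis
      by (simp add: fps_ext_def dp_def)
  qed
  have "(\<Sum>p\<leftarrow>L. fst p * (- \<i>) ^ nat (fst (snd p)) *
     (of_real (X (snd (snd p))) * fps_ext (H (snd (snd p))) (fst (snd p) - int k) +
      of_real (Z (snd (snd p))) * fps_ext (H (snd (snd p))) (fst (snd p) - int w))) =
    (\<Sum>p\<leftarrow>L. c * (X_symb k X (snd (snd p)) * fst p * dp (fst (snd p) - int k) (of_real (snd (snd p) \<bullet> (- v)))) +
      c * (X_symb w Z (snd (snd p)) * fst p * dp (fst (snd p) - int w) (of_real (snd (snd p) \<bullet> (- v)))))"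
  proof (intro arg_cong[of _ _ sum_list] map_cong refl)
    fix p assume "p \<in> set L"
    obtain b n \<xi> where p: "p = (b, n, \<xi>)"
      by (cases p) auto
    then have n: "0 \<le> n"
      using deg \<open>p \<in> set L\<close> by auto
    let ?z = "complex_of_real (v \<bullet> \<xi>)"
    have "b * (- \<i>) ^ nat n * (of_real (X \<xi>) * (c * dp (n - int k) (- \<i> * ?z)) + of_real (Z \<xi>) * (c * dp (n - int w) (- \<i> * ?z)))
      = b * c * (of_real (X \<xi>) * ((- \<i>) ^ nat n * dp (n - int k) (- \<i> * ?z)) + of_real (Z \<xi>) * ((- \<i>) ^ nat n * dp (n - int w) (- \<i> * ?z)))"
      by (simp add: algebra_simps)
    also have "\<dots> = b * c * (of_real (X \<xi>) * ((- \<i>) ^ k * dp (n - int k) (- ?z)) + of_real (Z \<xi>) * ((- \<i>) ^ w * dp (n - int w) (- ?z)))"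
      by (simp only: minus_i_power_dp[OF n])
    finally show "fst p * (- \<i>) ^ nat (fst (snd p)) *
     (of_real (X (snd (snd p))) * fps_ext (H (snd (snd p))) (fst (snd p) - int k) +
      of_real (Z (snd (snd p))) * fps_ext (H (snd (snd p))) (fst (snd p) - int w)) =
      c * (X_symb k X (snd (snd p)) * fst p * dp (fst (snd p) - int k) (of_real (snd (snd p) \<bullet> (- v)))) +
      c * (X_symb w Z (snd (snd p)) * fst p * dp (fst (snd p) - int w) (of_real (snd (snd p) \<bullet> (- v))))"
      unfolding coeff p fst_conv snd_conv X_symb_def by (simp add: algebra_simps inner_commute)
  qed
  \<comment> \<open>For a single exponential of frequency \<open>v\<close> the functional is
    \<open>c\<close> times the mixed equation evaluated at \<open>- v\<close>.\<close>
  also have "\<dots> = c * (psum (symb k (X_symb k X) L) (- v) + psum (symb w (X_symb w Z) L) (- v))"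
    by (simp add: psum_symb sum_list_add sum_list_const_mult distrib_left)
  finally show ?case
    by (simp add: L)
next
  case (plus f g)
  define F where "F \<xi> = fps_expansion (\<lambda>s. f (s *s cvec \<xi>)) 0" for \<xi>
  define G where "G \<xi> = fps_expansion (\<lambda>s. g (s *s cvec \<xi>)) 0" for \<xi>
  have F: "(\<lambda>s. f (s *s cvec \<xi>)) has_fps_expansion F \<xi>" for \<xi>
    unfolding F_def using exp_sum_holomorphic[OF plus.hyps(1), of "cvec \<xi>" 0]
    by (intro has_fps_expansion_fps_expansion[of UNIV]) auto
  have G: "(\<lambda>s. g (s *s cvec \<xi>)) has_fps_expansion G \<xi>" for \<xi>
    unfolding G_def using exp_sum_holomorphic[OF plus.hyps(2), of "cvec \<xi>" 0]
    by (intro has_fps_expansion_fps_expansion[of UNIV]) auto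
  have "H \<xi> = F \<xi> + G \<xi>" for \<xi>
    using fps_expansion_unique_complex[OF plus.prems has_fps_expansion_add[OF F G]] .
  then have H: "fps_ext (H \<xi>) n = fps_ext (F \<xi>) n + fps_ext (G \<xi>) n" for \<xi> n
    by (simp add: fps_ext_def)
  let ?t = "\<lambda>H p. fst p * (- \<i>) ^ nat (fst (snd p)) *
     (of_real (X (snd (snd p))) * fps_ext (H (snd (snd p))) (fst (snd p) - int k) +
      of_real (Z (snd (snd p))) * fps_ext (H (snd (snd p))) (fst (snd p) - int w))"
  have "(\<Sum>p\<leftarrow>L. ?t H p) = (\<Sum>p\<leftarrow>L. ?t F p + ?t G p)"
    by (intro arg_cong[of _ _ sum_list] map_cong refl) (simp add: H algebra_simps)
  also have "\<dots> = (\<Sum>p\<leftarrow>L. ?t F p) + (\<Sum>p\<leftarrow>L. ?t G p)"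
    by (rule sum_list_add)
  also have "\<dots> = 0"
    by (simp only: plus.IH(1)[OF F] plus.IH(2)[OF G]) simp
  finally show ?case .
qed

section \<open>The masks\<close>

lemma exp_sum_shift:
  fixes f :: "complex ^ 'n \<Rightarrow> complex"
  assumes "exp_sum f"
  shows "exp_sum (\<lambda>\<zeta>. f (\<zeta> + \<eta>))"
proof -
  have "exp_sum (\<lambda>\<zeta>. f (cmat (mat 1) *v \<zeta> + \<eta>))"
    by (rule exp_sum_affine[OF assms])
  moreover have "cmat (mat 1) = (mat 1 :: complex ^ 'n ^ 'n)"
    by (simp add: cmat_def mat_def vec_eq_iff)
  ultimately show ?thesis
    by simp
qed

lemma exp_sum_mask:
  assumes "exp_sum g"
  shows "exp_sum (mask S g)"
proof -
  have "exp_sum (\<lambda>\<zeta>. (\<Prod>s\<in>S - {0}. g (\<zeta> + cvec ((2 * pi) *\<^sub>R s))) * inverse (\<Prod>s\<in>S - {0}. g (cvec ((2 * pi) *\<^sub>R s))))"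
    by (intro exp_sum_mult exp_sum_const exp_sum_prod exp_sum_shift assms)
  then show ?thesis
    by (simp add: mask_def[abs_def] divide_inverse)
qed

text \<open>At most two coefficients of \<open>G\<close> enter the Cauchy product at order
  \<open>n\<close>; \<open>fps_ext\<close> supplies 0 when the complementary index would be
  negative.\<close>

lemma fps_mult_two_terms:
  assumes G: "\<And>i. i \<le> n \<Longrightarrow> fps_nth G i = c * (if i = k then x else if i = w then z else 0)" and kw: "k < w"
  shows "fps_nth (G * H) n = c * (x * fps_ext H (int n - int k) + z * fps_ext H (int n - int w))"
proof -
  have "fps_nth (G * H) n = (\<Sum>i\<le>n. fps_nth G i * fps_nth H (n - i))"
    by (simp add: fps_mult_nth atLeast0AtMost)
  also have "\<dots> = (\<Sum>i\<le>n. (if i = k then c * x * fps_nth H (n - i) else 0) + (if i = w then c * z * fps_nth H (n - i) else 0))"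
    using kw by (intro sum.cong) (auto simp: G)
  also have "\<dots> = (if k \<le> n then c * x * fps_nth H (n - k) else 0) + (if w \<le> n then c * z * fps_nth H (n - w) else 0)"
    by (simp add: sum.distrib)
  also have "\<dots> = c * (x * fps_ext H (int n - int k) + z * fps_ext H (int n - int w))"
    by (auto simp: fps_ext_def algebra_simps nat_diff_distrib)
  finally show ?thesis .
qed

lemma mono_at_scale: "mono_at \<alpha> (s *\<^sub>R \<xi>) = s ^ mdeg \<alpha> * mono_at \<alpha> \<xi>"
  by (simp add: mono_at_def mdeg_def power_mult_distrib prod.distrib power_sum)

lemma poly_at_scale:
  assumes "Y \<in> homog_polys k"
  shows "poly_at Y (s *\<^sub>R \<xi>) = s ^ k * poly_at Y \<xi>"
  unfolding poly_at_def sum_distrib_left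
  by (intro sum.cong refl) (use assms in \<open>simp add: mono_at_scale homog_polys_def\<close>)

lemma tendsto_sum_list:
  fixes f :: "nat \<Rightarrow> 'a \<Rightarrow> complex"
  assumes "\<And>p. p \<in> set L \<Longrightarrow> (\<lambda>N. f N p) \<longlonglongrightarrow> g p"
  shows "(\<lambda>N. \<Sum>p\<leftarrow>L. f N p) \<longlonglongrightarrow> (\<Sum>p\<leftarrow>L. g p)"
  using assms by (induction L) (auto intro: tendsto_add)

section \<open>Taylor expansions of the partial products and the moment conditions\<close>

locale elliptic = dilation_setup A U Q S + cdist \<phi>
  for A U Q :: "real ^ 'n ^ 'n" and S :: "(real ^ 'n) set" and \<phi> :: "(real ^ 'n \<Rightarrow> complex) \<Rightarrow> complex" +
  fixes K :: "complex set" and m k :: nat and X :: "(nat ^ 'n) \<Rightarrow>\<^sub>0 real"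
    and G :: "int \<Rightarrow> complex ^ 'n \<Rightarrow> complex" and C :: "int \<Rightarrow> real" and R :: "int \<Rightarrow> nat ^ 'n \<Rightarrow> real"
  assumes K: "K = \<real> \<or> K = UNIV"
    and X: "X \<in> homog_polys k"
    and k: "k < 2 * m"
    and G: "\<And>j. trig_poly K (G j)"
    and G_nonzero: "\<And>j s. s \<in> S - {0} \<Longrightarrow> G j (cvec ((2 * pi) *\<^sub>R s)) \<noteq> 0"
    and C: "\<And>j. C j \<noteq> 0"
    and R: "\<And>j. series_order (R j) > enat (2 * m)"
    and Maclaurin: "\<And>j \<xi>. ((\<lambda>\<kappa>. of_real (R j \<kappa> * mono_at \<kappa> (mat_powi (inv_transp A) j *v \<xi>))) has_sum
          (G j (cvec (mat_powi (inv_transp A) j *v \<xi>))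
            - of_real (C j * (poly_at X \<xi> + poly_at (W_poly Q) \<xi> ^ m)))) UNIV"
    and \<phi>: "\<And>Z. compact Z \<Longrightarrow> uniform_limit Z
        (\<lambda>N \<zeta>. \<Prod>j = 1..N. mask S (G (int j)) (cmat (mat_powi (inv_transp A) (int j)) *v \<zeta>))
        (fourier \<phi>) sequentially"
begin

abbreviation "Xf \<equiv> poly_at X"
definition "Wf \<xi> = poly_at (W_poly Q) \<xi> ^ m"

definition partial :: "nat \<Rightarrow> complex ^ 'n \<Rightarrow> complex" where
  "partial N \<zeta> = (\<Prod>j = 1..N. mask S (G (int j)) (cmat (Bpow j) *v \<zeta>))"

lemma partial_limit: "compact Z \<Longrightarrow> uniform_limit Z partial (fourier \<phi>) sequentially"
  using \<phi>[of Z] by (simp add: partial_def[abs_def] Bpow_def)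

lemma exp_sum_G: "exp_sum (G j)"
  by (rule exp_sum_trig_poly[OF G])

lemma exp_sum_factor: "exp_sum (\<lambda>\<zeta>. mask S (G j) (cmat N *v \<zeta> + \<eta>))"
  by (rule exp_sum_affine[OF exp_sum_mask[OF exp_sum_G]])

lemma exp_sum_partial: "exp_sum (\<lambda>\<zeta>. partial N (\<zeta> + \<eta>))"
  unfolding partial_def matrix_vector_right_distrib by (intro exp_sum_prod exp_sum_factor)

lemma mask_0: "mask S (G j) 0 = 1"
  using G_nonzero by (simp add: mask_def finite_S)

lemma fourier_0: "fourier \<phi> 0 = 1"
proof -
  have "partial N 0 = 1" for N
    by (simp add: partial_def mask_0)
  moreover have "(\<lambda>N. partial N 0) \<longlonglongrightarrow> fourier \<phi> 0"
    by (rule tendsto_uniform_limitI[OF partial_limit[of "{0}"]]) auto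
  ultimately show ?thesis
    by (simp add: LIMSEQ_const_iff)
qed

text \<open>Every mask equals 1 at the origin, hence so does the Fourier transform. The resulting
  nonzero mean of \<open>\<phi>\<close> is what makes convolution invertible on polynomials.\<close>

lemma phi_1: "\<phi>_norm * \<phi> (\<lambda>x. 1) = 1"
  using fourier_line[of 0 0 0] fourier_0 by simp

text \<open>The offset \<open>j0\<close> ensures that the factor of index \<open>j0\<close>, if
  positive, is present in every term of the sequence.\<close>

lemma partial_line_limit:
  "uniform_limit (cball 0 1) (\<lambda>N s. partial (N + j0) (s *s cvec \<xi> + cvec w))
     (\<lambda>s. fourier \<phi> (s *s cvec \<xi> + cvec w)) sequentially"
proof -
  let ?h = "\<lambda>s. s *s cvec \<xi> + cvec w"
  have "continuous_on (cball 0 1) ?h"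
    unfolding vector_scalar_mult_def by (intro continuous_intros continuous_on_vec_lambda)
  then have "compact (?h ` cball 0 1)"
    by (intro compact_continuous_image) auto
  then have lim: "uniform_limit (?h ` cball 0 1) partial (fourier \<phi>) sequentially"
    by (rule partial_limit)
  show ?thesis
    unfolding uniform_limit_iff
  proof (intro allI impI)
    fix e :: real assume "e > 0"
    then obtain N0 where N0: "\<forall>N\<ge>N0. \<forall>z\<in>?h ` cball 0 1. dist (partial N z) (fourier \<phi> z) < e"
      using lim unfolding uniform_limit_iff eventually_sequentially by blast
    show "\<forall>\<^sub>F N in sequentially. \<forall>s\<in>cball 0 1. dist (partial (N + j0) (?h s)) (fourier \<phi> (?h s)) < e"
      unfolding eventually_sequentially
    proof (intro exI[of _ N0] allI impI ballI)
      fix N s assume "N0 \<le> N" "s \<in> cball (0::complex) 1"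
      then show "dist (partial (N + j0) (?h s)) (fourier \<phi> (?h s)) < e"
        using N0 by simp
    qed
  qed
qed

lemma partial_line_holomorphic: "(\<lambda>s. partial N (s *s cvec \<xi> + cvec w)) holomorphic_on UNIV"
  using exp_sum_holomorphic[OF exp_sum_partial[of N "cvec w"], of "cvec \<xi>" 0] by simp

lemma fourier_line_expansion:
  "\<exists>F. (\<lambda>s. fourier \<phi> (s *s cvec \<xi> + cvec w)) has_fps_expansion F"
proof -
  have "(\<lambda>s. partial (N + 0) (s *s cvec \<xi> + cvec w)) has_fps_expansion
      fps_expansion (\<lambda>s. partial (N + 0) (s *s cvec \<xi> + cvec w)) 0" for N
    using partial_line_holomorphic by (intro has_fps_expansion_fps_expansion[of UNIV]) auto
  from uniform_limit_fps_coeffs[OF partial_line_limit partial_line_holomorphic this]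
  show ?thesis
    by blast
qed

text \<open>Every index in the support of \<open>R j\<close> has degree at least
  \<open>2 * m + 1\<close>, so on the ray each term of the remainder is at most
  \<open>s ^ Suc (2 * m)\<close> times its modulus at \<open>s = 1\<close>. The constant
  \<open>D\<close> is the sum of these moduli.\<close>

lemma G_line_coeffs:
  fixes j :: int
  defines "\<eta> \<equiv> \<lambda>\<xi>. mat_powi B j *v \<xi>"
  shows "\<exists>D. \<forall>s>0. s \<le> 1 \<longrightarrow> cmod (G j (of_real s *s cvec (\<eta> \<xi>)) -
      (\<Sum>n<Suc (2 * m). of_real (C j) * (if n = k then of_real (Xf \<xi>) else if n = 2 * m then of_real (Wf \<xi>) else 0) * of_real s ^ n))
    \<le> D * s ^ Suc (2 * m)"
proof -
  let ?a = "\<lambda>\<kappa>. R j \<kappa> * mono_at \<kappa> (\<eta> \<xi>)"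
  have sum1: "((\<lambda>\<kappa>. complex_of_real (?a \<kappa>)) has_sum
      (G j (cvec (\<eta> \<xi>)) - of_real (C j * (Xf \<xi> + Wf \<xi>)))) UNIV"
    using Maclaurin[of j \<xi>] by (simp only: \<eta>_def Wf_def)
  then have "(\<lambda>\<kappa>. cmod (complex_of_real (?a \<kappa>))) summable_on UNIV"
    by (intro has_sum_imp_summable[THEN summable_on_iff_abs_summable_on_complex[THEN iffD1]])
  then obtain D where D: "((\<lambda>\<kappa>. cmod (complex_of_real (?a \<kappa>))) has_sum D) UNIV"
    by (auto simp: summable_on_def)
  show ?thesis
  proof (intro exI[of _ D] allI impI)
    fix s :: real assume s: "0 < s" "s \<le> 1"
    have \<eta>s: "mat_powi B j *v (s *\<^sub>R \<xi>) = s *\<^sub>R \<eta> \<xi>"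
      by (simp add: \<eta>_def matrix_vector_mult_scaleR)
    have W: "poly_at (W_poly Q) (s *\<^sub>R \<xi>) ^ m = s ^ (2 * m) * Wf \<xi>"
      by (simp add: poly_at_scale[OF W_poly_homog] Wf_def power_mult_distrib power_mult)
    have "((\<lambda>\<kappa>. complex_of_real (R j \<kappa> * (s ^ mdeg \<kappa> * mono_at \<kappa> (\<eta> \<xi>)))) has_sum
        (G j (cvec (s *\<^sub>R \<eta> \<xi>)) - of_real (C j * (s ^ k * Xf \<xi> + s ^ (2 * m) * Wf \<xi>)))) UNIV"
      using Maclaurin[of j "s *\<^sub>R \<xi>"] unfolding \<eta>s W poly_at_scale[OF X] mono_at_scale .
    moreover have "((\<lambda>\<kappa>. s ^ Suc (2 * m) * cmod (complex_of_real (?a \<kappa>))) has_sum (s ^ Suc (2 * m) * D)) UNIV"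
      by (rule has_sum_cmult_right[OF D])
    ultimately have "cmod (G j (cvec (s *\<^sub>R \<eta> \<xi>)) - of_real (C j * (s ^ k * Xf \<xi> + s ^ (2 * m) * Wf \<xi>))) \<le> s ^ Suc (2 * m) * D"
    proof (rule norm_infsum_le)
      fix \<kappa>
      show "cmod (complex_of_real (R j \<kappa> * (s ^ mdeg \<kappa> * mono_at \<kappa> (\<eta> \<xi>)))) \<le> s ^ Suc (2 * m) * cmod (complex_of_real (?a \<kappa>))"
      proof (cases "R j \<kappa> = 0")
        case False
        have "enat (2 * m) < (INF \<kappa>\<in>{\<kappa>. R j \<kappa> \<noteq> 0}. enat (mdeg \<kappa>))"
          using R[of j] by (simp add: series_order_def)
        also have "\<dots> \<le> enat (mdeg \<kappa>)"
          using False by (intro INF_lower) simp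
        finally have "2 * m < mdeg \<kappa>"
          by simp
        then have "s ^ mdeg \<kappa> \<le> s ^ Suc (2 * m)"
          using s by (intro power_decreasing) auto
        then have "s ^ mdeg \<kappa> * \<bar>?a \<kappa>\<bar> \<le> s ^ Suc (2 * m) * \<bar>?a \<kappa>\<bar>"
          by (rule mult_right_mono) simp
        then show ?thesis
          using s by (simp add: abs_mult norm_mult norm_power mult_ac)
      qed simp
    qed
    moreover have "(\<Sum>n<Suc (2 * m). of_real (C j) * (if n = k then complex_of_real (Xf \<xi>) else if n = 2 * m then of_real (Wf \<xi>) else 0) * of_real s ^ n)
       = of_real (C j * (s ^ k * Xf \<xi> + s ^ (2 * m) * Wf \<xi>))"
    proof -
      have "(\<Sum>n<Suc (2 * m). of_real (C j) * (if n = k then complex_of_real (Xf \<xi>) else if n = 2 * m then of_real (Wf \<xi>) else 0) * of_real s ^ n)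
         = (\<Sum>n<Suc (2 * m). (if n = k then of_real (C j) * of_real (Xf \<xi>) * of_real s ^ n else 0)
             + (if n = 2 * m then of_real (C j) * of_real (Wf \<xi>) * of_real s ^ n else 0))"
        using k by (intro sum.cong) auto
      also have "\<dots> = of_real (C j) * of_real (Xf \<xi>) * of_real s ^ k + of_real (C j) * of_real (Wf \<xi>) * of_real s ^ (2 * m)"
        using k by (simp add: sum.distrib del: sum.lessThan_Suc)
      finally show ?thesis
        by (simp add: algebra_simps)
    qed
    ultimately show "cmod (G j (of_real s *s cvec (\<eta> \<xi>)) -
      (\<Sum>n<Suc (2 * m). of_real (C j) * (if n = k then of_real (Xf \<xi>) else if n = 2 * m then of_real (Wf \<xi>) else 0) * of_real s ^ n))
    \<le> D * s ^ Suc (2 * m)"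
      by (simp only: cvec_scale mult.commute)
  qed
qed

text \<open>For \<open>l \<noteq> 0\<close> one of the factors of the infinite product carries, near \<open>- 2 \<pi> l\<close>, the
  polynomial \<open>X + W ^ m\<close>.\<close>

lemma partial_factor:
  assumes "l \<noteq> 0"
  shows "\<exists>j0 h. (\<forall>N. exp_sum (h N)) \<and> (\<forall>N \<zeta>. partial (N + j0) (\<zeta> + cvec (- ((2 * pi) *\<^sub>R ivec l)))
     = G (int j0) (cmat (Bpow j0) *v \<zeta>) * h N \<zeta>)"
proof -
  obtain p l' where p: "Bpow p *v ivec l = ivec l'" and l': "\<And>n. ivec l' \<noteq> M *v ivec n"
    by (rule eventually_not_divisible[OF assms]) blast
  obtain s0 n where s0: "s0 \<in> S - {0}" and n: "B *v ivec l' = s0 + ivec n"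
    by (rule digit_complement[OF l']) blast
  \<comment> \<open>After \<open>p\<close> divisions \<open>l\<close> is still integral but not
    divisible by \<open>M\<close>, so one more division leaves a nonzero digit \<open>s0\<close>
    modulo integer vectors.\<close>
  define j0 where "j0 = Suc p"
  let ?w = "- ((2 * pi) *\<^sub>R ivec l) :: real ^ 'n"
  have "Bpow j0 *v ivec l = s0 + ivec n"
    by (simp add: j0_def Bpow_Suc_vec p n)
  then have w: "Bpow j0 *v ?w = - ((2 * pi) *\<^sub>R s0) + (2 * pi) *\<^sub>R ivec (- n)"
    by (simp add: linear_neg[OF matrix_vector_mul_linear] matrix_vector_mult_scaleR ivec_minus scaleR_add_right)
  define den where "den = (\<Prod>s\<in>S - {0}. G (int j0) (cvec ((2 * pi) *\<^sub>R s)))"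
  define h0 where "h0 \<zeta> = (\<Prod>s\<in>S - {0} - {s0}. G (int j0) (cmat (Bpow j0) *v \<zeta> + (cvec (Bpow j0 *v ?w) + cvec ((2 * pi) *\<^sub>R s)))) * inverse den" for \<zeta>
  define h where "h N \<zeta> = h0 \<zeta> * (\<Prod>j\<in>{1..N + j0} - {j0}. mask S (G (int j)) (cmat (Bpow j) *v \<zeta> + cvec (Bpow j *v ?w)))" for N \<zeta>
  have h_exp: "exp_sum (h N)" for N
    unfolding h_def[abs_def] h0_def
    by (intro exp_sum_mult exp_sum_prod exp_sum_const exp_sum_affine exp_sum_G exp_sum_mask)
  have split: "cmat (Bpow j) *v (\<zeta> + cvec ?w) = cmat (Bpow j) *v \<zeta> + cvec (Bpow j *v ?w)" for j \<zeta>
    by (simp only: matrix_vector_right_distrib cmat_cvec)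
  have f0: "mask S (G (int j0)) (cmat (Bpow j0) *v \<zeta> + cvec (Bpow j0 *v ?w)) = G (int j0) (cmat (Bpow j0) *v \<zeta>) * h0 \<zeta>" for \<zeta>
  proof -
    let ?f = "\<lambda>s. G (int j0) (cmat (Bpow j0) *v \<zeta> + (cvec (Bpow j0 *v ?w) + cvec ((2 * pi) *\<^sub>R s)))"
    \<comment> \<open>In the numerator factor of \<open>s0\<close> the two shifts cancel up to a
      period of \<open>G\<close>.\<close>
    have "cvec (Bpow j0 *v ?w) + cvec ((2 * pi) *\<^sub>R s0) = cvec ((2 * pi) *\<^sub>R ivec (- n))"
      unfolding w cvec_add[symmetric] by simp
    then have "?f s0 = G (int j0) (cmat (Bpow j0) *v \<zeta>)"
      using trig_poly_periodic[OF G] by simp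
    moreover have "(\<Prod>s\<in>S - {0}. ?f s) = ?f s0 * (\<Prod>s\<in>S - {0} - {s0}. ?f s)"
      using s0 finite_S by (intro prod.remove) auto
    ultimately show ?thesis
      unfolding mask_def den_def[symmetric] h0_def by (simp only: add.assoc divide_inverse mult.assoc)
  qed
  have "partial (N + j0) (\<zeta> + cvec ?w) = G (int j0) (cmat (Bpow j0) *v \<zeta>) * h N \<zeta>" for N \<zeta>
  proof -
    let ?F = "\<lambda>j. mask S (G (int j)) (cmat (Bpow j) *v \<zeta> + cvec (Bpow j *v ?w))"
    have "partial (N + j0) (\<zeta> + cvec ?w) = (\<Prod>j\<in>{1..N + j0}. ?F j)"
      unfolding partial_def split ..
    also have "\<dots> = ?F j0 * (\<Prod>j\<in>{1..N + j0} - {j0}. ?F j)"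
      by (rule prod.remove) (auto simp: j0_def)
    finally show ?thesis
      unfolding f0 h_def by (simp only: mult.assoc)
  qed
  then show ?thesis
    using h_exp by blast
qed

abbreviation "symX \<equiv> symb k (X_symb k Xf)"
abbreviation "symW \<equiv> symb (2 * m) (X_symb (2 * m) Wf)"

text \<open>The lists that represent the solution space. The bound \<open>2 * m\<close> is the order
  up to which the series of \<open>G\<close> is prescribed, and nonnegative exponents survive the
  conversion by \<open>nat\<close>.\<close>

definition valid :: "(complex \<times> int \<times> (real ^ 'n)) list \<Rightarrow> bool" where
  "valid L \<longleftrightarrow> (\<forall>p\<in>set L. fst p \<in> K \<and> 0 \<le> fst (snd p) \<and> fst (snd p) \<le> int (2 * m)) \<and>
     (\<forall>x. psum (symX L) x + psum (symW L) x = 0)"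

text \<open>Up to reflection and a constant, the left side is a combination of Taylor coefficients
  of the Fourier transform at \<open>- 2 \<pi> l\<close>. For a partial product the same combination
  is the mixed functional of the cofactor \<open>h N\<close>, times a constant, and so vanishes; the
  limit inherits this.\<close>

lemma vanishing_moments:
  assumes L: "valid L" and l: "l \<noteq> 0"
  shows "\<phi> (\<lambda>x. psum L (- x) * char l x) = 0"
proof -
  let ?w = "- ((2 * pi) *\<^sub>R ivec l) :: real ^ 'n"
  obtain j0 h where h: "\<forall>N. exp_sum (h N)" and ph: "\<forall>N \<zeta>. partial (N + j0) (\<zeta> + cvec ?w)
     = G (int j0) (cmat (Bpow j0) *v \<zeta>) * h N \<zeta>"
    using partial_factor[OF l] by (elim exE conjE)
  define GF where "GF \<xi> = fps_expansion (\<lambda>s. G (int j0) (s *s cvec (Bpow j0 *v \<xi>))) 0" for \<xi>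
  define H where "H N \<xi> = fps_expansion (\<lambda>s. h N (s *s cvec \<xi>)) 0" for N \<xi>
  have GF: "(\<lambda>s. G (int j0) (s *s cvec (Bpow j0 *v \<xi>))) has_fps_expansion GF \<xi>" for \<xi>
    unfolding GF_def using exp_sum_holomorphic[OF exp_sum_G, where \<xi> = "cvec (Bpow j0 *v \<xi>)" and \<eta> = 0]
    by (intro has_fps_expansion_fps_expansion[of UNIV]) auto
  have H: "(\<lambda>s. h N (s *s cvec \<xi>)) has_fps_expansion H N \<xi>" for N \<xi>
    unfolding H_def using exp_sum_holomorphic[of "h N", where \<xi> = "cvec \<xi>" and \<eta> = 0] h
    by (intro has_fps_expansion_fps_expansion[of UNIV]) auto
  \<comment> \<open>Up to order \<open>2 * m\<close> the series of \<open>G\<close> is a multiple of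
    \<open>X + W ^ m\<close>, and the exponents in \<open>L\<close> never ask for a higher
    order.\<close>
  have GFn: "fps_nth (GF \<xi>) n = of_real (C (int j0)) * (if n = k then of_real (Xf \<xi>) else if n = 2 * m then of_real (Wf \<xi>) else 0)"
    if "n \<le> 2 * m" for n \<xi>
  proof -
    obtain D where "\<forall>s>0. s \<le> 1 \<longrightarrow> cmod (G (int j0) (of_real s *s cvec (mat_powi B (int j0) *v \<xi>)) -
      (\<Sum>n<Suc (2 * m). of_real (C (int j0)) * (if n = k then of_real (Xf \<xi>) else if n = 2 * m then of_real (Wf \<xi>) else 0) * of_real s ^ n))
      \<le> D * s ^ Suc (2 * m)"
      using G_line_coeffs[of "int j0" \<xi>] by (elim exE)
    then show ?thesis
      using that by (intro fps_coeffs_of_asymptotics[OF GF, where M = "Suc (2 * m)" and C = D])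
        (simp_all add: Bpow_def del: sum.lessThan_Suc)
  qed
  have FN: "(\<lambda>s. partial (N + j0) (s *s cvec \<xi> + cvec ?w)) has_fps_expansion GF \<xi> * H N \<xi>" for N \<xi>
    using has_fps_expansion_mult[OF GF H, of \<xi> N \<xi>] ph by (simp add: cmat_scale cmat_cvec)
  have "\<exists>F. (\<lambda>s. fourier \<phi> (s *s cvec \<xi> + cvec ?w)) has_fps_expansion F \<and>
      (\<forall>n. (\<lambda>N. fps_nth (GF \<xi> * H N \<xi>) n) \<longlonglongrightarrow> fps_nth F n)" for \<xi>
    by (rule uniform_limit_fps_coeffs[OF partial_line_limit partial_line_holomorphic FN]) blast
  then have "\<forall>\<xi>. \<exists>F. (\<lambda>s. fourier \<phi> (s *s cvec \<xi> + cvec ?w)) has_fps_expansion F \<and>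
      (\<forall>n. (\<lambda>N. fps_nth (GF \<xi> * H N \<xi>) n) \<longlonglongrightarrow> fps_nth F n)"
    by blast
  from choice[OF this] obtain F where F: "\<forall>\<xi>. (\<lambda>s. fourier \<phi> (s *s cvec \<xi> + cvec ?w)) has_fps_expansion F \<xi> \<and>
      (\<forall>n. (\<lambda>N. fps_nth (GF \<xi> * H N \<xi>) n) \<longlonglongrightarrow> fps_nth (F \<xi>) n)"
    by (elim exE)
  let ?t = "\<lambda>F p. fst p * (- \<i>) ^ nat (fst (snd p)) * fps_nth (F (snd (snd p))) (nat (fst (snd p)))"
  have L': "0 \<le> fst (snd p)" "fst (snd p) \<le> int (2 * m)" if "p \<in> set L" for p
    using L that by (auto simp: valid_def)
  have zero: "(\<Sum>p\<leftarrow>L. ?t (\<lambda>\<xi>. GF \<xi> * H N \<xi>) p) = 0" for N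
  proof -
    have "(\<Sum>p\<leftarrow>L. ?t (\<lambda>\<xi>. GF \<xi> * H N \<xi>) p) = (\<Sum>p\<leftarrow>L. of_real (C (int j0)) * (fst p * (- \<i>) ^ nat (fst (snd p)) *
     (of_real (Xf (snd (snd p))) * fps_ext (H N (snd (snd p))) (fst (snd p) - int k) +
      of_real (Wf (snd (snd p))) * fps_ext (H N (snd (snd p))) (fst (snd p) - int (2 * m)))))"
    proof (intro arg_cong[of _ _ sum_list] map_cong refl)
      fix p assume p: "p \<in> set L"
      let ?\<xi> = "snd (snd p)" and ?n = "nat (fst (snd p))"
      have n: "int ?n = fst (snd p)" "?n \<le> 2 * m"
        using L'[OF p] by auto
      have "fps_nth (GF ?\<xi> * H N ?\<xi>) ?n = of_real (C (int j0)) *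
         (of_real (Xf ?\<xi>) * fps_ext (H N ?\<xi>) (int ?n - int k) + of_real (Wf ?\<xi>) * fps_ext (H N ?\<xi>) (int ?n - int (2 * m)))"
        by (rule fps_mult_two_terms[OF GFn k]) (use n(2) in simp)
      then show "?t (\<lambda>\<xi>. GF \<xi> * H N \<xi>) p = of_real (C (int j0)) * (fst p * (- \<i>) ^ nat (fst (snd p)) *
     (of_real (Xf (snd (snd p))) * fps_ext (H N (snd (snd p))) (fst (snd p) - int k) +
      of_real (Wf (snd (snd p))) * fps_ext (H N (snd (snd p))) (fst (snd p) - int (2 * m))))"
        unfolding n(1) by (simp only: mult_ac)
    qed
    also have "\<dots> = of_real (C (int j0)) * (\<Sum>p\<leftarrow>L. fst p * (- \<i>) ^ nat (fst (snd p)) *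
     (of_real (Xf (snd (snd p))) * fps_ext (H N (snd (snd p))) (fst (snd p) - int k) +
      of_real (Wf (snd (snd p))) * fps_ext (H N (snd (snd p))) (fst (snd p) - int (2 * m))))"
      by (simp only: sum_list_const_mult)
    also have "\<dots> = 0"
      by (subst mixed_functional_vanishes[OF _ _ h[rule_format] H]) (use L in \<open>auto simp: valid_def\<close>)
    finally show ?thesis .
  qed
  have "(\<lambda>N. \<Sum>p\<leftarrow>L. ?t (\<lambda>\<xi>. GF \<xi> * H N \<xi>) p) \<longlonglongrightarrow> (\<Sum>p\<leftarrow>L. ?t F p)"
    by (intro tendsto_sum_list tendsto_mult tendsto_const) (use F in blast)
  then have lim: "(\<Sum>p\<leftarrow>L. ?t F p) = 0"
    unfolding zero by (simp add: LIMSEQ_const_iff)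
  have ch: "exp (- \<i> * of_real (?w \<bullet> x)) = char l x" for x
    by (simp add: char_def mult_ac)
  have sm: "smooth (\<lambda>x. dp n (of_real (\<xi> \<bullet> x)) * char l x)" for n \<xi>
    using smooth_mult[OF smooth_dp smooth_exp_linear_form[of "- \<i>" ?w]] by (simp only: ch)
  have "0 = (\<Sum>p\<leftarrow>L. ?t F p)"
    by (simp only: lim)
  also have "\<dots> = (\<Sum>p\<leftarrow>L. \<phi>_norm * (fst p * (- 1) ^ nat (fst (snd p)) * \<phi> (\<lambda>x. dp (fst (snd p)) (of_real (snd (snd p) \<bullet> x)) * char l x)))"
  proof (intro arg_cong[of _ _ sum_list] map_cong refl)
    fix p assume p: "p \<in> set L"
    let ?n = "nat (fst (snd p))"
    have n: "int ?n = fst (snd p)"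
      using L'[OF p] by auto
    have e: "fps_nth (F (snd (snd p))) ?n = \<phi>_norm * ((- \<i>) ^ ?n * \<phi> (\<lambda>x. dp (fst (snd p)) (of_real (snd (snd p) \<bullet> x)) * char l x))"
      using fourier_line_coeffs[OF conjunct1[OF F[rule_format]], of "snd (snd p)" ?n] unfolding ch n .
    \<comment> \<open>One power of \<open>- \<i>\<close> comes from the functional and one from the
      Taylor coefficient; their product accounts for the reflected argument of
      \<open>psum L\<close>.\<close>
    have ii: "(- \<i>) ^ ?n * (- \<i>) ^ ?n = (- 1 :: complex) ^ ?n"
      by (simp add: power_mult_distrib[symmetric])
    have "a * i * (c * (i * f)) = c * (a * (i * i) * f)" for a i c f :: complex
      by (simp only: mult_ac)
    then show "?t F p = \<phi>_norm * (fst p * (- 1) ^ nat (fst (snd p)) * \<phi> (\<lambda>x. dp (fst (snd p)) (of_real (snd (snd p) \<bullet> x)) * char l x))"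
      unfolding e ii[symmetric] .
  qed
  also have "\<dots> = \<phi>_norm * (\<Sum>p\<leftarrow>L. \<phi> (\<lambda>x. (fst p * (- 1) ^ nat (fst (snd p))) * (dp (fst (snd p)) (of_real (snd (snd p) \<bullet> x)) * char l x)))"
    by (simp only: sum_list_const_mult phi_cmult[OF sm])
  also have "\<dots> = \<phi>_norm * \<phi> (\<lambda>x. \<Sum>p\<leftarrow>L. (fst p * (- 1) ^ nat (fst (snd p))) * (dp (fst (snd p)) (of_real (snd (snd p) \<bullet> x)) * char l x))"
    by (subst phi_sum_list) (intro smooth_mult[OF smooth_const sm], rule refl)
  also have "(\<lambda>x. \<Sum>p\<leftarrow>L. (fst p * (- 1) ^ nat (fst (snd p))) * (dp (fst (snd p)) (of_real (snd (snd p) \<bullet> x)) * char l x)) =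
      (\<lambda>x. psum L (- x) * char l x)"
  proof
    fix x :: "real ^ 'n"
    have neg: "dp n (of_real (\<xi> \<bullet> (- x))) = (- 1) ^ nat n * dp n (of_real (\<xi> \<bullet> x))" for n \<xi>
      using dp_scale[of n "-1" "of_real (\<xi> \<bullet> x)"] by simp
    show "(\<Sum>p\<leftarrow>L. (fst p * (- 1) ^ nat (fst (snd p))) * (dp (fst (snd p)) (of_real (snd (snd p) \<bullet> x)) * char l x)) =
        psum L (- x) * char l x"
      unfolding psum_eq sum_list_mult_const[symmetric] neg by (simp only: mult_ac)
  qed
  finally show ?thesis
    using \<phi>_norm_nonzero by simp
qed

end

section \<open>Reproduction\<close>

text \<open>Products of the weights from \<open>moment_weights\<close>, one family for each
  coordinate, extract a single coefficient from the values on an integer grid.\<close>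

lemma poly_at_nonzero:
  fixes P :: "(nat ^ 'n) \<Rightarrow>\<^sub>0 real"
  assumes "P \<noteq> 0"
  obtains \<xi> where "poly_at P \<xi> \<noteq> 0"
proof -
  have "\<exists>\<xi>. poly_at P \<xi> \<noteq> 0"
  proof (rule ccontr)
    assume "\<not> ?thesis"
    then have zero: "poly_at P \<xi> = 0" for \<xi>
      by blast
    obtain \<alpha> where \<alpha>: "\<alpha> \<in> Poly_Mapping.keys P"
      using assms by (metis ex_in_conv keys_eq_empty)
    \<comment> \<open>A common bound for all exponents that occur in \<open>P\<close>.\<close>
    define D where "D = (\<Sum>\<beta>\<in>Poly_Mapping.keys P. mdeg \<beta>)"
    have D: "\<beta> $ i \<le> D" if "\<beta> \<in> Poly_Mapping.keys P" for \<beta> i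
    proof -
      have "\<beta> $ i \<le> mdeg \<beta>"
        unfolding mdeg_def by (rule member_le_sum) auto
      also have "\<dots> \<le> D"
        unfolding D_def using that by (intro member_le_sum) auto
      finally show ?thesis .
    qed
    have "\<forall>i. \<exists>w :: nat \<Rightarrow> complex. \<forall>e\<le>D. (\<Sum>s\<le>D. w s * of_nat s ^ e) = (if e = \<alpha> $ i then 1 else 0)"
    proof
      fix i
      obtain w :: "nat \<Rightarrow> complex" where "\<And>e. e \<le> D \<Longrightarrow> (\<Sum>s\<le>D. w s * of_nat s ^ e) = (if e = \<alpha> $ i then 1 else 0)"
        using moment_weights[OF D[OF \<alpha>, of i]] by metis
      then show "\<exists>w :: nat \<Rightarrow> complex. \<forall>e\<le>D. (\<Sum>s\<le>D. w s * of_nat s ^ e) = (if e = \<alpha> $ i then 1 else 0)"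
        by blast
    qed
    from choice[OF this] obtain w :: "'n \<Rightarrow> nat \<Rightarrow> complex"
      where w: "\<forall>i. \<forall>e\<le>D. (\<Sum>s\<le>D. w i s * of_nat s ^ e) = (if e = \<alpha> $ i then 1 else 0)"
      by (elim exE)
    let ?J = "PiE (UNIV :: 'n set) (\<lambda>_. {..D})"
    have pick: "(\<Sum>j\<in>?J. (\<Prod>i\<in>UNIV. w i (j i)) * of_real (mono_at \<beta> (\<chi> i. real (j i)))) = (if \<beta> = \<alpha> then 1 else 0)"
      if \<beta>: "\<beta> \<in> Poly_Mapping.keys P" for \<beta>
    proof -
      have "(\<Sum>j\<in>?J. (\<Prod>i\<in>UNIV. w i (j i)) * of_real (mono_at \<beta> (\<chi> i. real (j i)))) =
          (\<Sum>j\<in>?J. \<Prod>i\<in>UNIV. w i (j i) * of_nat (j i) ^ (\<beta> $ i))"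
        by (simp add: mono_at_def prod.distrib)
      also have "\<dots> = (\<Prod>i\<in>UNIV. \<Sum>s\<le>D. w i s * of_nat s ^ (\<beta> $ i))"
        by (rule prod_sum_PiE[symmetric]) auto
      also have "\<dots> = (\<Prod>i\<in>UNIV. if \<beta> $ i = \<alpha> $ i then 1 else 0)"
        using w D[OF \<beta>] by (intro prod.cong) auto
      also have "\<dots> = (if \<beta> = \<alpha> then 1 else 0)"
        by (auto simp: vec_eq_iff)
      finally show ?thesis .
    qed
    have "0 = (\<Sum>j\<in>?J. (\<Prod>i\<in>UNIV. w i (j i)) * of_real (poly_at P (\<chi> i. real (j i))))"
      by (simp add: zero)
    also have "\<dots> = (\<Sum>j\<in>?J. \<Sum>\<beta>\<in>Poly_Mapping.keys P. of_real (Poly_Mapping.lookup P \<beta>) *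
        ((\<Prod>i\<in>UNIV. w i (j i)) * of_real (mono_at \<beta> (\<chi> i. real (j i)))))"
      by (simp add: poly_at_def sum_distrib_left mult_ac)
    also have "\<dots> = (\<Sum>\<beta>\<in>Poly_Mapping.keys P. of_real (Poly_Mapping.lookup P \<beta>) *
        (\<Sum>j\<in>?J. (\<Prod>i\<in>UNIV. w i (j i)) * of_real (mono_at \<beta> (\<chi> i. real (j i)))))"
      by (subst sum.swap) (simp add: sum_distrib_left)
    also have "\<dots> = (\<Sum>\<beta>\<in>Poly_Mapping.keys P. if \<beta> = \<alpha> then complex_of_real (Poly_Mapping.lookup P \<beta>) else 0)"
      by (intro sum.cong refl) (simp add: pick)
    also have "\<dots> = of_real (Poly_Mapping.lookup P \<alpha>)"
      using \<alpha> by simp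
    finally show False
      using \<alpha> by (simp add: in_keys_iff)
  qed
  then show ?thesis
    using that by blast
qed

section \<open>Translation and convolution as operators on lists\<close>

text \<open>A series of operators whose term of index \<open>a\<close> has order \<open>a\<close>;
  translation and convolution are both of this form. The cut at the exponent drops only terms that
  evaluate to 0 and keeps nonnegative exponents nonnegative.\<close>

definition coeff_op :: "nat \<Rightarrow> (nat \<Rightarrow> real ^ 'n \<Rightarrow> complex) \<Rightarrow> (complex \<times> int \<times> (real ^ 'n)) list
    \<Rightarrow> (complex \<times> int \<times> (real ^ 'n)) list" where
  "coeff_op lo \<mu> L = concat (map (\<lambda>p. map (\<lambda>a. (fst p * \<mu> a (snd (snd p)), fst (snd p) - int a, snd (snd p)))
     [lo..<Suc (nat (fst (snd p)))]) L)"

lemma psum_symb_coeff_op: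
  "psum (symb k Y (coeff_op lo \<mu> L)) x = (\<Sum>p\<leftarrow>L. Y (snd (snd p)) * fst p *
     (\<Sum>a\<in>{lo..<Suc (nat (fst (snd p)))}. \<mu> a (snd (snd p)) * dp (fst (snd p) - int a - int k) (of_real (snd (snd p) \<bullet> x))))"
proof (induction L)
  case Nil
  then show ?case
    by (simp add: coeff_op_def symb_def)
next
  case (Cons p L)
  let ?l = "map (\<lambda>a. (fst p * \<mu> a (snd (snd p)), fst (snd p) - int a, snd (snd p))) [lo..<Suc (nat (fst (snd p)))]"
  have "coeff_op lo \<mu> (p # L) = ?l @ coeff_op lo \<mu> L"
    by (simp add: coeff_op_def)
  then have "psum (symb k Y (coeff_op lo \<mu> (p # L))) x = psum (symb k Y ?l) x + psum (symb k Y (coeff_op lo \<mu> L)) x"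
    by (simp only: symb_def map_append psum_append)
  moreover have "psum (symb k Y ?l) x = (\<Sum>a\<leftarrow>[lo..<Suc (nat (fst (snd p)))]. Y (snd (snd p)) * fst p * (\<mu> a (snd (snd p)) *
      dp (fst (snd p) - int a - int k) (of_real (snd (snd p) \<bullet> x))))"
    by (simp add: psum_symb o_def mult.assoc del: upt_Suc)
  ultimately show ?case
    by (simp only: Cons.IH interv_sum_list_conv_sum_set_nat sum_distrib_left list.map sum_list.Cons set_upt)
qed

lemma symb_trivial: "symb 0 (\<lambda>_. 1) L = L"
  by (simp add: symb_def)

lemma psum_symb_append: "psum (symb k Y (L @ L')) x = psum (symb k Y L) x + psum (symb k Y L') x"
  by (simp add: symb_def psum_append)

lemma psum_symb_cmult: "psum (symb k Y (map (\<lambda>(b, n, \<xi>). (c * b, n, \<xi>)) L)) x = c * psum (symb k Y L) x"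
  by (simp add: psum_symb o_def split_beta sum_list_const_mult[symmetric] mult_ac)

lemma smooth_char: "smooth (\<lambda>x. char l x)"
  unfolding char_def by (rule smooth_exp_linear_form)

lemma sum_upto_nat: "(\<Sum>a\<in>{0..<Suc n}. f a) = (\<Sum>a\<le>n. f a)"
  by (simp only: lessThan_atLeast0[symmetric] lessThan_Suc_atMost)

definition shift_op :: "real ^ 'n \<Rightarrow> (complex \<times> int \<times> (real ^ 'n)) list \<Rightarrow> (complex \<times> int \<times> (real ^ 'n)) list" where
  "shift_op h L = coeff_op 0 (\<lambda>a \<xi>. dp (int a) (of_real (\<xi> \<bullet> h))) L"

text \<open>Taylor's formula. An arbitrary symbol is allowed so that translation is seen to commute
  with both operators of the mixed equation; the trivial symbol gives the formula for the polynomial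
  itself.\<close>

lemma psum_symb_shift_op:
  fixes h x :: "real ^ 'n"
  shows "psum (symb k Y (shift_op h L)) x = psum (symb k Y L) (x + h)"
  unfolding shift_op_def psum_symb_coeff_op psum_symb[of k Y L]
proof (intro arg_cong[of _ _ sum_list] map_cong refl)
  fix p :: "complex \<times> int \<times> (real ^ 'n)"
  let ?\<xi> = "snd (snd p)" and ?n = "fst (snd p)"
  have "dp (?n - int k) (of_real (?\<xi> \<bullet> (x + h))) =
      (\<Sum>a\<le>nat ?n. dp (int a) (of_real (?\<xi> \<bullet> h)) * dp (?n - int k - int a) (of_real (?\<xi> \<bullet> x)))"
    using dp_add[of "?n - int k" "nat ?n" "of_real (?\<xi> \<bullet> h)" "of_real (?\<xi> \<bullet> x)"]
    by (simp add: inner_add_right add.commute)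
  moreover have "?n - int a - int k = ?n - int k - int a" for a
    by simp
  ultimately show "Y ?\<xi> * fst p * (\<Sum>a\<in>{0..<Suc (nat ?n)}. dp (int a) (of_real (?\<xi> \<bullet> h)) *
      dp (?n - int a - int k) (of_real (?\<xi> \<bullet> x))) = Y ?\<xi> * fst p * dp (?n - int k) (of_real (?\<xi> \<bullet> (x + h)))"
    by (simp only: sum_upto_nat)
qed

context elliptic
begin

text \<open>In particular \<open>symX\<close> yields the same polynomial for any two lists of the
  same function; non-invariance under scaling rests on this and on \<open>diff_op_W\<close>.\<close>

lemma diff_op_X: "diff_op X (psum L) = psum (symX L)"
  unfolding diff_op_psum[OF X] symb_def X_symb_def
  by (rule arg_cong[of _ _ psum], rule map_cong) auto

lemma diff_op_W: "(diff_op (W_poly Q) ^^ m) (psum L) = psum (symW L)"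
proof -
  have eq: "((- \<i>)\<^sup>2 * complex_of_real (poly_at (W_poly Q) \<xi>)) ^ m = X_symb (2 * m) Wf \<xi>" for \<xi>
    by (simp only: X_symb_def Wf_def power_mult_distrib power_mult of_real_power)
  show ?thesis
    unfolding diff_op_funpow_psum[OF W_poly_homog] symb_def eq
    by (rule arg_cong[of _ _ psum], rule map_cong) (auto simp: mult.commute[of m])
qed

lemma validI:
  "(\<And>p. p \<in> set L \<Longrightarrow> fst p \<in> K \<and> 0 \<le> fst (snd p) \<and> fst (snd p) \<le> int (2 * m)) \<Longrightarrow>
   (\<And>x. psum (symX L) x + psum (symW L) x = 0) \<Longrightarrow> valid L"
  by (simp add: valid_def)

lemma validD:
  assumes "valid L"
  shows "p \<in> set L \<Longrightarrow> fst p \<in> K" "p \<in> set L \<Longrightarrow> 0 \<le> fst (snd p)" "p \<in> set L \<Longrightarrow> fst (snd p) \<le> int (2 * m)"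
    "psum (symX L) x + psum (symW L) x = 0"
  using assms by (simp_all add: valid_def)

lemma K_mult: "a \<in> K \<Longrightarrow> b \<in> K \<Longrightarrow> a * b \<in> K"
  using K by auto

lemma dp_in_K: "dp n (of_real r) \<in> K"
  using K by (auto simp: dp_def intro!: Reals_divide Reals_power fact_in_Reals)

lemma set_coeff_op:
  assumes "p \<in> set (coeff_op lo \<mu> L)"
  obtains p' a where "p' \<in> set L" "lo \<le> a" "a < Suc (nat (fst (snd p')))"
    "p = (fst p' * \<mu> a (snd (snd p')), fst (snd p') - int a, snd (snd p'))"
  using assms by (auto simp: coeff_op_def simp del: upt_Suc)

lemma valid_coeff_op:
  assumes L: "valid L" and \<mu>: "\<And>a \<xi>. \<mu> a \<xi> \<in> K"
    and eq: "\<And>x. psum (symX (coeff_op lo \<mu> L)) x + psum (symW (coeff_op lo \<mu> L)) x = 0"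
  shows "valid (coeff_op lo \<mu> L)"
proof (rule validI[OF _ eq])
  fix p assume "p \<in> set (coeff_op lo \<mu> L)"
  then obtain p' a where p': "p' \<in> set L" "a < Suc (nat (fst (snd p')))"
    "p = (fst p' * \<mu> a (snd (snd p')), fst (snd p') - int a, snd (snd p'))"
    by (rule set_coeff_op) blast
  show "fst p \<in> K \<and> 0 \<le> fst (snd p) \<and> fst (snd p) \<le> int (2 * m)"
    using p'(2) validD(1-3)[OF L p'(1)] by (auto simp: p'(3) intro!: K_mult \<mu>)
qed

lemma valid_shift_op:
  assumes "valid L"
  shows "valid (shift_op h L)"
proof -
  have "psum (symX (shift_op h L)) x + psum (symW (shift_op h L)) x = 0" for x
    unfolding psum_symb_shift_op by (rule validD(4)[OF assms])
  then show ?thesis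
    unfolding shift_op_def by (intro valid_coeff_op assms dp_in_K)
qed

lemma valid_append:
  assumes L: "valid L" and L': "valid L'"
  shows "valid (L @ L')"
proof (rule validI)
  fix x
  have "psum (symX (L @ L')) x + psum (symW (L @ L')) x =
      (psum (symX L) x + psum (symW L) x) + (psum (symX L') x + psum (symW L') x)"
    unfolding psum_symb_append by (simp only: ac_simps)
  then show "psum (symX (L @ L')) x + psum (symW (L @ L')) x = 0"
    unfolding validD(4)[OF L] validD(4)[OF L'] by simp
next
  fix p assume "p \<in> set (L @ L')"
  then have "p \<in> set L \<or> p \<in> set L'"
    by simp
  then show "fst p \<in> K \<and> 0 \<le> fst (snd p) \<and> fst (snd p) \<le> int (2 * m)"
  proof
    assume "p \<in> set L"
    then show ?thesis
      by (intro conjI validD(1-3)[OF L])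
  next
    assume "p \<in> set L'"
    then show ?thesis
      by (intro conjI validD(1-3)[OF L'])
  qed
qed

lemma valid_cmult:
  assumes "valid L" "c \<in> K"
  shows "valid (map (\<lambda>(b, n, \<xi>). (c * b, n, \<xi>)) L)"
proof (rule validI)
  fix x
  show "psum (symX (map (\<lambda>(b, n, \<xi>). (c * b, n, \<xi>)) L)) x + psum (symW (map (\<lambda>(b, n, \<xi>). (c * b, n, \<xi>)) L)) x = 0"
    unfolding psum_symb_cmult distrib_left[symmetric] validD(4)[OF assms(1)] by simp
next
  fix p assume "p \<in> set (map (\<lambda>(b, n, \<xi>). (c * b, n, \<xi>)) L)"
  then obtain p' where p': "p' \<in> set L" "p = (c * fst p', snd p')"
    by auto
  show "fst p \<in> K \<and> 0 \<le> fst (snd p) \<and> fst (snd p) \<le> int (2 * m)"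
    using validD(1-3)[OF assms(1) p'(1)] assms(2) by (auto simp: p'(2) intro!: K_mult)
qed

lemma valid_Nil: "valid []"
  by (rule validI) (simp_all add: symb_def)

section \<open>Real scalars: real moments and parity of the degree\<close>

text \<open>Conjugation reflects the argument of every factor and so replaces \<open>s\<close> by
  \<open>- s\<close>, which is another nonzero digit up to a period of \<open>G\<close>;
  \<open>digit_negation\<close> reindexes the product.\<close>

lemma mask_conj:
  assumes "K = \<real>"
  shows "cnj (mask S (G j) (cvec y)) = mask S (G j) (cvec (- y))"
proof -
  obtain \<sigma> where \<sigma>: "bij_betw \<sigma> (S - {0}) (S - {0})" "\<And>s. s \<in> S - {0} \<Longrightarrow> \<exists>n. - s = \<sigma> s + ivec n"
    by (rule digit_negation) blast
  have tp: "trig_poly \<real> (G j)"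
    using G[of j] assms by simp
  have num: "cnj (\<Prod>s\<in>S - {0}. G j (cvec (y + (2 * pi) *\<^sub>R s))) = (\<Prod>s\<in>S - {0}. G j (cvec (- y + (2 * pi) *\<^sub>R s)))" for y
  proof -
    have "cnj (\<Prod>s\<in>S - {0}. G j (cvec (y + (2 * pi) *\<^sub>R s))) = (\<Prod>s\<in>S - {0}. G j (cvec (- y + (2 * pi) *\<^sub>R \<sigma> s)))"
      unfolding cnj_prod
    proof (rule prod.cong[OF refl])
      fix s assume "s \<in> S - {0}"
      then obtain n where n: "- s = \<sigma> s + ivec n"
        using \<sigma>(2) by blast
      have "- (y + (2 * pi) *\<^sub>R s) = (- y + (2 * pi) *\<^sub>R \<sigma> s) + (2 * pi) *\<^sub>R ivec n"
        using arg_cong[OF n, of "\<lambda>v. (2 * pi) *\<^sub>R v"] by (simp add: scaleR_add_right)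
      then have "G j (cvec (- (y + (2 * pi) *\<^sub>R s))) = G j (cvec (- y + (2 * pi) *\<^sub>R \<sigma> s) + cvec ((2 * pi) *\<^sub>R ivec n))"
        by (simp only: cvec_add)
      also have "\<dots> = G j (cvec (- y + (2 * pi) *\<^sub>R \<sigma> s))"
        by (rule trig_poly_periodic[OF G])
      finally show "cnj (G j (cvec (y + (2 * pi) *\<^sub>R s))) = G j (cvec (- y + (2 * pi) *\<^sub>R \<sigma> s))"
        by (simp only: trig_poly_conj[OF tp])
    qed
    also have "\<dots> = (\<Prod>s\<in>S - {0}. G j (cvec (- y + (2 * pi) *\<^sub>R s)))"
      by (rule prod.reindex_bij_betw[OF \<sigma>(1)])
    finally show ?thesis .
  qed
  show ?thesis
    unfolding mask_def cvec_add[symmetric] complex_cnj_divide num using num[of 0] by simp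
qed

lemma fourier_conj:
  assumes "K = \<real>"
  shows "cnj (fourier \<phi> (cvec x)) = fourier \<phi> (cvec (- x))"
proof -
  have p: "cnj (partial N (cvec x)) = partial N (cvec (- x))" for N
    by (simp add: partial_def cmat_cvec mask_conj[OF assms] linear_neg[OF matrix_vector_mul_linear])
  have lim: "(\<lambda>N. partial N z) \<longlonglongrightarrow> fourier \<phi> z" for z
    by (rule tendsto_uniform_limitI[OF partial_limit[of "{z}"]]) auto
  have "(\<lambda>N. cnj (partial N (cvec x))) \<longlonglongrightarrow> cnj (fourier \<phi> (cvec x))"
    by (intro tendsto_cnj lim)
  then show ?thesis
    unfolding p using lim LIMSEQ_unique by blast
qed

text \<open>For real scalars, computing a Taylor coefficient along \<open>- \<xi>\<close> both
  directly and through \<open>fourier_conj\<close> shows that the moment equals its own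
  conjugate.\<close>

lemma phi_dp_in_K: "\<phi> (\<lambda>x. dp n (of_real (\<xi> \<bullet> x))) \<in> K"
proof (cases "K = UNIV \<or> n < 0")
  case True
  then show ?thesis
    using K by auto
next
  case False
  then have KR: "K = \<real>"
    using K by blast
  obtain a where n: "n = int a"
    using False by (metis nonneg_int_cases not_less)
  let ?d = "\<lambda>\<xi> n. \<phi> (\<lambda>x. dp (int n) (of_real (\<xi> \<bullet> x)))"
  let ?c = "\<lambda>\<xi> n. \<phi>_norm * ((- \<i>) ^ n * ?d \<xi> n)"
  obtain F where F: "(\<lambda>s. fourier \<phi> (s *s cvec (- \<xi>) + cvec 0)) has_fps_expansion F"
    using fourier_line_expansion by blast
  obtain D where D: "\<forall>s>0. s \<le> 1 \<longrightarrow> cmod (fourier \<phi> (of_real s *s cvec \<xi> + cvec 0) -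
      (\<Sum>n<Suc a. ?c \<xi> n * of_real s ^ n)) \<le> D * s ^ Suc a"
    using fourier_line_asymptotics[of \<xi> 0 "Suc a"] by (simp del: sum.lessThan_Suc) (elim exE)
  have "fps_nth F a = cnj (?c \<xi> a)"
  proof (rule fps_coeffs_of_asymptotics[OF F, where M = "Suc a" and c = "\<lambda>n. cnj (?c \<xi> n)" and C = D])
    fix s :: real assume s: "0 < s" "s \<le> 1"
    have "fourier \<phi> (of_real s *s cvec (- \<xi>) + cvec 0) = cnj (fourier \<phi> (of_real s *s cvec \<xi> + cvec 0))"
      by (simp add: cvec_scale fourier_conj[OF KR])
    then have "fourier \<phi> (of_real s *s cvec (- \<xi>) + cvec 0) - (\<Sum>n<Suc a. cnj (?c \<xi> n) * of_real s ^ n)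
      = cnj (fourier \<phi> (of_real s *s cvec \<xi> + cvec 0) - (\<Sum>n<Suc a. ?c \<xi> n * of_real s ^ n))"
      by (simp only: complex_cnj_diff cnj_sum complex_cnj_mult complex_cnj_power complex_cnj_complex_of_real)
    then show "cmod (fourier \<phi> (of_real s *s cvec (- \<xi>) + cvec 0) - (\<Sum>n<Suc a. cnj (?c \<xi> n) * of_real s ^ n)) \<le> D * s ^ Suc a"
      using D s by (simp only: complex_mod_cnj)
  qed simp
  moreover have "fps_nth F a = ?c (- \<xi>) a"
    using fourier_line_coeffs[OF F, of a] by simp
  moreover have "?d (- \<xi>) a = (- 1) ^ a * ?d \<xi> a"
  proof -
    have "(\<lambda>x. dp (int a) (complex_of_real ((- \<xi>) \<bullet> x))) = (\<lambda>x. (- 1) ^ a * dp (int a) (of_real (\<xi> \<bullet> x)))"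
      using dp_scale[of "int a" "-1"] by simp
    then show ?thesis
      by (simp only: phi_cmult[OF smooth_dp])
  qed
  moreover have "cnj \<phi>_norm = \<phi>_norm"
    by (simp add: \<phi>_norm_def)
  ultimately have "\<phi>_norm * (((- \<i>) ^ a * (- 1) ^ a) * ?d \<xi> a) = \<phi>_norm * (\<i> ^ a * cnj (?d \<xi> a))"
    by (simp add: mult.assoc)
  moreover have "(- \<i>) ^ a * (- 1) ^ a = \<i> ^ a"
    by (simp add: power_mult_distrib[symmetric])
  ultimately have "?d \<xi> a = cnj (?d \<xi> a)"
    using \<phi>_norm_nonzero by simp
  then show ?thesis
    unfolding KR n by (metis Reals_cnj_iff)
qed

text \<open>With real coefficients, reflection of a real argument conjugates \<open>G\<close>, but
  the term \<open>C 0 * X\<close> of order \<open>k\<close> is real there. So \<open>X\<close> is an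
  even function. This makes the factor \<open>(- \<i>) ^ k\<close> real.\<close>

lemma even_k:
  assumes KR: "K = \<real>" and \<xi>: "Xf \<xi> \<noteq> 0"
  shows "even k"
proof -
  let ?c = "\<lambda>\<xi> n. complex_of_real (C 0) * (if n = k then of_real (Xf \<xi>) else if n = 2 * m then of_real (Wf \<xi>) else 0)"
  have B0: "mat_powi B 0 *v \<xi> = \<xi>" for \<xi>
    by (simp add: mat_powi_def)
  have as: "\<exists>D. \<forall>s>0. s \<le> 1 \<longrightarrow> cmod (G 0 (of_real s *s cvec \<xi>) - (\<Sum>n<Suc (2 * m). ?c \<xi> n * of_real s ^ n)) \<le> D * s ^ Suc (2 * m)" for \<xi>
    using G_line_coeffs[of 0 \<xi>] unfolding B0 .
  define F where "F = fps_expansion (\<lambda>s. G 0 (s *s cvec (- \<xi>))) 0"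
  have F: "(\<lambda>s. G 0 (s *s cvec (- \<xi>))) has_fps_expansion F"
    unfolding F_def using exp_sum_holomorphic[OF exp_sum_G, where \<xi> = "cvec (- \<xi>)" and \<eta> = 0]
    by (intro has_fps_expansion_fps_expansion[of UNIV]) auto
  obtain D where D: "\<forall>s>0. s \<le> 1 \<longrightarrow> cmod (G 0 (of_real s *s cvec (- \<xi>)) - (\<Sum>n<Suc (2 * m). ?c (- \<xi>) n * of_real s ^ n)) \<le> D * s ^ Suc (2 * m)"
    using as by blast
  have 1: "fps_nth F k = ?c (- \<xi>) k"
    by (rule fps_coeffs_of_asymptotics[OF F, where M = "Suc (2 * m)" and C = D and c = "?c (- \<xi>)"]) (use D k in \<open>simp_all del: sum.lessThan_Suc\<close>)
  obtain D' where D': "\<forall>s>0. s \<le> 1 \<longrightarrow> cmod (G 0 (of_real s *s cvec \<xi>) - (\<Sum>n<Suc (2 * m). ?c \<xi> n * of_real s ^ n)) \<le> D' * s ^ Suc (2 * m)"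
    using as by blast
  have tp: "trig_poly \<real> (G 0)"
    using G[of 0] KR by simp
  have 2: "fps_nth F k = ?c \<xi> k"
  proof (rule fps_coeffs_of_asymptotics[OF F, where M = "Suc (2 * m)" and C = D' and c = "?c \<xi>"])
    fix s :: real assume s: "0 < s" "s \<le> 1"
    have "G 0 (of_real s *s cvec (- \<xi>)) = cnj (G 0 (of_real s *s cvec \<xi>))"
      by (simp add: cvec_scale trig_poly_conj[OF tp])
    moreover have "cnj (?c \<xi> n) = ?c \<xi> n" for n
      by simp
    ultimately have "G 0 (of_real s *s cvec (- \<xi>)) - (\<Sum>n<Suc (2 * m). ?c \<xi> n * of_real s ^ n) =
      cnj (G 0 (of_real s *s cvec \<xi>) - (\<Sum>n<Suc (2 * m). ?c \<xi> n * of_real s ^ n))"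
      by (simp only: complex_cnj_diff cnj_sum complex_cnj_mult complex_cnj_power complex_cnj_complex_of_real)
    then show "cmod (G 0 (of_real s *s cvec (- \<xi>)) - (\<Sum>n<Suc (2 * m). ?c \<xi> n * of_real s ^ n)) \<le> D' * s ^ Suc (2 * m)"
      using D' s by (simp only: complex_mod_cnj)
  qed (use k in simp)
  have "Xf (- \<xi>) = (- 1) ^ k * Xf \<xi>"
    using poly_at_scale[OF X, of "-1" \<xi>] by simp
  moreover have "Xf (- \<xi>) = Xf \<xi>"
    using 1 2 C[of 0] by simp
  ultimately have "(- 1 :: real) ^ k = 1"
    using \<xi> by simp
  then show ?thesis
    by (metis minus_one_power_iff one_neq_neg_one)
qed

section \<open>Convolution with the distribution on the solution space\<close>

text \<open>The reflected argument is that of \<open>P (x - z)\<close> as a function of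
  \<open>z\<close>, so these are the coefficients of convolution rather than correlation.\<close>

definition moment :: "nat \<Rightarrow> real ^ 'n \<Rightarrow> complex" where
  "moment a \<xi> = \<phi> (\<lambda>z. dp (int a) (of_real (\<xi> \<bullet> (- z))))"

lemma moment_in_K: "moment a \<xi> \<in> K"
  using phi_dp_in_K[of "int a" "- \<xi>"] by (simp add: moment_def)

lemma moment_0: "moment 0 \<xi> = \<phi> (\<lambda>x. 1)"
  by (simp add: moment_def)

lemma smooth_dp_reflect: "smooth (\<lambda>z. dp n (of_real (\<xi> \<bullet> (- z))))"
  using smooth_dp[of n "- \<xi>"] by simp

text \<open>Expand the translate by \<open>- z\<close> with \<open>psum_symb_shift_op\<close> and
  apply \<open>\<phi>\<close> in the variable \<open>z\<close>.\<close>

lemma psum_symb_moment_op: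
  "psum (symb l Y (coeff_op 0 moment L)) x = \<phi> (\<lambda>z. psum (symb l Y L) (x - z))"
proof -
  let ?e = "\<lambda>p a z. dp (int a) (of_real (snd (snd p) \<bullet> (- z))) * dp (fst (snd p) - int a - int l) (of_real (snd (snd p) \<bullet> x))"
  have sm: "smooth (\<lambda>z. ?e p a z)" for p :: "complex \<times> int \<times> (real ^ 'n)" and a
    by (intro smooth_mult smooth_const smooth_dp_reflect)
  have "psum (symb l Y L) (x - z) = (\<Sum>p\<leftarrow>L. Y (snd (snd p)) * fst p * (\<Sum>a\<in>{0..<Suc (nat (fst (snd p)))}. ?e p a z))" for z
    using psum_symb_shift_op[of l Y "- z" L x] unfolding shift_op_def psum_symb_coeff_op by (simp only: diff_conv_add_uminus)
  then have "\<phi> (\<lambda>z. psum (symb l Y L) (x - z)) =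
      \<phi> (\<lambda>z. \<Sum>p\<leftarrow>L. Y (snd (snd p)) * fst p * (\<Sum>a\<in>{0..<Suc (nat (fst (snd p)))}. ?e p a z))"
    by (simp only:)
  also have "\<dots> = (\<Sum>p\<leftarrow>L. \<phi> (\<lambda>z. Y (snd (snd p)) * fst p * (\<Sum>a\<in>{0..<Suc (nat (fst (snd p)))}. ?e p a z)))"
    by (rule phi_sum_list) (intro smooth_mult[OF smooth_const smooth_sum] sm)
  also have "\<dots> = (\<Sum>p\<leftarrow>L. Y (snd (snd p)) * fst p * (\<Sum>a\<in>{0..<Suc (nat (fst (snd p)))}. \<phi> (\<lambda>z. ?e p a z)))"
    by (simp only: phi_cmult[OF smooth_sum[OF sm]] phi_sum[OF sm])
  also have "\<dots> = psum (symb l Y (coeff_op 0 moment L)) x"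
    unfolding psum_symb_coeff_op
  proof (intro arg_cong[of _ _ sum_list] map_cong refl arg_cong2[of _ _ _ _ "(*)"] sum.cong)
    fix p :: "complex \<times> int \<times> (real ^ 'n)" and a
    have "\<phi> (\<lambda>z. dp (fst (snd p) - int a - int l) (of_real (snd (snd p) \<bullet> x)) * dp (int a) (of_real (snd (snd p) \<bullet> (- z)))) =
      dp (fst (snd p) - int a - int l) (of_real (snd (snd p) \<bullet> x)) * moment a (snd (snd p))"
      unfolding moment_def by (rule phi_cmult[OF smooth_dp_reflect])
    then show "\<phi> (\<lambda>z. ?e p a z) = moment a (snd (snd p)) * dp (fst (snd p) - int a - int l) (of_real (snd (snd p) \<bullet> x))"
      by (simp only: mult.commute)
  qed
  finally show ?thesis
    by simp
qed

lemma psum_moment_op: "psum (coeff_op 0 moment L) x = \<phi> (\<lambda>z. psum L (x - z))"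
  using psum_symb_moment_op[of 0 "\<lambda>_. 1" L x] by (simp add: symb_trivial)

text \<open>The term of index 0 is multiplication by the mean of \<open>\<phi>\<close>; all others
  lower the exponent and form the nilpotent part of the convolution.\<close>

lemma psum_symb_moment_split:
  assumes "\<forall>p\<in>set L. 0 \<le> fst (snd p)"
  shows "psum (symb l Y (coeff_op 0 moment L)) x = \<phi> (\<lambda>x. 1) * psum (symb l Y L) x + psum (symb l Y (coeff_op 1 moment L)) x"
proof -
  have "(\<Sum>a\<in>{0..<Suc n}. moment a \<xi> * dp (d - int a - int l) z) =
     \<phi> (\<lambda>x. 1) * dp (d - int l) z + (\<Sum>a\<in>{1..<Suc n}. moment a \<xi> * dp (d - int a - int l) z)" for n \<xi> d z
    by (subst sum.atLeast_Suc_lessThan) (simp_all add: moment_0 del: sum.op_ivl_Suc)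
  then show ?thesis
    unfolding psum_symb_coeff_op psum_symb[of l Y L] sum_list_const_mult[symmetric] sum_list_add[symmetric]
    by (simp only: distrib_left mult_ac)
qed

lemma smooth_reflect_psum: "smooth (\<lambda>z. psum L ((x :: real ^ 'n) - z))"
proof -
  have "smooth (\<lambda>z. \<Sum>p\<leftarrow>L. fst p * dp (fst (snd p)) (of_real (snd (snd p) \<bullet> (x - z))))"
  proof (intro smooth_sum_list smooth_mult smooth_const)
    fix p :: "complex \<times> int \<times> (real ^ 'n)"
    show "smooth (\<lambda>z. dp (fst (snd p)) (of_real (snd (snd p) \<bullet> (x - z))))"
      using smooth_translate[OF smooth_dp_reflect[of "fst (snd p)" "snd (snd p)"], of "- x"] by simp
  qed
  then show ?thesis
    by (simp only: psum_eq)
qed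

text \<open>Convolution commutes with both operators and so preserves the mixed equation;
  subtracting a multiple of the identity gives the same for the nilpotent part.\<close>

lemma valid_moment_op:
  assumes L: "valid L"
  shows "valid (coeff_op 0 moment L)" "valid (coeff_op 1 moment L)"
proof -
  have "psum (symX (coeff_op 0 moment L)) x + psum (symW (coeff_op 0 moment L)) x =
      \<phi> (\<lambda>z. psum (symX L) (x - z) + psum (symW L) (x - z))" for x
  proof -
    show ?thesis
      unfolding psum_symb_moment_op by (rule phi_add[OF smooth_reflect_psum smooth_reflect_psum, symmetric])
  qed
  then have eq0: "psum (symX (coeff_op 0 moment L)) x + psum (symW (coeff_op 0 moment L)) x = 0" for x
    by (simp add: validD(4)[OF L])
  then show "valid (coeff_op 0 moment L)"
    by (intro valid_coeff_op L moment_in_K)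
  have nn: "\<forall>p\<in>set L. 0 \<le> fst (snd p)"
    using validD(2)[OF L] by blast
  have "psum (symX (coeff_op 1 moment L)) x + psum (symW (coeff_op 1 moment L)) x = 0" for x
  proof -
    have "c + d = 0" if "\<mu> * a + c + (\<mu> * b + d) = 0" "a + b = 0" for a b c d \<mu> :: complex
    proof -
      have "\<mu> * a + c + (\<mu> * b + d) = \<mu> * (a + b) + (c + d)"
        by (simp only: distrib_left ac_simps)
      then show ?thesis
        using that by simp
    qed
    from this[OF eq0[of x, unfolded psum_symb_moment_split[OF nn]] validD(4)[OF L]] show ?thesis .
  qed
  then show "valid (coeff_op 1 moment L)"
    by (intro valid_coeff_op L moment_in_K)
qed

end

context elliptic
begin

text \<open>Induction on a bound for the exponents. Division by the mean solves the equation up to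
  the nilpotent part, whose exponents are smaller, and the induction hypothesis corrects this error
  inside the solution space.\<close>

lemma convolution_surjective:
  assumes "valid L"
  shows "\<exists>L'. valid L' \<and> (\<forall>x. psum (coeff_op 0 moment L') x = psum L x)"
proof -
  have "\<forall>L. valid L \<and> (\<forall>p\<in>set L. fst (snd p) < int N) \<longrightarrow>
      (\<exists>L'. valid L' \<and> (\<forall>x. psum (coeff_op 0 moment L') x = psum L x))" for N
  proof (induction N)
    case 0
    show ?case
    proof (intro allI impI)
      fix L assume L: "valid L \<and> (\<forall>p\<in>set L. fst (snd p) < int 0)"
      \<comment> \<open>A valid list has no negative exponents.\<close>
      have "L = []"
      proof (rule ccontr)
        assume "L \<noteq> []"
        then obtain p where "p \<in> set L"
          using hd_in_set by blast
        then show False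
          using L validD(2)[of L p] by auto
      qed
      then show "\<exists>L'. valid L' \<and> (\<forall>x. psum (coeff_op 0 moment L') x = psum L x)"
        by (intro exI[of _ "[]"]) (simp add: valid_Nil coeff_op_def)
    qed
  next
    case (Suc N)
    show ?case
    proof (intro allI impI)
      fix L assume L: "valid L \<and> (\<forall>p\<in>set L. fst (snd p) < int (Suc N))"
      define \<mu> where "\<mu> = \<phi> (\<lambda>x. 1)"
      have \<mu>: "\<mu> \<noteq> 0"
        using phi_1 by (auto simp: \<mu>_def)
      have \<mu>K: "\<mu> \<in> K" "inverse \<mu> \<in> K" "- 1 \<in> K"
        using moment_in_K[of 0 0] K by (auto simp: moment_0 \<mu>_def)
      define L1 where "L1 = map (\<lambda>(b, n, \<xi>). (inverse \<mu> * b, n, \<xi>)) L"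
      have L1: "valid L1"
        unfolding L1_def using L \<mu>K by (intro valid_cmult) auto
      have L1_deg: "fst (snd p) < int (Suc N)" if "p \<in> set L1" for p
        using that L by (auto simp: L1_def)
      have T1: "valid (coeff_op 1 moment L1)"
        by (rule valid_moment_op(2)[OF L1])
      have "fst (snd p) < int N" if p: "p \<in> set (coeff_op 1 moment L1)" for p
      proof -
        obtain p' a where "p' \<in> set L1" "1 \<le> a" "a < Suc (nat (fst (snd p')))"
          "p = (fst p' * moment a (snd (snd p')), fst (snd p') - int a, snd (snd p'))"
          using p by (rule set_coeff_op)
        then show ?thesis
          using L1_deg[of p'] by auto
      qed
      then obtain L2 where L2: "valid L2" "\<And>x. psum (coeff_op 0 moment L2) x = psum (coeff_op 1 moment L1) x"
        using Suc.IH T1 by blast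
      define L' where "L' = L1 @ map (\<lambda>(b, n, \<xi>). (- 1 * b, n, \<xi>)) L2"
      have "valid L'"
        unfolding L'_def by (intro valid_append L1 valid_cmult L2 \<mu>K)
      moreover have "psum (coeff_op 0 moment L') x = psum L x" for x
      proof -
        have nn: "\<forall>p\<in>set L1. 0 \<le> fst (snd p)"
          using validD(2)[OF L1] by blast
        have "psum (coeff_op 0 moment L') x = \<phi> (\<lambda>z. psum L1 (x - z) + (- 1) * psum L2 (x - z))"
          unfolding psum_moment_op L'_def psum_append psum_cmult ..
        also have "\<dots> = \<phi> (\<lambda>z. psum L1 (x - z)) + (- 1) * \<phi> (\<lambda>z. psum L2 (x - z))"
          unfolding phi_add[OF smooth_reflect_psum smooth_mult[OF smooth_const smooth_reflect_psum]]
            phi_cmult[OF smooth_reflect_psum] ..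
        also have "\<dots> = psum (coeff_op 0 moment L1) x - psum (coeff_op 1 moment L1) x"
          by (simp add: psum_moment_op[symmetric] L2(2))
        also have "\<dots> = \<mu> * psum L1 x"
          using psum_symb_moment_split[OF nn, of 0 "\<lambda>_. 1" x] by (simp add: symb_trivial \<mu>_def)
        also have "\<dots> = psum L x"
          unfolding L1_def psum_cmult using \<mu> by simp
        finally show ?thesis .
      qed
      ultimately show "\<exists>L'. valid L' \<and> (\<forall>x. psum (coeff_op 0 moment L') x = psum L x)"
        by blast
    qed
  qed
  from this[of "Suc (2 * m)"] show ?thesis
    using assms validD(3)[OF assms] by fastforce
qed

text \<open>The coefficients are the values at integer points of a preimage \<open>L'\<close> of
  \<open>L\<close> under convolution. The sum then samples \<open>g\<close> on the lattice, and
  \<open>has_sum_lattice\<close> evaluates it: the Fourier coefficients of \<open>g\<close> at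
  nonzero \<open>l\<close> vanish by the moment conditions for the translates of
  \<open>L'\<close>.\<close>

lemma valid_reproduced:
  assumes L: "valid L"
  shows "\<exists>c. range c \<subseteq> K \<and> shift_combination \<phi> c (psum L)"
proof -
  obtain L' where L': "valid L'" "\<And>x. psum (coeff_op 0 moment L') x = psum L x"
    using convolution_surjective[OF L] by blast
  define c where "c k = psum L' (ivec k)" for k
  have "range c \<subseteq> K"
    using validD(1)[OF L'(1)] by (auto simp: c_def intro!: psum_in[OF K])
  moreover have "shift_combination \<phi> c (psum L)"
    unfolding shift_combination_def
  proof (intro allI impI)
    fix \<psi> :: "real ^ 'n \<Rightarrow> complex" assume "test_function \<psi>"
    then have \<psi>: "smooth \<psi>" and "bounded {x. \<psi> x \<noteq> 0}"
      by (simp_all add: test_function_def)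
    then obtain \<rho> where \<rho>': "\<forall>x\<in>{x. \<psi> x \<noteq> 0}. norm x \<le> \<rho>"
      unfolding bounded_iff by blast
    have \<rho>: "\<psi> x = 0" if "\<rho> < norm x" for x
      using \<rho>' that by (auto simp: not_le[symmetric])
    define g where "g y = psum L' y * \<phi> (\<lambda>x. \<psi> (x + y))" for y
    have "\<exists>R. \<forall>y. R < norm y \<longrightarrow> \<phi> (\<lambda>x. \<psi> (x + y)) = 0"
      by (rule convolution_support[OF \<psi> \<rho>])
    then obtain R' where R': "\<forall>y. R' < norm y \<longrightarrow> \<phi> (\<lambda>x. \<psi> (x + y)) = 0"
      by (elim exE)
    have g: "continuous_on UNIV g" "\<And>y. R' < norm y \<Longrightarrow> g y = 0"
      unfolding g_def using R' by (auto intro!: continuous_on_mult phi_continuous[OF \<psi>] smooth_continuous[OF smooth_psum])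
    have conv: "(LINT y|lborel. g y * char l y) = (LINT u|lborel. \<phi> (\<lambda>x. psum L' (u - x) * char l (u - x)) * \<psi> u)" for l
    proof -
      obtain M where M: "\<forall>p\<in>set L'. fst (snd p) \<le> int M"
        using degree_bound by blast
      \<comment> \<open>One separated term for each entry of the list and each power in its binomial
        expansion.\<close>
      let ?I = "{0..<length L'} \<times> {..M}"
      define \<alpha> where "\<alpha> = (\<lambda>(i, a) u. fst (L' ! i) * dp (fst (snd (L' ! i)) - int a) (of_real (snd (snd (L' ! i)) \<bullet> u)) * char l u)"
      define \<beta> where "\<beta> = (\<lambda>(i, a) x. dp (int a) (of_real (snd (snd (L' ! i)) \<bullet> (- x))) * char (- l) x)"
      have charneg: "char l (- x) = char (- l) x" for x
        by (simp add: char_def ivec_minus)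
      have "(LINT y|lborel. (psum L' y * char l y) * \<phi> (\<lambda>x. \<psi> (x + y))) = (LINT u|lborel. \<phi> (\<lambda>x. psum L' (u - x) * char l (u - x)) * \<psi> u)"
      proof (rule convolution_integral[OF \<psi> \<rho>, where I = ?I and \<alpha> = \<alpha> and \<beta> = \<beta>])
        show "continuous_on UNIV (\<lambda>y. psum L' y * char l y)"
          by (intro continuous_on_mult smooth_continuous smooth_psum continuous_char)
        show "finite ?I"
          by simp
        show "psum L' (u - x) * char l (u - x) = (\<Sum>j\<in>?I. \<alpha> j u * \<beta> j x)" for u x
        proof -
          have "psum L' (u - x) = (\<Sum>i\<in>{0..<length L'}. fst (L' ! i) * dp (fst (snd (L' ! i))) (of_real (snd (snd (L' ! i)) \<bullet> (u - x))))"
            by (simp add: psum_eq sum_list_sum_nth)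
          also have "\<dots> = (\<Sum>i\<in>{0..<length L'}. \<Sum>a\<le>M. fst (L' ! i) * (dp (int a) (of_real (snd (snd (L' ! i)) \<bullet> (- x))) *
              dp (fst (snd (L' ! i)) - int a) (of_real (snd (snd (L' ! i)) \<bullet> u))))"
          proof (rule sum.cong[OF refl])
            fix i assume "i \<in> {0..<length L'}"
            then have "fst (snd (L' ! i)) \<le> int M"
              using M by simp
            from dp_add[OF this, of "of_real (snd (snd (L' ! i)) \<bullet> (- x))" "of_real (snd (snd (L' ! i)) \<bullet> u)"]
            show "fst (L' ! i) * dp (fst (snd (L' ! i))) (of_real (snd (snd (L' ! i)) \<bullet> (u - x))) =
              (\<Sum>a\<le>M. fst (L' ! i) * (dp (int a) (of_real (snd (snd (L' ! i)) \<bullet> (- x))) *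
              dp (fst (snd (L' ! i)) - int a) (of_real (snd (snd (L' ! i)) \<bullet> u))))"
              by (simp add: inner_diff_right sum_distrib_left)
          qed
          finally have eq: "psum L' (u - x) = (\<Sum>i\<in>{0..<length L'}. \<Sum>a\<le>M. fst (L' ! i) * (dp (int a) (of_real (snd (snd (L' ! i)) \<bullet> (- x))) *
              dp (fst (snd (L' ! i)) - int a) (of_real (snd (snd (L' ! i)) \<bullet> u))))" .
          have "psum L' (u - x) * (char l u * char (- l) x) = (\<Sum>i\<in>{0..<length L'}. \<Sum>a\<le>M. \<alpha> (i, a) u * \<beta> (i, a) x)"
            unfolding eq sum_distrib_right \<alpha>_def \<beta>_def prod.case by (intro sum.cong refl) (simp only: mult_ac)
          moreover have "char l (u - x) = char l u * char (- l) x"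
            using char_add_right[of l u "- x"] by (simp add: charneg)
          ultimately show ?thesis
            by (simp add: sum.cartesian_product split_beta)
        qed
        show "continuous_on UNIV (\<alpha> j)" for j
          unfolding \<alpha>_def split_beta
          by (intro continuous_on_mult continuous_on_const smooth_continuous[OF smooth_dp] continuous_char)
        show "smooth (\<beta> j)" for j
          unfolding \<beta>_def split_beta by (intro smooth_mult smooth_dp_reflect smooth_char)
      qed
      then show ?thesis
        by (simp add: g_def mult_ac)
    qed
    have ft: "(LINT y|lborel. g y * char l y) = 0" if l: "l \<noteq> 0" for l
    proof -
      have "\<phi> (\<lambda>x. psum L' (u - x) * char l (u - x)) = 0" for u
      proof -
        \<comment> \<open>Translation by \<open>u\<close> stays in the solution space and leaves the
          reflected argument required by \<open>vanishing_moments\<close>; the character contributes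
          a constant and changes \<open>l\<close> to \<open>- l\<close>.\<close>
        have "psum L' (u - x) * char l (u - x) = char l u * (psum (shift_op u L') (- x) * char (- l) x)" for x
        proof -
          have "psum (shift_op u L') (- x) = psum L' (u - x)"
            using psum_symb_shift_op[of 0 "\<lambda>_. 1" u L' "- x"] by (simp add: symb_trivial)
          moreover have "char l (u - x) = char l u * char (- l) x"
            using char_add_right[of l u "- x"] by (simp add: char_def ivec_minus)
          ultimately show ?thesis
            by simp
        qed
        moreover have "smooth (\<lambda>x. psum (shift_op u L') (- x) * char (- l) x)"
          using smooth_mult[OF smooth_reflect_psum[of _ 0] smooth_char] by simp
        ultimately show ?thesis
          using vanishing_moments[OF valid_shift_op[OF L'(1)], of "- l" u] l by (simp add: phi_cmult)
      qed
      then show ?thesis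
        by (simp add: conv)
    qed
    have "((\<lambda>k. g (ivec k)) has_sum (LINT y|lborel. g y)) UNIV"
    proof (rule has_sum_lattice)
      show "continuous_on UNIV g"
        by (rule g(1))
      show "g y = 0" if "R' < norm y" for y
        using that by (rule g(2))
      show "(LINT y|lborel. g y * char l y) = 0" if "l \<noteq> 0" for l
        using that by (rule ft)
    qed
    moreover have "(LINT y|lborel. g y) = (LINT x|lborel. psum L x * \<psi> x)"
      using conv[of 0] by (simp add: psum_moment_op[symmetric] L'(2))
    ultimately show "((\<lambda>k. c k * \<phi> (\<lambda>x. \<psi> (x + ivec k))) has_sum (LINT x|lborel. psum L x * \<psi> x)) UNIV"
      by (simp add: c_def g_def)
  qed
  ultimately show ?thesis
    by blast
qed

end

theorem theorem4p7:
  fixes K :: "complex set"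
    and m k :: nat
    and X :: "(nat ^ 'n) \<Rightarrow>\<^sub>0 real"
    and A U Q :: "real ^ 'n ^ 'n"
    and S :: "(real ^ 'n) set"
    and G :: "int \<Rightarrow> complex ^ 'n \<Rightarrow> complex"
    and C :: "int \<Rightarrow> real"
    and R :: "int \<Rightarrow> nat ^ 'n \<Rightarrow> real"
    and \<phi> :: "(real ^ 'n \<Rightarrow> complex) \<Rightarrow> complex"
  assumes K: "K = \<real> \<or> K = UNIV"
    and X: "X \<in> homog_polys k" "X \<noteq> 0"
    and k: "1 \<le> k" "k \<le> 2 * m - 1"
    and A: "dilation_matrix A" "isotropic A" "isotropic_factorization A U Q"
    and S: "digit_set (transpose A) S"
    and G: "\<And>j. trig_poly K (G j)"
    and G_nonzero: "\<And>j s. s \<in> S - {0} \<Longrightarrow> G j (cvec ((2 * pi) *\<^sub>R s)) \<noteq> 0"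
    and C: "\<And>j. C j \<noteq> 0"
    and R: "\<And>j. series_order (R j) > enat (2 * m)"
    and Maclaurin: "\<And>j \<xi>. ((\<lambda>\<kappa>. of_real (R j \<kappa> * mono_at \<kappa> (mat_powi (inv_transp A) j *v \<xi>))) has_sum
          (G j (cvec (mat_powi (inv_transp A) j *v \<xi>))
            - of_real (C j * (poly_at X \<xi> + poly_at (W_poly Q) \<xi> ^ m)))) UNIV"
    and kernels: "polys \<real> \<inter> (null_space (diff_op X) - null_space (diff_op (W_poly Q) ^^ m)) \<noteq> {}"
    and \<phi>: "scaling_function A (\<lambda>j. mask S (G j)) 0 \<phi>"
  shows "\<exists>V. poly_space K V \<and> reproduces K \<phi> V \<and> shift_invariant V \<and> \<not> scale_invariant V"
proof -
  have \<phi>_dist: "compact_distribution \<phi>"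
    and \<phi>_lim: "\<And>Z. compact Z \<Longrightarrow> uniform_limit Z
        (\<lambda>N \<zeta>. \<Prod>j = 1..N. mask S (G (int j)) (cmat (mat_powi (inv_transp A) (int j)) *v \<zeta>))
        (fourier \<phi>) sequentially"
    using \<phi> by (simp_all add: scaling_function_def)
  have k2: "k < 2 * m"
    using k by linarith
  note X_nonzero = X(2)
  interpret elliptic A U Q S \<phi> K m k X G C R
    by unfold_locales (use A S \<phi>_dist K X k2 G G_nonzero C R Maclaurin \<phi>_lim in \<open>simp_all\<close>)
  define V where "V = {psum L | L. valid L}"
  have "poly_space K V"
    unfolding poly_space_def
  proof (intro conjI ballI)
    show "V \<subseteq> polys K"
    proof
      fix P assume "P \<in> V"
      then obtain L where L: "valid L" "P = psum L"
        by (auto simp: V_def)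
      have "psum L x \<in> K" for x
        by (rule psum_in[OF K]) (use validD(1)[OF L(1)] in blast)
      then show "P \<in> polys K"
        by (auto simp: L(2) polys_def polynomial_function_psum)
    qed
    show "(\<lambda>_. 0) \<in> V"
      using valid_Nil by (auto simp: V_def intro!: exI[of _ "[]"])
    show "(\<lambda>x. P x + P' x) \<in> V" if P: "P \<in> V" "P' \<in> V" for P P'
    proof -
      obtain L L' where "valid L" "P = psum L" "valid L'" "P' = psum L'"
        using P unfolding V_def by blast
      then show ?thesis
        unfolding V_def by (auto simp: psum_append[symmetric] intro!: exI[of _ "L @ L'"] valid_append)
    qed
    show "(\<lambda>x. c * P x) \<in> V" if c: "c \<in> K" and P: "P \<in> V" for c P
    proof -
      obtain L where L: "valid L" "P = psum L"
        using P by (auto simp: V_def)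
      have "(\<lambda>x. c * P x) = psum (map (\<lambda>(b, n, \<xi>). (c * b, n, \<xi>)) L)"
        by (rule ext) (simp only: L(2) psum_cmult)
      then show ?thesis
        unfolding V_def using valid_cmult[OF L(1) c] by blast
    qed
  qed
  moreover have "reproduces K \<phi> V"
    unfolding reproduces_def V_def using valid_reproduced by blast
  moreover have "shift_invariant V"
    unfolding shift_invariant_def
  proof (intro ballI allI)
    fix P h assume "P \<in> V"
    then obtain L where L: "valid L" "P = psum L"
      by (auto simp: V_def)
    have "(\<lambda>x. P (x + h)) = psum (shift_op h L)"
      using psum_symb_shift_op[of 0 "\<lambda>_. 1" h L] by (simp add: symb_trivial L(2) fun_eq_iff)
    then show "(\<lambda>x. P (x + h)) \<in> V"
      unfolding V_def using valid_shift_op[OF L(1)] by blast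
  qed
  moreover have "\<not> scale_invariant V"
  proof -
    obtain P where P: "P \<in> polys \<real>" "P \<in> null_space (diff_op X)" "P \<notin> null_space (diff_op (W_poly Q) ^^ m)"
      using kernels by blast
    \<comment> \<open>\<open>P\<close> is real-valued, so passing to its real part loses nothing and
      yields a list with real coefficients.\<close>
    have "real_polynomial_function (Re \<circ> P)"
      using P(1) bounded_linear_Re by (simp add: polys_def polynomial_function_def)
    from power_span_real_polynomial[OF this]
    obtain L0 where L0: "\<forall>p\<in>set L0. fst p \<in> \<real>" "(\<lambda>x. of_real ((Re \<circ> P) x)) = psum L0"
      unfolding power_span_def by blast
    have "P x = of_real ((Re \<circ> P) x)" for x
    proof -
      have "P x \<in> \<real>"
        using P(1) by (auto simp: polys_def)
      then show ?thesis
        by simp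
    qed
    then have PL: "P = psum L0"
      using L0(2) by (simp add: fun_eq_iff)
    have ker: "psum (symX L0) x = 0" for x
    proof -
      have "diff_op X P = (\<lambda>_. 0)"
        using P(2) by (simp add: null_space_def)
      then show ?thesis
        unfolding PL diff_op_X by (rule fun_cong)
    qed
    have "(diff_op (W_poly Q) ^^ m) P \<noteq> (\<lambda>_. 0)"
      using P(3) by (simp add: null_space_def)
    then obtain x0 where x0: "psum (symW L0) x0 \<noteq> 0"
      unfolding PL diff_op_W by (auto simp: fun_eq_iff)
    obtain \<xi>1 where \<xi>1: "Xf \<xi>1 \<noteq> 0"
      by (rule poly_at_nonzero[OF X_nonzero])
    have Y1: "X_symb k Xf \<xi>1 \<noteq> 0"
      using \<xi>1 by (simp add: X_symb_def)
    have Z: "X_symb (2 * m) Wf \<xi> \<in> \<real>" for \<xi>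
      by (simp add: X_symb_def power_mult)
    \<comment> \<open>For real scalars the cancelling coefficient is real because \<open>k\<close>
      is even.\<close>
    have K': "K = UNIV \<or> (K = \<real> \<and> X_symb k Xf \<xi>1 \<in> \<real>)"
    proof (cases "K = UNIV")
      case False
      then have KR: "K = \<real>"
        using K by blast
      then obtain i where "k = 2 * i"
        using even_k[OF KR \<xi>1] by (auto elim: evenE)
      then have "X_symb k Xf \<xi>1 \<in> \<real>"
        by (simp add: X_symb_def power_mult)
      then show ?thesis
        using KR by simp
    qed simp
    \<comment> \<open>By \<open>psum_scale\<close>, this list represents the polynomial dilated by
      2.\<close>
    let ?s = "map (\<lambda>(b, n, \<xi>). (of_real 2 ^ nat n * b, n, \<xi>))"
    have "\<exists>L. (\<forall>p\<in>set L. fst p \<in> K \<and> 0 \<le> fst (snd p) \<and> fst (snd p) \<le> int (2 * m)) \<and>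
        (\<forall>x. psum (symX L) x + psum (symW L) x = 0) \<and>
        psum (symX (?s L)) 0 + psum (symW (?s L)) 0 \<noteq> 0"
    proof (rule exists_unscalable_solution[where Y = "X_symb k Xf" and Z = "X_symb (2 * m) Wf", OF L0(1) ker x0 k2 Y1 Z K'], goal_cases)
      case (1 L)
      then show ?case
        by (intro exI[of _ L] conjI allI)
    qed
    then obtain L where L: "\<forall>p\<in>set L. fst p \<in> K \<and> 0 \<le> fst (snd p) \<and> fst (snd p) \<le> int (2 * m)"
      and eq: "\<forall>x. psum (symX L) x + psum (symW L) x = 0"
      and ne: "psum (symX (?s L)) 0 + psum (symW (?s L)) 0 \<noteq> 0"
      by (elim exE conjE)
    have "valid L"
      using L eq by (simp add: valid_def)
    then have "psum L \<in> V"
      by (auto simp: V_def)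
    moreover have "(\<lambda>x. psum L (2 *\<^sub>R x)) \<notin> V"
    proof
      assume "(\<lambda>x. psum L (2 *\<^sub>R x)) \<in> V"
      then obtain L2 where L2: "valid L2" "(\<lambda>x. psum L (2 *\<^sub>R x)) = psum L2"
        by (auto simp: V_def)
      \<comment> \<open>The lists may differ but define the same polynomial. Through the
        differential operators the mixed equation of \<open>L2\<close> would transfer to the dilated
        list, where it fails at the origin.\<close>
      have "psum (?s L) = psum L2"
        unfolding L2(2)[symmetric] by (rule ext) (rule psum_scale)
      then have "psum (symX (?s L)) = psum (symX L2)" "psum (symW (?s L)) = psum (symW L2)"
        unfolding diff_op_X[symmetric] diff_op_W[symmetric] by (simp_all only:)
      then show False
        using ne validD(4)[OF L2(1), of 0] by (simp only:)
    qed
    ultimately show ?thesis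
      unfolding scale_invariant_def by (metis zero_neq_numeral)
  qed
  ultimately show ?thesis
    by blast
qed

end
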